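(* Let $\mathbb{K}$ be a field and let $R$ be a commutative augmented Koszul $\mathbb{K}$-algebra. If $A$ is a semi-commutative skew PBW extension of $R$, then $A$ is $R$-augmented Koszul.
   Context: Skew PBW extension: Let $R$ and $A$ be rings. $A$ is a skew PBW extension of $R$, written $A=\sigma(R)\langle x_1,\dots,x_n\rangle$, if: (i) $R\subseteq A$; (ii) there exist $x_1,\dots,x_n\in A$ such that $A$ is a free left $R$-module with basis $\mathrm{Mon}(A)=\{x^{\alpha}=x_1^{\alpha_1}\cdots x_n^{\alpha_n}\mid \alpha\in\mathbb{N}^n\}$ (with $x_1^0\cdots x_n^0=1$); (iii) for each $1\le i\le n$ and $r\in R\setminus\{0\}$ there is $c_{i,r}\in R\setminus\{0\}$ with $x_ir-c_{i,r}x_i\in R$; (iv) for all $1\le i,j\le n$ there is $c_{i,j}\in R\setminus\{0\}$ with $x_jx_i-c_{i,j}x_ix_j\in R+Rx_1+\cdots+Rx_n$. For such $A$ there are, for each $i$, an injective endomorphism $\sigma_i:R\to R$ and a $\sigma_i$-derivation $\delta_i:R\to R$ with $x_ir=\sigma_i(r)x_i+\delta_i(r)$ for all $r\in R$. $A$ is constant if $\sigma_i(r)=r$ and $\delta_i(r)=0$ for all $r\in R$ and all $i$. $A$ is quasi-commutative if (iii) and (iv) are replaced by: for each $i$ and $r\in R\setminus\{0\}$ there is $c_{i,r}\in R\setminus\{0\}$ with $x_ir=c_{i,r}x_i$; and for all $i,j$ there is $c_{i,j}\in R\setminus\{0\}$ with $x_jx_i=c_{i,j}x_ix_j$. $A$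 is semi-commutative if it is quasi-commutative and constant. Augmented algebras: Let $R$ be a $\mathbb{K}$-algebra. An $R$-algebra $A$ is $R$-augmented if there is an ideal $A_+\subset A$ with $A=A_+\oplus R\cdot1$ as $R$-module; then $R$ is regarded as the $A$-module $A/A_+$. A $\mathbb{K}$-algebra is augmented if it is $\mathbb{K}$-augmented in this sense. For an $R$-augmented algebra $A$, a grading $A=\bigoplus_{n\ge0}A_n$ is compatible with the augmentation if $A=T_R(V)/I$ for some finite-dimensional $R$-bimodule $V$ (finite-dimensional over $\mathbb{K}$ when $R=\mathbb{K}$; for general $R$ understood as finitely generated) and some finitely generated homogeneous ideal $I\subset\sum_{i\ge2}V^{\otimes i}$, with $A_n=V^{\otimes n}$ mod $I$ and $A_+=\bigoplus_{n>0}A_n$. Here $T_R(V)$ is the tensor algebra of $V$ over $R$. Koszulity: For an $R$-augmented algebra $A$, the Yoneda algebra is $E(A)=\mathrm{Ext}_A(R,R)=\bigoplus_m E^m(A)$, where $E^m(A)=\mathrm{Ext}^m_A(R,R)$, with the Yoneda product. $A$ is $\mathcal{K}_m$ if $E(A)$ is generated as an $R$-algebra by $E^1(A),\dots,E^m(A)$. If $A$ has a grading compatible with its augmentation and $A$ is $\mathcal{K}_1$, then $A$ is called $R$-augmented Koszul. "Augmented Koszul $\mathbb{K}$-algebra" means $\mathbb{K}$-augmented Koszul (the same definition with $\mathbb{K}$ as the base ring). *)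

theory Defs
  imports "HOL-Algebra.QuotRing" "HOL-Algebra.Generated_Rings"
begin

section \<open>Skew PBW extensions\<close>

definition exponents :: "nat \<Rightarrow> (nat \<Rightarrow> nat) set" where
  "exponents n = {\<alpha>. \<forall>i. i \<notin> {1..n} \<longrightarrow> \<alpha> i = 0}"

text \<open>\<open>x\<^sub>1\<^sup>\<alpha>\<^sup>1 \<cdots> x\<^sub>n\<^sup>\<alpha>\<^sup>n\<close>, with the factors in this order.\<close>

definition std_monomial :: "('a, 'm) ring_scheme \<Rightarrow> nat \<Rightarrow> (nat \<Rightarrow> 'a) \<Rightarrow> (nat \<Rightarrow> nat) \<Rightarrow> 'a" where
  "std_monomial A n x \<alpha> =
     foldr (\<lambda>i a. (x i [^]\<^bsub>A\<^esub> \<alpha> i) \<otimes>\<^bsub>A\<^esub> a) [1..<Suc n] \<one>\<^bsub>A\<^esub>"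

definition free_on_std_monomials ::
    "('a, 'm) ring_scheme \<Rightarrow> 'a set \<Rightarrow> nat \<Rightarrow> (nat \<Rightarrow> 'a) \<Rightarrow> bool" where
  "free_on_std_monomials A R n x \<longleftrightarrow>
     (\<forall>a\<in>carrier A. \<exists>!c.
        (\<forall>\<alpha>\<in>exponents n. c \<alpha> \<in> R) \<and> (\<forall>\<alpha>. \<alpha> \<notin> exponents n \<longrightarrow> c \<alpha> = \<zero>\<^bsub>A\<^esub>) \<and>
        finite {\<alpha>. c \<alpha> \<noteq> \<zero>\<^bsub>A\<^esub>} \<and>
        a = (\<Oplus>\<^bsub>A\<^esub>\<alpha>\<in>{\<alpha>. c \<alpha> \<noteq> \<zero>\<^bsub>A\<^esub>}. c \<alpha> \<otimes>\<^bsub>A\<^esub> std_monomial A n x \<alpha>))"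

definition skew_pbw_extension ::
    "('a, 'm) ring_scheme \<Rightarrow> 'a set \<Rightarrow> nat \<Rightarrow> (nat \<Rightarrow> 'a) \<Rightarrow> bool" where
  "skew_pbw_extension A R n x \<longleftrightarrow>
     ring A \<and> subring R A \<and>
     (\<forall>i\<in>{1..n}. x i \<in> carrier A) \<and> free_on_std_monomials A R n x \<and>
     (\<forall>i\<in>{1..n}. \<forall>r\<in>R - {\<zero>\<^bsub>A\<^esub>}. \<exists>c\<in>R - {\<zero>\<^bsub>A\<^esub>}.
        (x i \<otimes>\<^bsub>A\<^esub> r) \<ominus>\<^bsub>A\<^esub> (c \<otimes>\<^bsub>A\<^esub> x i) \<in> R) \<and>
     (\<forall>i\<in>{1..n}. \<forall>j\<in>{1..n}. \<exists>c\<in>R - {\<zero>\<^bsub>A\<^esub>}. \<exists>r\<in>{0..n} \<rightarrow> R.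
        (x j \<otimes>\<^bsub>A\<^esub> x i) \<ominus>\<^bsub>A\<^esub> (c \<otimes>\<^bsub>A\<^esub> (x i \<otimes>\<^bsub>A\<^esub> x j)) =
          r 0 \<oplus>\<^bsub>A\<^esub> (\<Oplus>\<^bsub>A\<^esub>k\<in>{1..n}. r k \<otimes>\<^bsub>A\<^esub> x k))"

text \<open>
  In a skew PBW extension every \<open>x\<^sub>i r\<close> has a unique expression \<open>\<sigma>\<^sub>i(r) x\<^sub>i + \<delta>\<^sub>i(r)\<close> with
  \<open>\<sigma>\<^sub>i(r), \<delta>\<^sub>i(r) \<in> R\<close>, because \<open>1\<close> and \<open>x\<^sub>i\<close> are distinct members of the basis.
\<close>

definition pbw_sigma :: "('a, 'm) ring_scheme \<Rightarrow> 'a set \<Rightarrow> (nat \<Rightarrow> 'a) \<Rightarrow> nat \<Rightarrow> 'a \<Rightarrow> 'a" where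
  "pbw_sigma A R x i r =
     (THE s. s \<in> R \<and> (\<exists>d\<in>R. x i \<otimes>\<^bsub>A\<^esub> r = (s \<otimes>\<^bsub>A\<^esub> x i) \<oplus>\<^bsub>A\<^esub> d))"

definition pbw_delta :: "('a, 'm) ring_scheme \<Rightarrow> 'a set \<Rightarrow> (nat \<Rightarrow> 'a) \<Rightarrow> nat \<Rightarrow> 'a \<Rightarrow> 'a" where
  "pbw_delta A R x i r =
     (THE d. d \<in> R \<and> (\<exists>s\<in>R. x i \<otimes>\<^bsub>A\<^esub> r = (s \<otimes>\<^bsub>A\<^esub> x i) \<oplus>\<^bsub>A\<^esub> d))"

definition pbw_constant ::
    "('a, 'm) ring_scheme \<Rightarrow> 'a set \<Rightarrow> nat \<Rightarrow> (nat \<Rightarrow> 'a) \<Rightarrow> bool" where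
  "pbw_constant A R n x \<longleftrightarrow>
     (\<forall>i\<in>{1..n}. \<forall>r\<in>R. pbw_sigma A R x i r = r \<and> pbw_delta A R x i r = \<zero>\<^bsub>A\<^esub>)"

text \<open>The two conditions below imply the last two conditions of \<open>skew_pbw_extension\<close>.\<close>

definition pbw_quasi_commutative ::
    "('a, 'm) ring_scheme \<Rightarrow> 'a set \<Rightarrow> nat \<Rightarrow> (nat \<Rightarrow> 'a) \<Rightarrow> bool" where
  "pbw_quasi_commutative A R n x \<longleftrightarrow>
     skew_pbw_extension A R n x \<and>
     (\<forall>i\<in>{1..n}. \<forall>r\<in>R - {\<zero>\<^bsub>A\<^esub>}. \<exists>c\<in>R - {\<zero>\<^bsub>A\<^esub>}.
        x i \<otimes>\<^bsub>A\<^esub> r = c \<otimes>\<^bsub>A\<^esub> x i) \<and>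
     (\<forall>i\<in>{1..n}. \<forall>j\<in>{1..n}. \<exists>c\<in>R - {\<zero>\<^bsub>A\<^esub>}.
        x j \<otimes>\<^bsub>A\<^esub> x i = c \<otimes>\<^bsub>A\<^esub> (x i \<otimes>\<^bsub>A\<^esub> x j))"

definition pbw_semi_commutative ::
    "('a, 'm) ring_scheme \<Rightarrow> 'a set \<Rightarrow> nat \<Rightarrow> (nat \<Rightarrow> 'a) \<Rightarrow> bool" where
  "pbw_semi_commutative A R n x \<longleftrightarrow> pbw_quasi_commutative A R n x \<and> pbw_constant A R n x"


section \<open>Algebras over a commutative ring and augmentations\<close>

text \<open>
  A (unital, associative, not necessarily commutative) algebra over a commutative ring \<open>B\<close> is a
  ring \<open>A\<close> with a ring homomorphism \<open>\<eta>\<close> from \<open>B\<close> into the centre of \<open>A\<close>; the scalar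
  multiplication is \<open>b \<cdot> a = \<eta> b a\<close>.
\<close>

definition central_algebra ::
    "('b, 'l) ring_scheme \<Rightarrow> ('a, 'm) ring_scheme \<Rightarrow> ('b \<Rightarrow> 'a) \<Rightarrow> bool" where
  "central_algebra B A \<eta> \<longleftrightarrow>
     cring B \<and> ring A \<and> \<eta> \<in> ring_hom B A \<and>
     (\<forall>b\<in>carrier B. \<forall>a\<in>carrier A. \<eta> b \<otimes>\<^bsub>A\<^esub> a = a \<otimes>\<^bsub>A\<^esub> \<eta> b)"

text \<open>
  \<open>A = A\<^sub>+ \<oplus> B \<cdot> 1\<close>. Uniqueness is required of \<open>b\<close> itself and not only of \<open>b \<cdot> 1\<close>, so that
  \<open>A / A\<^sub>+\<close> is identified with \<open>B\<close>.
\<close>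

definition augmentation_ideal ::
    "('b, 'l) ring_scheme \<Rightarrow> ('a, 'm) ring_scheme \<Rightarrow> ('b \<Rightarrow> 'a) \<Rightarrow> 'a set \<Rightarrow> bool" where
  "augmentation_ideal B A \<eta> Ap \<longleftrightarrow>
     ideal Ap A \<and>
     (\<forall>a\<in>carrier A. \<exists>!(p, b). p \<in> Ap \<and> b \<in> carrier B \<and> a = p \<oplus>\<^bsub>A\<^esub> \<eta> b)"


section \<open>The tensor algebra of a bimodule\<close>

text \<open>
  Modules and bimodules reuse the record of \<^theory>\<open>HOL-Algebra.Module\<close>, whose fields \<open>mult\<close> and
  \<open>one\<close> play no role.
\<close>

record ('b, 'v) bimodule = "('b, 'v) module" +
  rsmult :: "'v \<Rightarrow> 'b \<Rightarrow> 'v"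

definition is_bimodule :: "('b, 'l) ring_scheme \<Rightarrow> ('b, 'v) bimodule \<Rightarrow> bool" where
  "is_bimodule B V \<longleftrightarrow>
     ring B \<and> abelian_group V \<and>
     (\<forall>r\<in>carrier B. \<forall>v\<in>carrier V. r \<odot>\<^bsub>V\<^esub> v \<in> carrier V \<and> rsmult V v r \<in> carrier V) \<and>
     (\<forall>v\<in>carrier V. \<one>\<^bsub>B\<^esub> \<odot>\<^bsub>V\<^esub> v = v \<and> rsmult V v \<one>\<^bsub>B\<^esub> = v) \<and>
     (\<forall>r\<in>carrier B. \<forall>v\<in>carrier V. \<forall>w\<in>carrier V.
        r \<odot>\<^bsub>V\<^esub> (v \<oplus>\<^bsub>V\<^esub> w) = (r \<odot>\<^bsub>V\<^esub> v) \<oplus>\<^bsub>V\<^esub> (r \<odot>\<^bsub>V\<^esub> w) \<and>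
        rsmult V (v \<oplus>\<^bsub>V\<^esub> w) r = rsmult V v r \<oplus>\<^bsub>V\<^esub> rsmult V w r) \<and>
     (\<forall>r\<in>carrier B. \<forall>s\<in>carrier B. \<forall>v\<in>carrier V.
        (r \<oplus>\<^bsub>B\<^esub> s) \<odot>\<^bsub>V\<^esub> v = (r \<odot>\<^bsub>V\<^esub> v) \<oplus>\<^bsub>V\<^esub> (s \<odot>\<^bsub>V\<^esub> v) \<and>
        rsmult V v (r \<oplus>\<^bsub>B\<^esub> s) = rsmult V v r \<oplus>\<^bsub>V\<^esub> rsmult V v s \<and>
        (r \<otimes>\<^bsub>B\<^esub> s) \<odot>\<^bsub>V\<^esub> v = r \<odot>\<^bsub>V\<^esub> (s \<odot>\<^bsub>V\<^esub> v) \<and>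
        rsmult V v (r \<otimes>\<^bsub>B\<^esub> s) = rsmult V (rsmult V v r) s \<and>
        rsmult V (r \<odot>\<^bsub>V\<^esub> v) s = r \<odot>\<^bsub>V\<^esub> rsmult V v s)"

definition fin_gen_bimodule :: "('b, 'l) ring_scheme \<Rightarrow> ('b, 'v) bimodule \<Rightarrow> bool" where
  "fin_gen_bimodule B V \<longleftrightarrow>
     is_bimodule B V \<and>
     (\<exists>S. finite S \<and> S \<subseteq> carrier V \<and>
        (\<forall>v\<in>carrier V. \<exists>c\<in>S \<rightarrow> carrier B. v = (\<Oplus>\<^bsub>V\<^esub>s\<in>S. c s \<odot>\<^bsub>V\<^esub> s)))"

text \<open>
  The free ring \<open>\<int>\<langle>L\<rangle>\<close>: integer combinations of words over \<open>L\<close>, multiplied by concatenation.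
\<close>

definition free_ring :: "'x set \<Rightarrow> ('x list \<Rightarrow> int) ring" where
  "free_ring L =
     \<lparr> carrier = {f. finite {w. f w \<noteq> 0} \<and> (\<forall>w. f w \<noteq> 0 \<longrightarrow> set w \<subseteq> L)},
       monoid.mult = (\<lambda>f g w. \<Sum>i\<le>length w. f (take i w) * g (drop i w)),
       one = (\<lambda>w. if w = [] then 1 else 0),
       ring.zero = (\<lambda>w. 0),
       add = (\<lambda>f g w. f w + g w) \<rparr>"

definition letter :: "'x \<Rightarrow> 'x list \<Rightarrow> int" where
  "letter a = (\<lambda>w. if w = [a] then 1 else 0)"

text \<open>
  \<open>T\<^sub>B(V)\<close> is presented as the ring generated by letters for the elements of \<open>B\<close> (\<open>Inl\<close>) and of
  \<open>V\<close> (\<open>Inr\<close>), subject to the relations saying that \<open>B\<close> maps to it by a (unital) ring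
  homomorphism and \<open>V\<close> by a \<open>B\<close>-bimodule homomorphism.
\<close>

definition tensor_letters :: "('b, 'l) ring_scheme \<Rightarrow> ('b, 'v) bimodule \<Rightarrow> ('b + 'v) set" where
  "tensor_letters B V = Inl ` carrier B \<union> Inr ` carrier V"

definition tensor_relations ::
    "('b, 'l) ring_scheme \<Rightarrow> ('b, 'v) bimodule \<Rightarrow> (('b + 'v) list \<Rightarrow> int) set" where
  "tensor_relations B V =
     (let F = free_ring (tensor_letters B V); \<beta> = (\<lambda>r. letter (Inl r)); \<nu> = (\<lambda>v. letter (Inr v))
      in {\<beta> \<one>\<^bsub>B\<^esub> \<ominus>\<^bsub>F\<^esub> \<one>\<^bsub>F\<^esub>} \<union>
         {\<beta> (r \<oplus>\<^bsub>B\<^esub> s) \<ominus>\<^bsub>F\<^esub> (\<beta> r \<oplus>\<^bsub>F\<^esub> \<beta> s) | r s. r \<in> carrier B \<and> s \<in> carrier B} \<union>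
         {\<beta> (r \<otimes>\<^bsub>B\<^esub> s) \<ominus>\<^bsub>F\<^esub> (\<beta> r \<otimes>\<^bsub>F\<^esub> \<beta> s) | r s. r \<in> carrier B \<and> s \<in> carrier B} \<union>
         {\<nu> (v \<oplus>\<^bsub>V\<^esub> w) \<ominus>\<^bsub>F\<^esub> (\<nu> v \<oplus>\<^bsub>F\<^esub> \<nu> w) | v w. v \<in> carrier V \<and> w \<in> carrier V} \<union>
         {\<nu> (r \<odot>\<^bsub>V\<^esub> v) \<ominus>\<^bsub>F\<^esub> (\<beta> r \<otimes>\<^bsub>F\<^esub> \<nu> v) | r v. r \<in> carrier B \<and> v \<in> carrier V} \<union>
         {\<nu> (rsmult V v r) \<ominus>\<^bsub>F\<^esub> (\<nu> v \<otimes>\<^bsub>F\<^esub> \<beta> r) | r v. r \<in> carrier B \<and> v \<in> carrier V})"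

definition tensor_ideal ::
    "('b, 'l) ring_scheme \<Rightarrow> ('b, 'v) bimodule \<Rightarrow> (('b + 'v) list \<Rightarrow> int) set" where
  "tensor_ideal B V = Idl\<^bsub>free_ring (tensor_letters B V)\<^esub> (tensor_relations B V)"

definition tensor_algebra ::
    "('b, 'l) ring_scheme \<Rightarrow> ('b, 'v) bimodule \<Rightarrow> (('b + 'v) list \<Rightarrow> int) set ring" where
  "tensor_algebra B V = free_ring (tensor_letters B V) Quot tensor_ideal B V"

definition tensor_base ::
    "('b, 'l) ring_scheme \<Rightarrow> ('b, 'v) bimodule \<Rightarrow> 'b \<Rightarrow> (('b + 'v) list \<Rightarrow> int) set" where
  "tensor_base B V r = tensor_ideal B V +>\<^bsub>free_ring (tensor_letters B V)\<^esub> letter (Inl r)"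

text \<open>
  The summand \<open>V\<^bsup>\<otimes>n\<^esup>\<close> of \<open>T\<^sub>B(V)\<close>: the additive span of the products with exactly \<open>n\<close> factors from
  \<open>V\<close> (and any number of factors from \<open>B\<close>, so that \<open>V\<^bsup>\<otimes>0\<^esup> = B\<close>).
\<close>

definition tensor_power ::
    "('b, 'l) ring_scheme \<Rightarrow> ('b, 'v) bimodule \<Rightarrow> nat \<Rightarrow> (('b + 'v) list \<Rightarrow> int) set set" where
  "tensor_power B V n =
     {tensor_ideal B V +>\<^bsub>free_ring (tensor_letters B V)\<^esub> f | f.
        f \<in> carrier (free_ring (tensor_letters B V)) \<and>
        (\<forall>w. f w \<noteq> 0 \<longrightarrow> length (filter (\<lambda>a. \<not> isl a) w) = n)}"


section \<open>Gradings compatible with an augmentation\<close>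

text \<open>The sum \<open>\<Sum>\<^sub>i\<^sub>\<in>\<^sub>N D\<^sub>i\<close> of additive subgroups of a ring.\<close>

definition component_sum :: "('a, 'm) ring_scheme \<Rightarrow> (nat \<Rightarrow> 'a set) \<Rightarrow> nat set \<Rightarrow> 'a set" where
  "component_sum A D N =
     {(\<Oplus>\<^bsub>A\<^esub>i\<in>F. y i) | F y. finite F \<and> F \<subseteq> N \<and> (\<forall>i\<in>F. y i \<in> D i)}"

definition nat_grading ::
    "('b, 'l) ring_scheme \<Rightarrow> ('a, 'm) ring_scheme \<Rightarrow> ('b \<Rightarrow> 'a) \<Rightarrow> (nat \<Rightarrow> 'a set) \<Rightarrow> bool" where
  "nat_grading B A \<eta> D \<longleftrightarrow>
     (\<forall>n. additive_subgroup (D n) A) \<and>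
     \<eta> ` carrier B \<subseteq> D 0 \<and>
     (\<forall>i j. \<forall>a\<in>D i. \<forall>b\<in>D j. a \<otimes>\<^bsub>A\<^esub> b \<in> D (i + j)) \<and>
     (\<forall>a\<in>carrier A. \<exists>!y. (\<forall>n. y n \<in> D n) \<and> finite {n. y n \<noteq> \<zero>\<^bsub>A\<^esub>} \<and>
        a = (\<Oplus>\<^bsub>A\<^esub>n\<in>{n. y n \<noteq> \<zero>\<^bsub>A\<^esub>}. y n))"

text \<open>
  The equality \<open>A = T\<^sub>B(V)/I\<close> is an isomorphism \<open>h\<close> of \<open>B\<close>-algebras. Taking the carrier of \<open>V\<close> in the
  type of elements of \<open>A\<close> is no restriction: as \<open>I\<close> lives in degrees \<open>\<ge> 2\<close>, \<open>V\<close> is isomorphic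
  to \<open>D 1\<close>. For the same reason \<open>V\<close> is symmetric (\<open>r v = v r\<close>), so that being finitely generated
  as a left module or as a bimodule is the same.
\<close>

definition compatible_grading ::
    "('b, 'l) ring_scheme \<Rightarrow> ('a, 'm) ring_scheme \<Rightarrow> ('b \<Rightarrow> 'a) \<Rightarrow> 'a set \<Rightarrow> (nat \<Rightarrow> 'a set) \<Rightarrow> bool"
  where
  "compatible_grading B A \<eta> Ap D \<longleftrightarrow>
     nat_grading B A \<eta> D \<and>
     (\<exists>(V :: ('b, 'a) bimodule) I h.
        let T = tensor_algebra B V in
        fin_gen_bimodule B V \<and>
        ideal I T \<and> (\<exists>S. finite S \<and> S \<subseteq> carrier T \<and> I = Idl\<^bsub>T\<^esub> S) \<and>
        I = component_sum T (\<lambda>n. I \<inter> tensor_power B V n) UNIV \<and>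
        I \<subseteq> component_sum T (tensor_power B V) {2..} \<and>
        h \<in> ring_iso (T Quot I) A \<and>
        (\<forall>r\<in>carrier B. h (I +>\<^bsub>T\<^esub> tensor_base B V r) = \<eta> r) \<and>
        (\<forall>n. D n = (\<lambda>t. h (I +>\<^bsub>T\<^esub> t)) ` tensor_power B V n)) \<and>
     Ap = component_sum A D {1..}"


section \<open>Ext and the Yoneda algebra\<close>

definition left_module_hom ::
    "('a, 'm) ring_scheme \<Rightarrow> ('a, 'u) module \<Rightarrow> ('a, 'v) module \<Rightarrow> ('u \<Rightarrow> 'v) set" where
  "left_module_hom A M N =
     {f. f \<in> carrier M \<rightarrow> carrier N \<and>
         (\<forall>p\<in>carrier M. \<forall>q\<in>carrier M. f (p \<oplus>\<^bsub>M\<^esub> q) = f p \<oplus>\<^bsub>N\<^esub> f q) \<and>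
         (\<forall>a\<in>carrier A. \<forall>p\<in>carrier M. f (a \<odot>\<^bsub>M\<^esub> p) = a \<odot>\<^bsub>N\<^esub> f p)}"

definition free_left_module :: "('a, 'm) ring_scheme \<Rightarrow> 'i set \<Rightarrow> ('a, 'i \<Rightarrow> 'a) module" where
  "free_left_module A J =
     \<lparr> carrier = {p. finite {i. p i \<noteq> \<zero>\<^bsub>A\<^esub>} \<and> (\<forall>i\<in>J. p i \<in> carrier A) \<and>
                     (\<forall>i. i \<notin> J \<longrightarrow> p i = \<zero>\<^bsub>A\<^esub>)},
       monoid.mult = undefined, one = undefined,
       ring.zero = (\<lambda>i. \<zero>\<^bsub>A\<^esub>),
       add = (\<lambda>p q i. p i \<oplus>\<^bsub>A\<^esub> q i),
       smult = (\<lambda>a p i. a \<otimes>\<^bsub>A\<^esub> p i) \<rparr>"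

text \<open>\<open>A/I\<close> as a left \<open>A\<close>-module, for a two-sided ideal \<open>I\<close>.\<close>

definition quotient_left_module :: "('a, 'm) ring_scheme \<Rightarrow> 'a set \<Rightarrow> ('a, 'a set) module" where
  "quotient_left_module A I =
     \<lparr> carrier = carrier (A Quot I),
       monoid.mult = monoid.mult (A Quot I), one = one (A Quot I),
       ring.zero = ring.zero (A Quot I),
       add = add (A Quot I),
       smult = (\<lambda>a C. (I +>\<^bsub>A\<^esub> a) \<otimes>\<^bsub>A Quot I\<^esub> C) \<rparr>"

text \<open>
  A free resolution \<open>\<cdots> \<rightarrow> P\<^sub>1 \<rightarrow> P\<^sub>0 \<rightarrow> M \<rightarrow> 0\<close>: \<open>P\<^sub>k\<close> is free on the set \<open>gens k\<close>, \<open>diff k\<close> is the map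
  from \<open>P\<^sub>k\<^sub>+\<^sub>1\<close> to \<open>P\<^sub>k\<close>, and \<open>aug\<close> is the map from \<open>P\<^sub>0\<close> to \<open>M\<close>.
\<close>

record ('i, 'a, 'v) resolution =
  gens :: "nat \<Rightarrow> 'i set"
  diff :: "nat \<Rightarrow> ('i \<Rightarrow> 'a) \<Rightarrow> ('i \<Rightarrow> 'a)"
  aug :: "('i \<Rightarrow> 'a) \<Rightarrow> 'v"

definition res_module ::
    "('a, 'm) ring_scheme \<Rightarrow> ('i, 'a, 'v) resolution \<Rightarrow> nat \<Rightarrow> ('a, 'i \<Rightarrow> 'a) module" where
  "res_module A P k = free_left_module A (gens P k)"

definition free_resolution ::
    "('a, 'm) ring_scheme \<Rightarrow> ('a, 'v) module \<Rightarrow> ('i, 'a, 'v) resolution \<Rightarrow> bool" where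
  "free_resolution A M P \<longleftrightarrow>
     aug P \<in> left_module_hom A (res_module A P 0) M \<and>
     (\<forall>k. diff P k \<in> left_module_hom A (res_module A P (Suc k)) (res_module A P k)) \<and>
     aug P ` carrier (res_module A P 0) = carrier M \<and>
     diff P 0 ` carrier (res_module A P 1) =
       {p \<in> carrier (res_module A P 0). aug P p = \<zero>\<^bsub>M\<^esub>} \<and>
     (\<forall>k. diff P (Suc k) ` carrier (res_module A P (Suc (Suc k))) =
       {p \<in> carrier (res_module A P (Suc k)). diff P k p = \<zero>\<^bsub>res_module A P k\<^esub>})"

text \<open>
  Cocycles and coboundaries of the complex \<open>Hom\<^sub>A(P\<^sub>\<bullet>, M)\<close>. Functions that agree on the carrier of
  \<open>P\<^sub>m\<close> are cohomologous, so the values outside the carrier do not matter.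
\<close>

definition ext_cocycles ::
    "('a, 'm) ring_scheme \<Rightarrow> ('a, 'v) module \<Rightarrow> ('i, 'a, 'v) resolution \<Rightarrow> nat
      \<Rightarrow> (('i \<Rightarrow> 'a) \<Rightarrow> 'v) set" where
  "ext_cocycles A M P m =
     {f \<in> left_module_hom A (res_module A P m) M.
        \<forall>p\<in>carrier (res_module A P (Suc m)). f (diff P m p) = \<zero>\<^bsub>M\<^esub>}"

definition cohomologous ::
    "('a, 'm) ring_scheme \<Rightarrow> ('a, 'v) module \<Rightarrow> ('i, 'a, 'v) resolution \<Rightarrow> nat
      \<Rightarrow> (('i \<Rightarrow> 'a) \<Rightarrow> 'v) \<Rightarrow> (('i \<Rightarrow> 'a) \<Rightarrow> 'v) \<Rightarrow> bool" where
  "cohomologous A M P m f g \<longleftrightarrow>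
     (case m of
        0 \<Rightarrow> \<forall>p\<in>carrier (res_module A P 0). g p = f p
      | Suc k \<Rightarrow> \<exists>b\<in>left_module_hom A (res_module A P k) M.
          \<forall>p\<in>carrier (res_module A P (Suc k)). g p = f p \<oplus>\<^bsub>M\<^esub> b (diff P k p))"

definition ext_class ::
    "('a, 'm) ring_scheme \<Rightarrow> ('a, 'v) module \<Rightarrow> ('i, 'a, 'v) resolution \<Rightarrow> nat
      \<Rightarrow> (('i \<Rightarrow> 'a) \<Rightarrow> 'v) \<Rightarrow> (('i \<Rightarrow> 'a) \<Rightarrow> 'v) set" where
  "ext_class A M P m f = {g \<in> ext_cocycles A M P m. cohomologous A M P m f g}"

definition Ext ::
    "('a, 'm) ring_scheme \<Rightarrow> ('a, 'v) module \<Rightarrow> ('i, 'a, 'v) resolution \<Rightarrow> nat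
      \<Rightarrow> (('i \<Rightarrow> 'a) \<Rightarrow> 'v) set set" where
  "Ext A M P m = ext_class A M P m ` ext_cocycles A M P m"

definition ext_zero ::
    "('a, 'm) ring_scheme \<Rightarrow> ('a, 'v) module \<Rightarrow> ('i, 'a, 'v) resolution \<Rightarrow> nat
      \<Rightarrow> (('i \<Rightarrow> 'a) \<Rightarrow> 'v) set" where
  "ext_zero A M P m = ext_class A M P m (\<lambda>p. \<zero>\<^bsub>M\<^esub>)"

text \<open>\<open>F k : P\<^sub>j\<^sub>+\<^sub>k \<rightarrow> P\<^sub>k\<close> is a chain map lifting the cocycle \<open>g : P\<^sub>j \<rightarrow> M\<close>.\<close>

definition cocycle_lift ::
    "('a, 'm) ring_scheme \<Rightarrow> ('a, 'v) module \<Rightarrow> ('i, 'a, 'v) resolution \<Rightarrow> nat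
      \<Rightarrow> (('i \<Rightarrow> 'a) \<Rightarrow> 'v) \<Rightarrow> (nat \<Rightarrow> ('i \<Rightarrow> 'a) \<Rightarrow> ('i \<Rightarrow> 'a)) \<Rightarrow> bool" where
  "cocycle_lift A M P j g F \<longleftrightarrow>
     (\<forall>k. F k \<in> left_module_hom A (res_module A P (j + k)) (res_module A P k)) \<and>
     (\<forall>p\<in>carrier (res_module A P j). aug P (F 0 p) = g p) \<and>
     (\<forall>k. \<forall>p\<in>carrier (res_module A P (j + Suc k)).
        diff P k (F (Suc k) p) = F k (diff P (j + k) p))"

text \<open>
  The Yoneda algebra \<open>\<Oplus>\<^sub>m Ext\<^sup>m\<^sub>A(M, M)\<close>, computed by the resolution \<open>P\<close> of \<open>M\<close>. An element is the
  family of its homogeneous components. The product of the classes of \<open>f : P\<^sub>i \<rightarrow> M\<close> and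
  \<open>g : P\<^sub>j \<rightarrow> M\<close> is the class of \<open>f \<circ> F i : P\<^sub>i\<^sub>+\<^sub>j \<rightarrow> M\<close>, where \<open>F\<close> lifts \<open>g\<close>.
\<close>

definition yoneda_algebra ::
    "('a, 'm) ring_scheme \<Rightarrow> ('a, 'v) module \<Rightarrow> ('i, 'a, 'v) resolution
      \<Rightarrow> (nat \<Rightarrow> (('i \<Rightarrow> 'a) \<Rightarrow> 'v) set) ring" where
  "yoneda_algebra A M P =
     \<lparr> carrier = {u. (\<forall>m. u m \<in> Ext A M P m) \<and> finite {m. u m \<noteq> ext_zero A M P m}},
       monoid.mult = (\<lambda>u v m. {h \<in> ext_cocycles A M P m. \<exists>f g F.
                 (\<forall>i\<le>m. f i \<in> u i) \<and>
                 (\<forall>j\<le>m. g j \<in> v j \<and> cocycle_lift A M P j (g j) (F j)) \<and>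
                 cohomologous A M P m (\<lambda>p. \<Oplus>\<^bsub>M\<^esub>i\<in>{..m}. f i (F (m - i) i p)) h}),
       one = (\<lambda>m. if m = 0 then ext_class A M P 0 (aug P) else ext_zero A M P m),
       ring.zero = ext_zero A M P,
       add = (\<lambda>u v m. {h \<in> ext_cocycles A M P m. \<exists>f\<in>u m. \<exists>g\<in>v m.
                 cohomologous A M P m (\<lambda>p. f p \<oplus>\<^bsub>M\<^esub> g p) h}) \<rparr>"

definition yoneda_component ::
    "('a, 'm) ring_scheme \<Rightarrow> ('a, 'v) module \<Rightarrow> ('i, 'a, 'v) resolution \<Rightarrow> nat
      \<Rightarrow> (nat \<Rightarrow> (('i \<Rightarrow> 'a) \<Rightarrow> 'v) set) set" where
  "yoneda_component A M P m =
     {u \<in> carrier (yoneda_algebra A M P). \<forall>k. k \<noteq> m \<longrightarrow> u k = ext_zero A M P k}"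

text \<open>
  The scalars \<open>B \<cdot> 1\<close> of the Yoneda algebra of an algebra over \<open>B\<close>: \<open>r \<cdot> 1\<close> is the class of \<open>r \<cdot> aug\<close>
  (which is linear because \<open>\<eta> r\<close> is central).
\<close>

definition yoneda_scalars ::
    "('b, 'l) ring_scheme \<Rightarrow> ('a, 'm) ring_scheme \<Rightarrow> ('b \<Rightarrow> 'a) \<Rightarrow> ('a, 'v) module
      \<Rightarrow> ('i, 'a, 'v) resolution \<Rightarrow> (nat \<Rightarrow> (('i \<Rightarrow> 'a) \<Rightarrow> 'v) set) set" where
  "yoneda_scalars B A \<eta> M P =
     (\<lambda>r m. if m = 0 then ext_class A M P 0 (\<lambda>p. \<eta> r \<odot>\<^bsub>M\<^esub> aug P p) else ext_zero A M P m)
       ` carrier B"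


section \<open>Koszul algebras\<close>

text \<open>
  The property \<open>\<K>\<^sub>m\<close>. The Yoneda algebra does not depend, up to isomorphism of graded
  \<open>B\<close>-algebras, on the resolution, so any one may be used to compute it. The index type
  \<open>'a list\<close> is large enough for a free resolution to exist: each kernel has a generating set of
  cardinality at most \<open>max |A| \<aleph>\<^sub>0\<close>.
\<close>

definition K_property ::
    "nat \<Rightarrow> ('b, 'l) ring_scheme \<Rightarrow> ('a, 'm) ring_scheme \<Rightarrow> ('b \<Rightarrow> 'a) \<Rightarrow> 'a set \<Rightarrow> bool" where
  "K_property m B A \<eta> Ap \<longleftrightarrow>
     (let M = quotient_left_module A Ap in
      \<exists>P :: ('a list, 'a, 'a set) resolution.
        free_resolution A M P \<and>
        generate_ring (yoneda_algebra A M P)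
          (yoneda_scalars B A \<eta> M P \<union> (\<Union>i\<in>{1..m}. yoneda_component A M P i)) =
        carrier (yoneda_algebra A M P))"

definition augmented_koszul ::
    "('b, 'l) ring_scheme \<Rightarrow> ('a, 'm) ring_scheme \<Rightarrow> ('b \<Rightarrow> 'a) \<Rightarrow> bool" where
  "augmented_koszul B A \<eta> \<longleftrightarrow>
     central_algebra B A \<eta> \<and>
     (\<exists>Ap D. augmentation_ideal B A \<eta> Ap \<and> compatible_grading B A \<eta> Ap D \<and>
        K_property 1 B A \<eta> Ap)"

end

theory Submission
  imports Defs "HOL-Library.Nat_Bijection"
begin

text \<open>
  A semi-commutative extension is a quantum affine space: the \<open>x\<^sub>i\<close> are central over \<open>R\<close> and
  \<open>x\<^sub>j x\<^sub>i = q\<^sub>j\<^sub>i x\<^sub>i x\<^sub>j\<close>, where \<open>q\<^sub>j\<^sub>i\<close> is a unit because \<open>x\<^sub>i x\<^sub>j = q\<^sub>i\<^sub>j q\<^sub>j\<^sub>i x\<^sub>i x\<^sub>j\<close> is a basis element.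
  The module \<open>R = A / A\<^sub>+\<close> has a quantum Koszul resolution: \<open>P\<^sub>k\<close> is free on the symbols \<open>e\<^sub>S\<close>, where \<open>S\<close>
  runs through the \<open>k\<close>-element subsets of \<open>{1..n}\<close>, and \<open>d e\<^sub>S\<close> is a combination of the \<open>x\<^sub>i e\<^bsub>S - i\<^esub>\<close> with
  unit coefficients. It is exact because moving the largest index that occurs in \<open>x\<^sup>\<beta> e\<^sub>S\<close> from
  the monomial into \<open>S\<close> is an \<open>R\<close>-linear contraction. Since \<open>A\<^sub>+\<close> annihilates \<open>R\<close>, the cohomology is
  \<open>R\<close>-free on the dual symbols \<open>\<xi>\<^sub>S\<close>, and lifting cocycles along \<open>d\<close> shows that
  \<open>\<xi>\<^sub>S \<xi>\<^sub>i\<close> is a unit multiple of \<open>\<xi>\<^bsub>S \<union> i\<^esub>\<close> for \<open>i \<notin> S\<close>; hence \<open>\<xi>\<^sub>1, \<dots>, \<xi>\<^sub>n\<close> generate. The presentation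
  \<open>A = T\<^sub>R(V) / I\<close> holds because words can be straightened into standard monomials using the quadratic
  relations alone.
\<close>

subsection \<open>Monomials in quantum commuting variables\<close>

text \<open>The same straightening is needed twice, in \<open>A\<close> and in the quotient of the
  tensor algebra by the quadratic relations, whose standard monomials are not yet known to be
  independent. It is therefore carried out in a locale that knows only commutation rules and is
  instantiated with both rings. Apart from scalars, only right multiplication by a variable is
  expanded in coefficients: left module maps leave the right-hand side free, so the differential can
  multiply by x_i there. The Yoneda product is specified through arbitrary representatives and
  arbitrary chain lifts. An explicit lift shows that products exist; that all lifts give the same
  value is a separate argument, possible because the coefficient module sees only constant terms.
  The ideal of the presentation is taken to be the kernel of the map from the tensor algebra to
  \<open>A\<close>. The isomorphism is then immediate, homogeneity follows by comparing degrees in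
  \<open>A\<close>, and finite generation is the real content: the kernel has to be identified with
  the ideal of the quadratic relations.\<close>

abbreviation incr :: "(nat \<Rightarrow> nat) \<Rightarrow> nat \<Rightarrow> nat \<Rightarrow> nat" where
  "incr \<alpha> i \<equiv> \<alpha>(i := Suc (\<alpha> i))"

text \<open>The subtraction is truncated, so this inverts \<open>incr\<close> only where \<open>\<alpha> i > 0\<close>.\<close>

abbreviation decr :: "(nat \<Rightarrow> nat) \<Rightarrow> nat \<Rightarrow> nat \<Rightarrow> nat" where
  "decr \<alpha> i \<equiv> \<alpha>(i := \<alpha> i - 1)"

text \<open>The scalar produced when x_i, multiplied onto x^\<alpha> from the right, moves left past
  the powers of all later variables to its place.\<close>

definition twist :: "('b, 'l) ring_scheme \<Rightarrow> nat \<Rightarrow> (nat \<Rightarrow> nat \<Rightarrow> 'b) \<Rightarrow> (nat \<Rightarrow> nat) \<Rightarrow> nat \<Rightarrow> 'b" where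
  "twist P n Q \<alpha> i = finprod P (\<lambda>j. Q j i [^]\<^bsub>P\<^esub> \<alpha> j) {i<..n}"

text \<open>The variables need not be independent over \<open>P\<close>, so that a ring given by
  generators and relations is covered as well. The swap rule is formulated for i < j, the direction
  in which words are put into order.\<close>

locale quantum_vars = ring_hom_ring P B b + P: cring P
  for P (structure) and B (structure) and b +
  fixes n :: nat and Q :: "nat \<Rightarrow> nat \<Rightarrow> _" and y :: "nat \<Rightarrow> _"
  assumes Q_closed: "\<lbrakk>i \<in> {1..n}; j \<in> {1..n}; i < j\<rbrakk> \<Longrightarrow> Q j i \<in> carrier P"
    and y_closed: "i \<in> {1..n} \<Longrightarrow> y i \<in> carrier B"
    and y_central: "\<lbrakk>i \<in> {1..n}; r \<in> carrier P\<rbrakk> \<Longrightarrow> b r \<otimes>\<^bsub>B\<^esub> y i = y i \<otimes>\<^bsub>B\<^esub> b r"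
    and y_swap: "\<lbrakk>i \<in> {1..n}; j \<in> {1..n}; i < j\<rbrakk> \<Longrightarrow>
       y j \<otimes>\<^bsub>B\<^esub> y i = b (Q j i) \<otimes>\<^bsub>B\<^esub> (y i \<otimes>\<^bsub>B\<^esub> y j)"
begin

text \<open>Suffixes of the ordered product. A variable arriving from the right meets the last
  factors first, so the inductions go from the end of the product to its beginning.\<close>

definition tail_monomial :: "nat \<Rightarrow> (nat \<Rightarrow> nat) \<Rightarrow> 'c" where
  "tail_monomial k \<alpha> = foldr (\<lambda>i a. (y i [^]\<^bsub>B\<^esub> \<alpha> i) \<otimes>\<^bsub>B\<^esub> a) [k..<Suc n] \<one>\<^bsub>B\<^esub>"

lemma std_monomial_eq_tail: "std_monomial B n y \<alpha> = tail_monomial 1 \<alpha>"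
  by (simp add: std_monomial_def tail_monomial_def)

lemma tail_monomial_end: "n < k \<Longrightarrow> tail_monomial k \<alpha> = \<one>\<^bsub>B\<^esub>"
  by (simp add: tail_monomial_def)

lemma tail_monomial_step:
  "k \<le> n \<Longrightarrow> tail_monomial k \<alpha> = (y k [^]\<^bsub>B\<^esub> \<alpha> k) \<otimes>\<^bsub>B\<^esub> tail_monomial (Suc k) \<alpha>"
  by (simp add: tail_monomial_def upt_rec del: upt_Suc)

lemma tail_monomial_closed: "1 \<le> k \<Longrightarrow> tail_monomial k \<alpha> \<in> carrier B"
proof (induction "Suc n - k" arbitrary: k)
  case 0 then show ?case by (simp add: tail_monomial_end)
next
  case (Suc d) then show ?case by (simp add: tail_monomial_step y_closed)
qed

lemma std_monomial_closed: "std_monomial B n y \<alpha> \<in> carrier B"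
  by (simp add: std_monomial_eq_tail tail_monomial_closed)

lemma tail_monomial_cong: "(\<And>i. k \<le> i \<Longrightarrow> i \<le> n \<Longrightarrow> \<alpha> i = \<beta> i) \<Longrightarrow> tail_monomial k \<alpha> = tail_monomial k \<beta>"
  unfolding tail_monomial_def by (rule foldr_cong) auto

lemma y_pow_central: "\<lbrakk>i \<in> {1..n}; r \<in> carrier P\<rbrakk> \<Longrightarrow> b r \<otimes>\<^bsub>B\<^esub> (y i [^]\<^bsub>B\<^esub> (m::nat)) = (y i [^]\<^bsub>B\<^esub> m) \<otimes>\<^bsub>B\<^esub> b r"
  by (rule S.group_commutes_pow[symmetric]) (auto simp: y_central y_closed)


lemma y_pow_swap:
  assumes i: "i \<in> {1..n}" and j: "j \<in> {1..n}" and ij: "i < j"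
  shows "(y j [^]\<^bsub>B\<^esub> (m::nat)) \<otimes>\<^bsub>B\<^esub> y i = b (Q j i [^] m) \<otimes>\<^bsub>B\<^esub> (y i \<otimes>\<^bsub>B\<^esub> (y j [^]\<^bsub>B\<^esub> m))"
proof (induction m)
  case 0 then show ?case using y_closed[OF i] by simp
next
  case (Suc m)
  note [simp] = y_closed[OF i] y_closed[OF j] Q_closed[OF i j ij]
  have "(y j [^]\<^bsub>B\<^esub> Suc m) \<otimes>\<^bsub>B\<^esub> y i = (y j [^]\<^bsub>B\<^esub> m) \<otimes>\<^bsub>B\<^esub> (b (Q j i) \<otimes>\<^bsub>B\<^esub> (y i \<otimes>\<^bsub>B\<^esub> y j))"
    by (simp add: S.m_assoc y_swap[OF i j ij])
  also have "\<dots> = b (Q j i) \<otimes>\<^bsub>B\<^esub> (((y j [^]\<^bsub>B\<^esub> m) \<otimes>\<^bsub>B\<^esub> y i) \<otimes>\<^bsub>B\<^esub> y j)"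
    by (simp add: S.m_assoc[symmetric] y_pow_central[OF j])
  also have "\<dots> = b (Q j i) \<otimes>\<^bsub>B\<^esub> b (Q j i [^] m) \<otimes>\<^bsub>B\<^esub> (y i \<otimes>\<^bsub>B\<^esub> (y j [^]\<^bsub>B\<^esub> m)) \<otimes>\<^bsub>B\<^esub> y j"
    by (simp add: Suc.IH S.m_assoc)
  finally show ?case by (simp add: S.m_assoc P.m_comm flip: hom_mult)
qed

text \<open>Every index in the suffix exceeds i, so x_i has to cross all of it; each crossing leaves
  a scalar that commutes with the variables and can be collected in front.\<close>

lemma tail_monomial_past:
  assumes i: "i \<in> {1..n}" and "i < k"
  shows "tail_monomial k \<alpha> \<otimes>\<^bsub>B\<^esub> y i =
    b (finprod P (\<lambda>j. Q j i [^] \<alpha> j) {k..n}) \<otimes>\<^bsub>B\<^esub> (y i \<otimes>\<^bsub>B\<^esub> tail_monomial k \<alpha>)"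
  using \<open>i < k\<close>
proof (induction "Suc n - k" arbitrary: k)
  case 0 then show ?case using y_closed[OF i] by (simp add: tail_monomial_end)
next
  case (Suc d)
  then have k: "k \<in> {1..n}" and eq: "{k..n} = insert k {Suc k..n}" by auto
  let ?p = "finprod P (\<lambda>j. Q j i [^] \<alpha> j) {Suc k..n}"
  have q: "(\<lambda>j. Q j i [^] \<alpha> j) \<in> {Suc k..n} \<rightarrow> carrier P"
    using Suc.prems i by (auto intro!: R.nat_pow_closed Q_closed)
  note [simp] = y_closed[OF i] y_closed[OF k] Q_closed[OF i k Suc.prems]
  have t: "tail_monomial (Suc k) \<alpha> \<in> carrier B" and p: "?p \<in> carrier P"
    using tail_monomial_closed q by auto
  have "tail_monomial k \<alpha> \<otimes>\<^bsub>B\<^esub> y i = (y k [^]\<^bsub>B\<^esub> \<alpha> k) \<otimes>\<^bsub>B\<^esub> (b ?p \<otimes>\<^bsub>B\<^esub> (y i \<otimes>\<^bsub>B\<^esub> tail_monomial (Suc k) \<alpha>))"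
    using k t Suc by (simp add: tail_monomial_step S.m_assoc)
  also have "\<dots> = b ?p \<otimes>\<^bsub>B\<^esub> (((y k [^]\<^bsub>B\<^esub> \<alpha> k) \<otimes>\<^bsub>B\<^esub> y i) \<otimes>\<^bsub>B\<^esub> tail_monomial (Suc k) \<alpha>)"
    using t p by (simp add: S.m_assoc[symmetric] y_pow_central[OF k])
  also have "\<dots> = b ?p \<otimes>\<^bsub>B\<^esub> (b (Q k i [^] \<alpha> k) \<otimes>\<^bsub>B\<^esub> (y i \<otimes>\<^bsub>B\<^esub> (y k [^]\<^bsub>B\<^esub> \<alpha> k)) \<otimes>\<^bsub>B\<^esub> tail_monomial (Suc k) \<alpha>)"
    by (simp add: y_pow_swap[OF i k Suc.prems])
  also have "\<dots> = b (?p \<otimes> Q k i [^] \<alpha> k) \<otimes>\<^bsub>B\<^esub> (y i \<otimes>\<^bsub>B\<^esub> tail_monomial k \<alpha>)"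
    using t p k by (simp add: S.m_assoc tail_monomial_step)
  also have "?p \<otimes> Q k i [^] \<alpha> k = finprod P (\<lambda>j. Q j i [^] \<alpha> j) {k..n}"
    using q p by (simp add: eq P.m_comm)
  finally show ?case .
qed

lemma twist_closed: "i \<in> {1..n} \<Longrightarrow> twist P n Q \<alpha> i \<in> carrier P"
  unfolding twist_def by (intro P.finprod_closed) (auto intro!: R.nat_pow_closed Q_closed)

text \<open>At k = i the variable has reached its own power and is absorbed there; factors of
  smaller index are merely carried along in front.\<close>

lemma tail_monomial_mult_var:
  assumes "1 \<le> k" "k \<le> i" "i \<le> n"
  shows "tail_monomial k \<alpha> \<otimes>\<^bsub>B\<^esub> y i = b (twist P n Q \<alpha> i) \<otimes>\<^bsub>B\<^esub> tail_monomial k (incr \<alpha> i)"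
  using assms(1,2)
proof (induction "i - k" arbitrary: k)
  case 0
  then have "i = k" and i: "i \<in> {1..n}" using assms by auto
  have t: "tail_monomial (Suc i) \<alpha> \<in> carrier B" using tail_monomial_closed by simp
  have tw: "finprod P (\<lambda>j. Q j i [^] \<alpha> j) {Suc i..n} = twist P n Q \<alpha> i"
    unfolding twist_def by (simp add: atLeastSucAtMost_greaterThanAtMost)
  have c: "tail_monomial (Suc i) (incr \<alpha> i) = tail_monomial (Suc i) \<alpha>"
    by (rule tail_monomial_cong) auto
  have "tail_monomial i \<alpha> \<otimes>\<^bsub>B\<^esub> y i = (y i [^]\<^bsub>B\<^esub> \<alpha> i) \<otimes>\<^bsub>B\<^esub> (b (twist P n Q \<alpha> i) \<otimes>\<^bsub>B\<^esub> (y i \<otimes>\<^bsub>B\<^esub> tail_monomial (Suc i) \<alpha>))"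
    using i t by (simp add: tail_monomial_step S.m_assoc tail_monomial_past tw y_closed)
  also have "\<dots> = b (twist P n Q \<alpha> i) \<otimes>\<^bsub>B\<^esub> ((y i [^]\<^bsub>B\<^esub> \<alpha> i) \<otimes>\<^bsub>B\<^esub> y i \<otimes>\<^bsub>B\<^esub> tail_monomial (Suc i) \<alpha>)"
    using i t twist_closed[OF i, of \<alpha>] by (simp add: S.m_assoc[symmetric] y_pow_central[OF i] y_closed)
  also have "(y i [^]\<^bsub>B\<^esub> \<alpha> i) \<otimes>\<^bsub>B\<^esub> y i \<otimes>\<^bsub>B\<^esub> tail_monomial (Suc i) \<alpha> = tail_monomial i (incr \<alpha> i)"
    using i by (subst tail_monomial_step) (simp_all only: c fun_upd_same S.nat_pow_Suc atLeastAtMost_iff)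
  finally show ?case unfolding \<open>i = k\<close> .
next
  case (Suc d)
  then have k: "k \<in> {1..n}" and i: "i \<in> {1..n}" and "k \<noteq> i" using assms by auto
  have t: "tail_monomial (Suc k) \<beta> \<in> carrier B" for \<beta> using tail_monomial_closed by simp
  have "tail_monomial k \<alpha> \<otimes>\<^bsub>B\<^esub> y i = (y k [^]\<^bsub>B\<^esub> \<alpha> k) \<otimes>\<^bsub>B\<^esub> (b (twist P n Q \<alpha> i) \<otimes>\<^bsub>B\<^esub> tail_monomial (Suc k) (incr \<alpha> i))"
    using k i t Suc by (simp add: tail_monomial_step S.m_assoc y_closed)
  also have "\<dots> = b (twist P n Q \<alpha> i) \<otimes>\<^bsub>B\<^esub> ((y k [^]\<^bsub>B\<^esub> \<alpha> k) \<otimes>\<^bsub>B\<^esub> tail_monomial (Suc k) (incr \<alpha> i))"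
    using k i t twist_closed[OF i, of \<alpha>] by (simp add: S.m_assoc[symmetric] y_pow_central[OF k] y_closed)
  finally show ?case using k \<open>k \<noteq> i\<close> by (simp add: tail_monomial_step)
qed

lemma std_monomial_mult_var:
  "i \<in> {1..n} \<Longrightarrow>
    std_monomial B n y \<alpha> \<otimes>\<^bsub>B\<^esub> y i = b (twist P n Q \<alpha> i) \<otimes>\<^bsub>B\<^esub> std_monomial B n y (incr \<alpha> i)"
  by (simp add: std_monomial_eq_tail tail_monomial_mult_var)

lemma tail_monomial_central:
  "\<lbrakk>1 \<le> k; r \<in> carrier P\<rbrakk> \<Longrightarrow> b r \<otimes>\<^bsub>B\<^esub> tail_monomial k \<alpha> = tail_monomial k \<alpha> \<otimes>\<^bsub>B\<^esub> b r"
proof (induction "Suc n - k" arbitrary: k)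
  case 0 then show ?case by (simp add: tail_monomial_end)
next
  case (Suc d)
  then have k: "k \<in> {1..n}" by auto
  have t: "tail_monomial (Suc k) \<alpha> \<in> carrier B" using tail_monomial_closed by simp
  show ?case using Suc k t y_pow_central[OF k Suc.prems(2), of "\<alpha> k"]
    by (simp add: tail_monomial_step y_closed S.m_assoc[symmetric]) (simp add: y_closed S.m_assoc)
qed

lemma std_monomial_central:
  "r \<in> carrier P \<Longrightarrow> b r \<otimes>\<^bsub>B\<^esub> std_monomial B n y \<alpha> = std_monomial B n y \<alpha> \<otimes>\<^bsub>B\<^esub> b r"
  by (simp add: std_monomial_eq_tail tail_monomial_central)

lemma twist_one:
  assumes "\<And>j. \<lbrakk>i < j; j \<le> n\<rbrakk> \<Longrightarrow> \<alpha> j = 0"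
  shows "twist P n Q \<alpha> i = \<one>"
  unfolding twist_def by (rule P.finprod_one_eqI) (simp add: assms)

text \<open>The contracting homotopy compares monomials that differ by one factor x_j. This scalar
  is what balances the factor - \<open>Q j i\<close> in the coefficients of the
  differential.\<close>

lemma twist_incr:
  assumes i: "i \<in> {1..n}" and j: "j \<in> {1..n}" and ij: "i < j"
  shows "twist P n Q (incr \<alpha> j) i = Q j i \<otimes> twist P n Q \<alpha> i"
proof -
  have s: "{i<..n} = insert j ({i<..n} - {j})" using j ij by auto
  have c: "(\<lambda>k. Q k i [^] \<beta> k) \<in> {i<..n} - {j} \<rightarrow> carrier P" for \<beta> :: "nat \<Rightarrow> nat"
    using i by (auto intro!: R.nat_pow_closed Q_closed)
  note [simp] = Q_closed[OF i j ij]
  have split: "finprod P (\<lambda>k. Q k i [^] \<beta> k) {i<..n} =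
      Q j i [^] \<beta> j \<otimes> finprod P (\<lambda>k. Q k i [^] \<beta> k) ({i<..n} - {j})" for \<beta> :: "nat \<Rightarrow> nat"
    by (subst s, subst P.finprod_insert) (use c[of \<beta>] in auto)
  have e: "finprod P (\<lambda>k. Q k i [^] incr \<alpha> j k) ({i<..n} - {j}) =
           finprod P (\<lambda>k. Q k i [^] \<alpha> k) ({i<..n} - {j})"
    by (rule P.finprod_cong') (use c[of \<alpha>] in auto)
  have p: "finprod P (\<lambda>k. Q k i [^] \<alpha> k) ({i<..n} - {j}) \<in> carrier P" using c by auto
  show ?thesis unfolding twist_def split e using p by (simp add: P.m_ac)
qed

end

subsection \<open>Coefficients with respect to the standard monomials\<close>

context ring
begin

lemma foldr_mult_closed:
  "\<lbrakk>\<And>i. i \<in> set l \<Longrightarrow> f i \<in> carrier R; z \<in> carrier R\<rbrakk> \<Longrightarrow> foldr (\<lambda>i a. f i \<otimes> a) l z \<in> carrier R"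
  by (induction l) auto

lemma foldr_mult_assoc:
  "\<lbrakk>\<And>i. i \<in> set l \<Longrightarrow> f i \<in> carrier R; z \<in> carrier R; w \<in> carrier R\<rbrakk> \<Longrightarrow>
    foldr (\<lambda>i a. f i \<otimes> a) l (z \<otimes> w) = foldr (\<lambda>i a. f i \<otimes> a) l z \<otimes> w"
  by (induction l) (auto simp: m_assoc foldr_mult_closed)

lemma foldr_mult_one:
  "(\<And>i. i \<in> set l \<Longrightarrow> f i = \<one>) \<Longrightarrow> foldr (\<lambda>i a. f i \<otimes> a) l \<one> = \<one>"
  by (induction l) auto

lemma monomial_closed:
  "(\<And>i. i \<in> {1..n} \<Longrightarrow> x i \<in> carrier R) \<Longrightarrow> std_monomial R n x \<alpha> \<in> carrier R"
  unfolding std_monomial_def by (rule foldr_mult_closed) auto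

lemma monomial_zero: "std_monomial R n x (\<lambda>_. 0) = \<one>"
  unfolding std_monomial_def by (rule foldr_mult_one) auto

text \<open>With no later variable present the new factor has nothing to cross, so no scalar
  appears.\<close>

lemma monomial_incr_last:
  assumes x: "\<And>i. i \<in> {1..n} \<Longrightarrow> x i \<in> carrier R"
    and i: "i \<in> {1..n}" and last: "\<And>j. i < j \<Longrightarrow> \<alpha> j = 0"
  shows "std_monomial R n x (incr \<alpha> i) = std_monomial R n x \<alpha> \<otimes> x i"
proof -
  let ?f = "\<lambda>\<alpha> i a. (x i [^] \<alpha> i) \<otimes> a"
  have l: "[1..<Suc n] = [1..<i] @ i # [Suc i..<Suc n]"
    using i upt_add_eq_append[of 1 i "Suc n - i"] upt_conv_Cons[of i "Suc n"] by (simp del: upt_Suc)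
  have tail: "foldr (?f \<beta>) [Suc i..<Suc n] \<one> = \<one>" if "\<And>j. i < j \<Longrightarrow> \<beta> j = 0" for \<beta> :: "nat \<Rightarrow> nat"
    by (rule foldr_mult_one) (auto simp: that)
  have std: "std_monomial R n x \<beta> = foldr (?f \<beta>) [1..<i] (x i [^] \<beta> i)"
    if "\<And>j. i < j \<Longrightarrow> \<beta> j = 0" for \<beta> :: "nat \<Rightarrow> nat"
    unfolding std_monomial_def l using tail[of \<beta>] that x i by (simp del: upt_Suc)
  have "std_monomial R n x (incr \<alpha> i) = foldr (?f \<alpha>) [1..<i] ((x i [^] \<alpha> i) \<otimes> x i)"
    by (subst std) (use last in \<open>auto intro!: foldr_cong\<close>)
  also have "\<dots> = foldr (?f \<alpha>) [1..<i] (x i [^] \<alpha> i) \<otimes> x i"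
    by (rule foldr_mult_assoc) (use x i in auto)
  finally show ?thesis using std[of \<alpha>] last by simp
qed

end

lemma exponents_incr: "\<lbrakk>\<alpha> \<in> exponents n; i \<in> {1..n}\<rbrakk> \<Longrightarrow> incr \<alpha> i \<in> exponents n"
  and exponents_decr: "\<alpha> \<in> exponents n \<Longrightarrow> decr \<alpha> i \<in> exponents n"
  and exponents_zero: "(\<lambda>_. 0) \<in> exponents n"
  by (auto simp: exponents_def)

text \<open>Freeness is separated from the commutation rules because coefficients with respect to
  the basis are already used to extract those rules from the hypotheses on the extension.\<close>

locale pbw_basis = ring A for A (structure) +
  fixes R n x
  assumes sub: "subring R A"
    and x_closed: "i \<in> {1..n} \<Longrightarrow> x i \<in> carrier A"
    and free: "free_on_std_monomials A R n x"
begin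

lemma R_sub: "r \<in> R \<Longrightarrow> r \<in> carrier A"
  and R_zero: "\<zero> \<in> R" and R_one: "\<one> \<in> R"
  and R_neg: "r \<in> R \<Longrightarrow> \<ominus> r \<in> R"
  and R_mult: "\<lbrakk>r \<in> R; s \<in> R\<rbrakk> \<Longrightarrow> r \<otimes> s \<in> R"
  and R_add: "\<lbrakk>r \<in> R; s \<in> R\<rbrakk> \<Longrightarrow> r \<oplus> s \<in> R"
  using subringE[OF sub] by auto

lemma R_finsum: "(\<And>i. i \<in> F \<Longrightarrow> f i \<in> R) \<Longrightarrow> finsum A f F \<in> R"
  by (induction F rule: infinite_finite_induct) (auto simp: R_zero R_add R_sub Pi_def)

abbreviation mon :: "(nat \<Rightarrow> nat) \<Rightarrow> 'a" where
  "mon \<equiv> std_monomial A n x"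

lemma mon_closed: "mon \<alpha> \<in> carrier A"
  by (rule monomial_closed) (rule x_closed)

definition families :: "((nat \<Rightarrow> nat) \<Rightarrow> 'a) set" where
  "families = {c. (\<forall>\<alpha>\<in>exponents n. c \<alpha> \<in> R) \<and> (\<forall>\<alpha>. \<alpha> \<notin> exponents n \<longrightarrow> c \<alpha> = \<zero>) \<and>
                  finite {\<alpha>. c \<alpha> \<noteq> \<zero>}}"

definition comb :: "((nat \<Rightarrow> nat) \<Rightarrow> 'a) \<Rightarrow> 'a" where
  "comb c = (\<Oplus>\<alpha>\<in>{\<alpha>. c \<alpha> \<noteq> \<zero>}. c \<alpha> \<otimes> mon \<alpha>)"

definition cf :: "'a \<Rightarrow> (nat \<Rightarrow> nat) \<Rightarrow> 'a" where
  "cf a = (THE c. c \<in> families \<and> a = comb c)"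

lemma families_R: "c \<in> families \<Longrightarrow> c \<alpha> \<in> R"
  unfolding families_def using R_zero by (cases "\<alpha> \<in> exponents n") auto

lemma comb_closed: "c \<in> families \<Longrightarrow> comb c \<in> carrier A"
  unfolding comb_def by (rule finsum_closed) (auto simp: mon_closed R_sub families_R)

lemma free': "a \<in> carrier A \<Longrightarrow> \<exists>!c. c \<in> families \<and> a = comb c"
  using free unfolding free_on_std_monomials_def families_def comb_def by (simp add: conj_assoc)

lemma cf_families: "a \<in> carrier A \<Longrightarrow> cf a \<in> families"
  and comb_cf: "a \<in> carrier A \<Longrightarrow> comb (cf a) = a"
  unfolding cf_def using theI'[OF free'] by auto

lemma cf_comb: "c \<in> families \<Longrightarrow> cf (comb c) = c"
  unfolding cf_def using free'[OF comb_closed] by (intro the1_equality) auto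

lemma cf_R: "a \<in> carrier A \<Longrightarrow> cf a \<alpha> \<in> R"
  by (simp add: families_R cf_families)

lemma cf_closed: "a \<in> carrier A \<Longrightarrow> cf a \<alpha> \<in> carrier A"
  by (simp add: R_sub cf_R)

lemma cf_outside: "\<lbrakk>a \<in> carrier A; \<alpha> \<notin> exponents n\<rbrakk> \<Longrightarrow> cf a \<alpha> = \<zero>"
  using cf_families[of a] by (simp add: families_def)

lemma cf_finite: "a \<in> carrier A \<Longrightarrow> finite {\<alpha>. cf a \<alpha> \<noteq> \<zero>}"
  using cf_families[of a] by (simp add: families_def)

lemma cf_eqD: "\<lbrakk>a \<in> carrier A; b \<in> carrier A; \<And>\<alpha>. cf a \<alpha> = cf b \<alpha>\<rbrakk> \<Longrightarrow> a = b"
  by (metis comb_cf ext)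

lemma comb_superset:
  assumes c: "c \<in> families" and F: "finite F" "{\<alpha>. c \<alpha> \<noteq> \<zero>} \<subseteq> F"
  shows "comb c = (\<Oplus>\<alpha>\<in>F. c \<alpha> \<otimes> mon \<alpha>)"
  unfolding comb_def
  by (rule add.finprod_mono_neutral_cong_left) (use F in \<open>auto simp: mon_closed R_sub families_R[OF c]\<close>)

lemma cf_expand:
  "\<lbrakk>a \<in> carrier A; finite F; {\<alpha>. cf a \<alpha> \<noteq> \<zero>} \<subseteq> F\<rbrakk> \<Longrightarrow> a = (\<Oplus>\<alpha>\<in>F. cf a \<alpha> \<otimes> mon \<alpha>)"
  using comb_superset[OF cf_families, of a F] by (simp add: comb_cf)

lemma cf_sum:
  assumes F: "finite F" "F \<subseteq> exponents n" and c: "\<And>\<alpha>. \<alpha> \<in> F \<Longrightarrow> c \<alpha> \<in> R"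
  shows "cf (\<Oplus>\<alpha>\<in>F. c \<alpha> \<otimes> mon \<alpha>) \<beta> = (if \<beta> \<in> F then c \<beta> else \<zero>)"
proof -
  let ?c = "\<lambda>\<alpha>. if \<alpha> \<in> F then c \<alpha> else \<zero>"
  have s: "{\<alpha>. ?c \<alpha> \<noteq> \<zero>} \<subseteq> F" by auto
  have "finite {\<alpha>. ?c \<alpha> \<noteq> \<zero>}" using s F(1) by (rule finite_subset)
  then have fam: "?c \<in> families" using F c R_zero unfolding families_def by auto
  have "(\<Oplus>\<alpha>\<in>F. c \<alpha> \<otimes> mon \<alpha>) = comb ?c"
    unfolding comb_superset[OF fam F(1) s]
    by (rule finsum_cong') (auto simp: mon_closed R_sub c)
  then show ?thesis by (simp add: cf_comb[OF fam])
qed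

lemma cf_add:
  assumes a: "a \<in> carrier A" and b: "b \<in> carrier A"
  shows "cf (a \<oplus> b) \<alpha> = cf a \<alpha> \<oplus> cf b \<alpha>"
proof -
  define F where "F = {\<alpha>. cf a \<alpha> \<noteq> \<zero>} \<union> {\<alpha>. cf b \<alpha> \<noteq> \<zero>}"
  have F: "finite F" "F \<subseteq> exponents n" using cf_finite cf_outside a b by (auto simp: F_def)
  note [simp] = mon_closed cf_closed a b
  have "a \<oplus> b = (\<Oplus>\<alpha>\<in>F. cf a \<alpha> \<otimes> mon \<alpha>) \<oplus> (\<Oplus>\<alpha>\<in>F. cf b \<alpha> \<otimes> mon \<alpha>)"
    using cf_expand[OF a F(1)] cf_expand[OF b F(1)] by (auto simp: F_def)
  also have "\<dots> = (\<Oplus>\<alpha>\<in>F. (cf a \<alpha> \<oplus> cf b \<alpha>) \<otimes> mon \<alpha>)"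
    by (subst finsum_addf[symmetric]) (auto simp: l_distr)
  also have "cf \<dots> \<alpha> = (if \<alpha> \<in> F then cf a \<alpha> \<oplus> cf b \<alpha> else \<zero>)"
    by (rule cf_sum[OF F]) (auto simp: R_add cf_R)
  finally show ?thesis by (auto simp: F_def)
qed

lemma cf_smult:
  assumes a: "a \<in> carrier A" and r: "r \<in> R"
  shows "cf (r \<otimes> a) \<alpha> = r \<otimes> cf a \<alpha>"
proof -
  define F where "F = {\<alpha>. cf a \<alpha> \<noteq> \<zero>}"
  have F: "finite F" "F \<subseteq> exponents n" using cf_finite cf_outside a by (auto simp: F_def)
  note [simp] = mon_closed cf_closed a R_sub[OF r]
  have "r \<otimes> a = r \<otimes> (\<Oplus>\<alpha>\<in>F. cf a \<alpha> \<otimes> mon \<alpha>)"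
    using cf_expand[OF a F(1)] by (auto simp: F_def)
  also have "\<dots> = (\<Oplus>\<alpha>\<in>F. (r \<otimes> cf a \<alpha>) \<otimes> mon \<alpha>)"
    by (subst finsum_rdistr) (use F in \<open>auto simp: m_assoc\<close>)
  also have "cf \<dots> \<alpha> = (if \<alpha> \<in> F then r \<otimes> cf a \<alpha> else \<zero>)"
    by (rule cf_sum[OF F]) (auto simp: R_mult cf_R r)
  finally show ?thesis by (auto simp: F_def)
qed

lemma cf_term:
  assumes "\<alpha> \<in> exponents n" "r \<in> R"
  shows "cf (r \<otimes> mon \<alpha>) \<beta> = (if \<beta> = \<alpha> then r else \<zero>)"
  using cf_sum[of "{\<alpha>}" "\<lambda>_. r" \<beta>] assms by (simp add: mon_closed R_sub)

lemma cf_mon: "\<alpha> \<in> exponents n \<Longrightarrow> cf (mon \<alpha>) \<beta> = (if \<beta> = \<alpha> then \<one> else \<zero>)"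
  using cf_term[of \<alpha> \<one> \<beta>] by (simp add: mon_closed R_one)

lemma cf_const: "r \<in> R \<Longrightarrow> cf r \<beta> = (if \<beta> = (\<lambda>_. 0) then r else \<zero>)"
  using cf_term[OF exponents_zero, of r \<beta>] by (simp add: monomial_zero R_sub)

lemma cf_zero: "cf \<zero> \<beta> = \<zero>"
  by (simp add: cf_const R_zero)

lemma cf_neg: "a \<in> carrier A \<Longrightarrow> cf (\<ominus> a) \<alpha> = \<ominus> cf a \<alpha>"
  using cf_add[of "\<ominus> a" a \<alpha>] by (simp add: cf_zero l_neg cf_closed minus_equality)

lemma cf_finsum:
  "f \<in> I \<rightarrow> carrier A \<Longrightarrow> cf (finsum A f I) \<alpha> = (\<Oplus>i\<in>I. cf (f i) \<alpha>)"
proof (induction I rule: infinite_finite_induct)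
  case (insert i I)
  then have "f \<in> I \<rightarrow> carrier A" "f i \<in> carrier A" by auto
  with insert show ?case by (simp add: cf_add cf_closed Pi_def)
qed (simp_all add: cf_zero)

lemma mon_single: "i \<in> {1..n} \<Longrightarrow> mon (incr (\<lambda>_. 0) i) = x i"
  by (subst monomial_incr_last) (auto simp: x_closed monomial_zero)

lemma mon_pair:
  assumes "i \<in> {1..n}" "j \<in> {1..n}" "i \<le> j"
  shows "mon (incr (incr (\<lambda>_. 0) i) j) = x i \<otimes> x j"
  by (subst monomial_incr_last) (use assms mon_single[of i] in \<open>auto simp: x_closed\<close>)

end

subsection \<open>Quantum affine spaces\<close>

text \<open>\<open>Q_unit\<close> asks for a one-sided inverse inside \<open>R\<close>; as
  \<open>R\<close> is commutative this makes \<open>Q j i\<close> a unit.\<close>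

locale quantum_affine = pbw_basis A R n x for A (structure) and R n x +
  fixes Q :: "nat \<Rightarrow> nat \<Rightarrow> 'a"
  assumes R_cring: "cring (A\<lparr>carrier := R\<rparr>)"
    and x_central: "\<lbrakk>i \<in> {1..n}; r \<in> R\<rbrakk> \<Longrightarrow> x i \<otimes> r = r \<otimes> x i"
    and Q_R: "\<lbrakk>i \<in> {1..n}; j \<in> {1..n}; i < j\<rbrakk> \<Longrightarrow> Q j i \<in> R"
    and Q_unit: "\<lbrakk>i \<in> {1..n}; j \<in> {1..n}; i < j\<rbrakk> \<Longrightarrow> \<exists>s\<in>R. s \<otimes> Q j i = \<one>"
    and x_swap: "\<lbrakk>i \<in> {1..n}; j \<in> {1..n}; i < j\<rbrakk> \<Longrightarrow> x j \<otimes> x i = Q j i \<otimes> (x i \<otimes> x j)"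
begin

lemma incl_hom: "(\<lambda>r. r) \<in> ring_hom (A\<lparr>carrier := R\<rparr>) A"
  by (rule ring_hom_memI) (auto simp: R_sub)

lemma incl_vars: "quantum_vars (A\<lparr>carrier := R\<rparr>) A (\<lambda>r. r) n Q x"
  unfolding quantum_vars_def quantum_vars_axioms_def
  using R_cring incl_hom ring_axioms
  by (auto simp: Q_R x_closed x_central x_swap cring_def intro!: ring_hom_ringI2)

lemma R_comm: "\<lbrakk>r \<in> R; s \<in> R\<rbrakk> \<Longrightarrow> r \<otimes> s = s \<otimes> r"
  using cring.cring_simprules(14)[OF R_cring] by simp

abbreviation tw :: "(nat \<Rightarrow> nat) \<Rightarrow> nat \<Rightarrow> 'a" where
  "tw \<equiv> twist (A\<lparr>carrier := R\<rparr>) n Q"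

lemma mon_mult_x: "i \<in> {1..n} \<Longrightarrow> mon \<alpha> \<otimes> x i = tw \<alpha> i \<otimes> mon (incr \<alpha> i)"
  by (rule quantum_vars.std_monomial_mult_var[OF incl_vars])

lemma tw_R: "i \<in> {1..n} \<Longrightarrow> tw \<alpha> i \<in> R"
  using quantum_vars.twist_closed[OF incl_vars] by simp

lemma tw_one: "(\<And>j. \<lbrakk>i < j; j \<le> n\<rbrakk> \<Longrightarrow> \<alpha> j = 0) \<Longrightarrow> tw \<alpha> i = \<one>"
  using quantum_vars.twist_one[OF incl_vars] by simp

lemma tw_incr: "\<lbrakk>i \<in> {1..n}; j \<in> {1..n}; i < j\<rbrakk> \<Longrightarrow> tw (incr \<alpha> j) i = Q j i \<otimes> tw \<alpha> i"
  using quantum_vars.twist_incr[OF incl_vars] by simp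

lemma mon_central: "r \<in> R \<Longrightarrow> r \<otimes> mon \<alpha> = mon \<alpha> \<otimes> r"
  using quantum_vars.std_monomial_central[OF incl_vars] by simp

lemma R_central:
  assumes r: "r \<in> R" and a: "a \<in> carrier A"
  shows "r \<otimes> a = a \<otimes> r"
proof -
  have "r \<otimes> comb c = comb c \<otimes> r" if c: "c \<in> families" for c
  proof -
    have fin: "finite {\<alpha>. c \<alpha> \<noteq> \<zero>}" using c by (simp add: families_def)
    have cl: "(\<lambda>\<alpha>. c \<alpha> \<otimes> mon \<alpha>) \<in> {\<alpha>. c \<alpha> \<noteq> \<zero>} \<rightarrow> carrier A"
      using c by (simp add: families_R R_sub mon_closed)
    have "r \<otimes> (c \<alpha> \<otimes> mon \<alpha>) = c \<alpha> \<otimes> mon \<alpha> \<otimes> r" for \<alpha>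
      using r c families_R[OF c, of \<alpha>] mon_closed[of \<alpha>]
      by (metis R_comm R_sub m_assoc mon_central)
    then show ?thesis unfolding comb_def
      by (simp add: finsum_rdistr[OF fin R_sub[OF r] cl] finsum_ldistr[OF fin R_sub[OF r] cl])
  qed
  then show ?thesis using comb_cf[OF a] cf_families[OF a] by metis
qed

text \<open>Right multiplication by x_i sends different basis monomials to multiples of different
  basis monomials, so each coefficient of the product has at most one source. Most later
  computations with coefficients go back to this formula.\<close>

lemma cf_mult_x:
  assumes a: "a \<in> carrier A" and i: "i \<in> {1..n}"
  shows "cf (a \<otimes> x i) \<gamma> = (if \<gamma> i = 0 then \<zero> else tw (decr \<gamma> i) i \<otimes> cf a (decr \<gamma> i))"
proof -
  define F where "F = {\<alpha>. cf a \<alpha> \<noteq> \<zero>}"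
  have F: "finite F" "F \<subseteq> exponents n" using cf_finite cf_outside a by (auto simp: F_def)
  note cl [simp] = mon_closed x_closed[OF i] cf_closed a R_sub[OF tw_R[OF i]]
  have "a \<otimes> x i = (\<Oplus>\<alpha>\<in>F. cf a \<alpha> \<otimes> mon \<alpha>) \<otimes> x i"
    using cf_expand[OF a F(1)] by (auto simp: F_def)
  also have "\<dots> = (\<Oplus>\<alpha>\<in>F. cf a \<alpha> \<otimes> mon \<alpha> \<otimes> x i)"
    by (rule finsum_ldistr) (use F in auto)
  also have "\<dots> = (\<Oplus>\<alpha>\<in>F. (tw \<alpha> i \<otimes> cf a \<alpha>) \<otimes> mon (incr \<alpha> i))"
    by (rule finsum_cong') (auto simp: m_assoc mon_mult_x[OF i] R_comm[OF tw_R[OF i] cf_R[OF a]])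
  finally have "cf (a \<otimes> x i) \<gamma> = (\<Oplus>\<alpha>\<in>F. cf ((tw \<alpha> i \<otimes> cf a \<alpha>) \<otimes> mon (incr \<alpha> i)) \<gamma>)"
    by (simp add: cf_finsum)
  also have "\<dots> = (\<Oplus>\<alpha>\<in>F. if \<gamma> = incr \<alpha> i then tw \<alpha> i \<otimes> cf a \<alpha> else \<zero>)"
    by (rule finsum_cong') (use F i in \<open>auto simp: cf_term exponents_incr R_mult tw_R cf_R a\<close>)
  also have "\<dots> = (if \<gamma> i = 0 then \<zero> else tw (decr \<gamma> i) i \<otimes> cf a (decr \<gamma> i))"
  proof (cases "\<gamma> i = 0")
    case True
    then have "\<gamma> \<noteq> incr \<alpha> i" for \<alpha> by auto
    then show ?thesis using True by simp
  next
    case False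
    \<comment> \<open>Since \<gamma> i is positive, the truncated subtraction is exact and
      \<open>decr\<close> really inverts \<open>incr\<close>.\<close>
    then have eq: "\<gamma> = incr \<alpha> i \<longleftrightarrow> decr \<gamma> i = \<alpha>" for \<alpha> by (auto simp: fun_eq_iff)
    show ?thesis
    proof (cases "decr \<gamma> i \<in> F")
      case True
      then show ?thesis unfolding eq using False
        add.finprod_singleton[OF True F(1), of "\<lambda>\<alpha>. tw \<alpha> i \<otimes> cf a \<alpha>"] by simp
    next
      case F': False
      then have "(\<Oplus>\<alpha>\<in>F. if decr \<gamma> i = \<alpha> then tw \<alpha> i \<otimes> cf a \<alpha> else \<zero>) = \<zero>"
        by (intro add.finprod_one_eqI) auto
      moreover have "cf a (decr \<gamma> i) = \<zero>" using F' by (simp add: F_def)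
      ultimately show ?thesis unfolding eq using False by simp
    qed
  qed
  finally show ?thesis .
qed

text \<open>Raising the largest index last means that \<open>mon_incr_last\<close> applies at each
  stage without a twist. Statements about monomials are thereby reduced to right multiplication by a
  single variable.\<close>

lemma exponents_induct [consumes 1, case_names zero incr]:
  assumes "\<alpha> \<in> exponents n" and zero: "P (\<lambda>_. 0)"
    and step: "\<And>\<alpha> m. \<lbrakk>\<alpha> \<in> exponents n; m \<in> {1..n}; \<And>j. m < j \<Longrightarrow> \<alpha> j = 0; P \<alpha>\<rbrakk> \<Longrightarrow> P (incr \<alpha> m)"
  shows "P \<alpha>"
  using assms(1)
proof (induction "sum \<alpha> {1..n}" arbitrary: \<alpha>)
  case 0
  then have "\<alpha> = (\<lambda>_. 0)" by (fastforce simp: exponents_def)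
  then show ?case using zero by simp
next
  case (Suc d)
  define S where "S = {i \<in> {1..n}. \<alpha> i \<noteq> 0}"
  define m where "m = Max S"
  have "\<exists>i\<in>{1..n}. \<alpha> i \<noteq> 0" by (rule ccontr) (use Suc.hyps(2) in simp)
  then have S: "finite S" "S \<noteq> {}" by (auto simp: S_def)
  then have m: "m \<in> {1..n}" "\<alpha> m \<noteq> 0" using Max_in[OF S] by (auto simp: m_def S_def)
  have last: "\<alpha> j = 0" if "m < j" for j
    using that Suc.prems S Max_ge[of S j] by (auto simp: m_def S_def exponents_def)
  have eq: "\<alpha> = incr (decr \<alpha> m) m" using m by auto
  have "sum (decr \<alpha> m) {1..n} = d"
    using Suc.hyps(2) m sum.remove[of "{1..n}" m \<alpha>] sum.remove[of "{1..n}" m "decr \<alpha> m"] by simp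
  then have "P (decr \<alpha> m)" using Suc.hyps(1) exponents_decr[OF Suc.prems] by auto
  then have "P (incr (decr \<alpha> m) m)"
    by (intro step) (use m last exponents_decr[OF Suc.prems] in auto)
  then show ?case using eq by simp
qed

lemma mon_incr_last:
  "\<lbrakk>m \<in> {1..n}; \<And>j. m < j \<Longrightarrow> \<alpha> j = 0\<rbrakk> \<Longrightarrow> mon (incr \<alpha> m) = mon \<alpha> \<otimes> x m"
  by (rule monomial_incr_last) (auto simp: x_closed)

subsection \<open>Grading and augmentation\<close>

definition deg :: "(nat \<Rightarrow> nat) \<Rightarrow> nat" where
  "deg \<alpha> = sum \<alpha> {1..n}"

definition D :: "nat \<Rightarrow> 'a set" where
  "D k = {a \<in> carrier A. \<forall>\<alpha>. cf a \<alpha> \<noteq> \<zero> \<longrightarrow> deg \<alpha> = k}"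

lemma deg_zero: "deg (\<lambda>_. 0) = 0"
  by (simp add: deg_def)

lemma deg_incr: "i \<in> {1..n} \<Longrightarrow> deg (incr \<alpha> i) = Suc (deg \<alpha>)"
  unfolding deg_def using sum.remove[of "{1..n}" i \<alpha>] sum.remove[of "{1..n}" i "incr \<alpha> i"] by simp

lemma deg_zeroD: "\<lbrakk>\<alpha> \<in> exponents n; deg \<alpha> = 0\<rbrakk> \<Longrightarrow> \<alpha> = (\<lambda>_. 0)"
  by (fastforce simp: exponents_def deg_def)

lemma D_closed: "a \<in> D k \<Longrightarrow> a \<in> carrier A"
  by (simp add: D_def)

lemma D_zero: "\<zero> \<in> D k" by (simp add: D_def cf_zero)

lemma D_add: "\<lbrakk>a \<in> D k; b \<in> D k\<rbrakk> \<Longrightarrow> a \<oplus> b \<in> D k"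
  by (auto simp: D_def cf_add) (metis R_zero R_sub l_zero)

lemma D_neg: "a \<in> D k \<Longrightarrow> \<ominus> a \<in> D k"
  by (auto simp: D_def cf_neg) (metis minus_zero)

lemma D_smult: "\<lbrakk>a \<in> D k; r \<in> R\<rbrakk> \<Longrightarrow> r \<otimes> a \<in> D k"
  by (auto simp: D_def cf_smult R_sub) (metis R_sub r_null)

lemma D_subgroup: "additive_subgroup (D k) A"
  by (rule additive_subgroupI, rule add.subgroupI)
     (use D_zero[of k] D_add D_neg in \<open>auto simp: D_closed a_inv_def[symmetric]\<close>)

lemma D_finsum: "(\<And>i. i \<in> F \<Longrightarrow> f i \<in> D k) \<Longrightarrow> finsum A f F \<in> D k"
proof (induction F rule: infinite_finite_induct)
  case (insert i F)
  then have "f i \<in> D k" "f i \<in> carrier A" "finsum A f F \<in> D k" "f \<in> F \<rightarrow> carrier A" using D_closed by auto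
  with insert show ?case by (simp add: D_add D_closed)
qed (simp_all add: D_zero)

lemma D_mult_x:
  assumes "a \<in> D k" "i \<in> {1..n}" shows "a \<otimes> x i \<in> D (Suc k)"
proof -
  have a: "a \<in> carrier A" using assms by (simp add: D_def)
  have "deg \<gamma> = Suc k" if "cf (a \<otimes> x i) \<gamma> \<noteq> \<zero>" for \<gamma>
  proof -
    have "\<gamma> i \<noteq> 0" "cf a (decr \<gamma> i) \<noteq> \<zero>"
      using that R_sub[OF tw_R[OF assms(2)]] by (auto simp: cf_mult_x[OF a assms(2)] split: if_splits)
    then have "deg (decr \<gamma> i) = k" "\<gamma> = incr (decr \<gamma> i) i" using assms(1) by (auto simp: D_def)
    then show ?thesis using deg_incr[OF assms(2), of "decr \<gamma> i"] by simp
  qed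
  then show ?thesis using a x_closed[OF assms(2)] by (simp add: D_def)
qed

lemma D_mult_mon: "\<lbrakk>\<beta> \<in> exponents n; a \<in> D k\<rbrakk> \<Longrightarrow> a \<otimes> mon \<beta> \<in> D (k + deg \<beta>)"
proof (induction rule: exponents_induct)
  case zero then show ?case by (simp add: monomial_zero deg_zero D_closed)
next
  case (incr \<beta> m)
  then have "a \<otimes> mon (incr \<beta> m) = (a \<otimes> mon \<beta>) \<otimes> x m"
    by (subst mon_incr_last) (auto simp: m_assoc D_closed mon_closed x_closed)
  then have "a \<otimes> mon (incr \<beta> m) \<in> D (k + deg (incr \<beta> m))"
    using D_mult_x[OF incr.IH[OF incr.prems] incr.hyps(2)] incr.hyps(2) by (simp add: deg_incr del: fun_upd_apply)
  then show ?case .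
qed

text \<open>Only the right factor is expanded into monomials; its coefficients move to the front
  because \<open>R\<close> is central.\<close>

lemma D_mult:
  assumes a: "a \<in> D i" and b: "b \<in> D j"
  shows "a \<otimes> b \<in> D (i + j)"
proof -
  have b': "b \<in> carrier A" and a': "a \<in> carrier A" using a b by (auto simp: D_def)
  have "a \<otimes> b = a \<otimes> (\<Oplus>\<beta>\<in>{\<beta>. cf b \<beta> \<noteq> \<zero>}. cf b \<beta> \<otimes> mon \<beta>)"
    using cf_expand[OF b' cf_finite[OF b']] by auto
  also have "\<dots> = (\<Oplus>\<beta>\<in>{\<beta>. cf b \<beta> \<noteq> \<zero>}. a \<otimes> (cf b \<beta> \<otimes> mon \<beta>))"
    by (rule finsum_rdistr) (use cf_finite[OF b'] a' in \<open>auto simp: cf_closed b' mon_closed\<close>)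
  also have "\<dots> \<in> D (i + j)"
  proof (rule D_finsum)
    fix \<beta> assume "\<beta> \<in> {\<beta>. cf b \<beta> \<noteq> \<zero>}"
    then have \<beta>: "\<beta> \<in> exponents n" "deg \<beta> = j" using b cf_outside[OF b'] by (auto simp: D_def)
    have "a \<otimes> (cf b \<beta> \<otimes> mon \<beta>) = cf b \<beta> \<otimes> (a \<otimes> mon \<beta>)"
      using R_central[OF cf_R[OF b'] a', of \<beta>] by (simp add: m_assoc[symmetric] a' b' cf_closed mon_closed)
    then show "a \<otimes> (cf b \<beta> \<otimes> mon \<beta>) \<in> D (i + j)"
      using D_smult[OF D_mult_mon[OF \<beta>(1) a] cf_R[OF b', of \<beta>]] \<beta>(2) by simp
  qed
  finally show ?thesis .
qed

lemma D_R: "r \<in> R \<Longrightarrow> r \<in> D 0"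
  by (simp add: D_def cf_const R_sub deg_zero)

lemma D_x: "i \<in> {1..n} \<Longrightarrow> x i \<in> D 1"
  using D_mult_x[OF D_R[OF R_one], of i] by (simp add: x_closed)

lemma D_0: "D 0 = R"
proof
  show "D 0 \<subseteq> R"
  proof
    fix a assume a: "a \<in> D 0"
    then have a': "a \<in> carrier A" by (simp add: D_closed)
    have "cf a \<alpha> = cf (cf a (\<lambda>_. 0)) \<alpha>" for \<alpha>
    proof (cases "\<alpha> = (\<lambda>_. 0)")
      case False
      then have "\<alpha> \<notin> exponents n \<or> deg \<alpha> \<noteq> 0" using deg_zeroD by metis
      then have "cf a \<alpha> = \<zero>"
        using a cf_outside[OF a', of \<alpha>] unfolding D_def mem_Collect_eq by metis
      then show ?thesis using False by (simp add: cf_const[OF cf_R[OF a']])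
    qed (simp add: cf_const[OF cf_R[OF a']])
    then have "a = cf a (\<lambda>_. 0)" by (rule cf_eqD[OF a' cf_closed[OF a']])
    then show "a \<in> R" using a by (metis D_closed cf_R)
  qed
qed (auto simp: D_R)

definition homog_part :: "'a \<Rightarrow> nat \<Rightarrow> 'a" where
  "homog_part a k = (\<Oplus>\<alpha>\<in>{\<alpha>. cf a \<alpha> \<noteq> \<zero> \<and> deg \<alpha> = k}. cf a \<alpha> \<otimes> mon \<alpha>)"

lemma homog_part_closed: "a \<in> carrier A \<Longrightarrow> homog_part a k \<in> carrier A"
  unfolding homog_part_def by (rule finsum_closed) (auto simp: cf_closed mon_closed)

lemma cf_homog_part: "a \<in> carrier A \<Longrightarrow> cf (homog_part a k) \<alpha> = (if deg \<alpha> = k then cf a \<alpha> else \<zero>)"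
  unfolding homog_part_def using cf_finite[of a] cf_outside[of a]
  by (subst cf_sum) (auto simp: cf_R)

lemma homog_part_D: "a \<in> carrier A \<Longrightarrow> homog_part a k \<in> D k"
  by (simp add: D_def homog_part_closed cf_homog_part)

text \<open>Different degrees use disjoint parts of the basis, so a sum of homogeneous elements can
  be taken apart coefficientwise. This yields uniqueness of homogeneous components here and
  homogeneity of the kernel of the presentation later.\<close>

lemma cf_graded_sum:
  assumes K: "finite K" and y: "\<And>k. k \<in> K \<Longrightarrow> y k \<in> D k"
  shows "cf (\<Oplus>k\<in>K. y k) \<alpha> = (if deg \<alpha> \<in> K then cf (y (deg \<alpha>)) \<alpha> else \<zero>)"
proof -
  have "cf (\<Oplus>k\<in>K. y k) \<alpha> = (\<Oplus>k\<in>K. cf (y k) \<alpha>)"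
    by (rule cf_finsum) (use y D_closed in auto)
  also have "\<dots> = (\<Oplus>k\<in>K. if deg \<alpha> = k then cf (y k) \<alpha> else \<zero>)"
    by (rule finsum_cong') (use y in \<open>auto simp: D_def cf_closed\<close>)
  also have "\<dots> = (if deg \<alpha> \<in> K then cf (y (deg \<alpha>)) \<alpha> else \<zero>)"
  proof (cases "deg \<alpha> \<in> K")
    case True
    then show ?thesis using add.finprod_singleton[OF True K, of "\<lambda>k. cf (y k) \<alpha>"] y
      by (auto simp: D_def cf_closed)
  next
    case False
    then show ?thesis by (auto intro: add.finprod_one_eqI)
  qed
  finally show ?thesis .
qed

lemma sum_homog_part:
  assumes a: "a \<in> carrier A" and K: "finite K" "\<And>\<alpha>. cf a \<alpha> \<noteq> \<zero> \<Longrightarrow> deg \<alpha> \<in> K"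
  shows "(\<Oplus>k\<in>K. homog_part a k) = a"
proof (rule cf_eqD)
  show "(\<Oplus>k\<in>K. homog_part a k) \<in> carrier A" by (rule finsum_closed) (use a homog_part_closed in auto)
  show "cf (\<Oplus>k\<in>K. homog_part a k) \<alpha> = cf a \<alpha>" for \<alpha>
    using cf_graded_sum[OF K(1), of "homog_part a" \<alpha>] K(2)[of \<alpha>] by (cases "cf a \<alpha> = \<zero>") (auto simp: homog_part_D a cf_homog_part)
qed (rule a)

lemma grading: "nat_grading (A\<lparr>carrier := R\<rparr>) A (\<lambda>r. r) D"
proof -
  have "\<exists>!y. (\<forall>n. y n \<in> D n) \<and> finite {n. y n \<noteq> \<zero>} \<and> a = (\<Oplus>n\<in>{n. y n \<noteq> \<zero>}. y n)"
    if a: "a \<in> carrier A" for a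
  proof (rule ex1I[of _ "homog_part a"])
    have cfd: "homog_part a (deg \<alpha>) \<noteq> \<zero>" if "cf a \<alpha> \<noteq> \<zero>" for \<alpha>
      using that cf_homog_part[OF a, of "deg \<alpha>" \<alpha>] by (auto simp: cf_zero)
    have "homog_part a k = \<zero>" if "k \<notin> deg ` {\<alpha>. cf a \<alpha> \<noteq> \<zero>}" for k
    proof -
      have "{\<alpha>. cf a \<alpha> \<noteq> \<zero> \<and> deg \<alpha> = k} = {}" using that by auto
      then show ?thesis unfolding homog_part_def by (simp only: finsum_empty)
    qed
    then have "{k. homog_part a k \<noteq> \<zero>} \<subseteq> deg ` {\<alpha>. cf a \<alpha> \<noteq> \<zero>}" by auto
    then have "finite {k. homog_part a k \<noteq> \<zero>}" using cf_finite[OF a] finite_subset by blast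
    then show "(\<forall>n. homog_part a n \<in> D n) \<and> finite {n. homog_part a n \<noteq> \<zero>} \<and> a = (\<Oplus>n\<in>{n. homog_part a n \<noteq> \<zero>}. homog_part a n)"
      using sum_homog_part[OF a, of "{n. homog_part a n \<noteq> \<zero>}"] cfd homog_part_D[OF a] by simp
    fix y assume y: "(\<forall>n. y n \<in> D n) \<and> finite {n. y n \<noteq> \<zero>} \<and> a = (\<Oplus>n\<in>{n. y n \<noteq> \<zero>}. y n)"
    then have yD: "y k \<in> D k" and fin: "finite {k. y k \<noteq> \<zero>}" for k by auto
    \<comment> \<open>Only the component in degree \<open>deg \<alpha>\<close> can contribute to the
      coefficient at \<alpha>, so any decomposition is determined by a.\<close>
    have c: "cf a \<alpha> = cf (y (deg \<alpha>)) \<alpha>" for \<alpha>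
    proof -
      have "cf a \<alpha> = cf (\<Oplus>k\<in>{k. y k \<noteq> \<zero>}. y k) \<alpha>" using y by simp
      also have "\<dots> = cf (y (deg \<alpha>)) \<alpha>" by (subst cf_graded_sum[OF fin yD]) (auto simp: cf_zero)
      finally show ?thesis .
    qed
    show "y = homog_part a"
    proof
      fix k
      show "y k = homog_part a k"
        by (rule cf_eqD) (use yD[of k] c in \<open>auto simp: homog_part_closed a cf_homog_part D_def\<close>)
    qed
  qed
  then show ?thesis unfolding nat_grading_def using D_subgroup D_R D_mult by auto
qed

section \<open>The augmentation ideal and constant terms\<close>

definition Ap :: "'a set" where
  "Ap = {a \<in> carrier A. cf a (\<lambda>_. 0) = \<zero>}"

abbreviation \<epsilon> :: "'a \<Rightarrow> 'a" where "\<epsilon> a \<equiv> cf a (\<lambda>_. 0)"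

lemma \<epsilon>_mult_x: "\<lbrakk>a \<in> carrier A; i \<in> {1..n}\<rbrakk> \<Longrightarrow> \<epsilon> (a \<otimes> x i) = \<zero>"
  by (simp add: cf_mult_x)

text \<open>Serves two cases: \<gamma> = 0, and \<gamma> the exponent of one variable when a has no
  constant term. In both, a nonconstant monomial of b ends in a variable and therefore cannot
  contribute at \<gamma>, which leaves only the constant term of b.\<close>

lemma cf_mult_constant_term:
  assumes a: "a \<in> carrier A" and b: "b \<in> carrier A"
    and z: "\<And>\<beta> m. m \<in> {1..n} \<Longrightarrow> cf (a \<otimes> mon \<beta> \<otimes> x m) \<gamma> = \<zero>"
  shows "cf (a \<otimes> b) \<gamma> = cf a \<gamma> \<otimes> \<epsilon> b"
proof -
  have m: "cf (a \<otimes> mon \<beta>) \<gamma> = (if \<beta> = (\<lambda>_. 0) then cf a \<gamma> else \<zero>)" if "\<beta> \<in> exponents n" for \<beta>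
    using that
  proof (induction rule: exponents_induct)
    case zero
    then show ?case using a by (simp add: monomial_zero)
  next
    case (incr \<beta> m)
    then have "cf (a \<otimes> mon (incr \<beta> m)) \<gamma> = cf (a \<otimes> mon \<beta> \<otimes> x m) \<gamma>"
      by (subst mon_incr_last) (auto simp: m_assoc a mon_closed x_closed)
    also have "\<dots> = \<zero>" by (rule z[OF incr.hyps(2)])
    finally have "cf (a \<otimes> mon (incr \<beta> m)) \<gamma> = \<zero>" .
    moreover have "incr \<beta> m \<noteq> (\<lambda>_. 0)" by (auto simp: fun_eq_iff)
    ultimately have "cf (a \<otimes> mon (incr \<beta> m)) \<gamma> = (if incr \<beta> m = (\<lambda>_. 0) then cf a \<gamma> else \<zero>)"
      by (simp only: if_False)
    then show ?case .
  qed
  \<comment> \<open>The zero exponent is added to the support so that the constant term of b can be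
    singled out even if it vanishes.\<close>
  define F where "F = insert (\<lambda>_. 0) {\<beta>. cf b \<beta> \<noteq> \<zero>}"
  have F: "finite F" "F \<subseteq> exponents n" "(\<lambda>_. 0) \<in> F"
    using cf_finite[OF b] cf_outside[OF b] exponents_zero by (auto simp: F_def)
  have "a \<otimes> b = a \<otimes> (\<Oplus>\<beta>\<in>F. cf b \<beta> \<otimes> mon \<beta>)"
    by (subst cf_expand[OF b F(1)]) (auto simp: F_def)
  also have "\<dots> = (\<Oplus>\<beta>\<in>F. a \<otimes> (cf b \<beta> \<otimes> mon \<beta>))"
    by (rule finsum_rdistr) (use F a in \<open>auto simp: cf_closed b mon_closed\<close>)
  also have "\<dots> = (\<Oplus>\<beta>\<in>F. cf b \<beta> \<otimes> (a \<otimes> mon \<beta>))"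
    by (rule finsum_cong') (use R_central[OF cf_R[OF b] a] in
        \<open>auto simp: m_assoc[symmetric] a b cf_closed mon_closed\<close>)
  finally have "cf (a \<otimes> b) \<gamma> = (\<Oplus>\<beta>\<in>F. cf (cf b \<beta> \<otimes> (a \<otimes> mon \<beta>)) \<gamma>)"
    by (simp add: cf_finsum a b cf_closed mon_closed)
  also have "\<dots> = (\<Oplus>\<beta>\<in>F. if (\<lambda>_. 0) = \<beta> then cf b \<beta> \<otimes> cf a \<gamma> else \<zero>)"
    by (rule finsum_cong') (use F(2) in \<open>auto simp: cf_smult a b cf_R cf_closed mon_closed m subset_iff\<close>)
  also have "\<dots> = \<epsilon> b \<otimes> cf a \<gamma>"
    using add.finprod_singleton[OF F(3,1), of "\<lambda>\<beta>. cf b \<beta> \<otimes> cf a \<gamma>"] by (simp add: cf_closed a b)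
  finally show ?thesis by (simp add: R_comm cf_R a b)
qed

lemma \<epsilon>_mult: "\<lbrakk>a \<in> carrier A; b \<in> carrier A\<rbrakk> \<Longrightarrow> \<epsilon> (a \<otimes> b) = \<epsilon> a \<otimes> \<epsilon> b"
  by (rule cf_mult_constant_term) (auto simp: \<epsilon>_mult_x mon_closed)

lemma Ap_ideal: "ideal Ap A"
proof (rule idealI)
  show "subgroup Ap (add_monoid A)"
    by (rule add.subgroupI) (auto simp: Ap_def cf_zero cf_neg cf_add a_inv_def[symmetric])
qed (auto simp: Ap_def \<epsilon>_mult cf_closed ring_axioms)

lemma augmentation: "augmentation_ideal (A\<lparr>carrier := R\<rparr>) A (\<lambda>r. r) Ap"
proof -
  have "\<exists>!(p, r). p \<in> Ap \<and> r \<in> R \<and> a = p \<oplus> r" if a: "a \<in> carrier A" for a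
  proof (rule ex1I[of _ "(a \<ominus> \<epsilon> a, \<epsilon> a)"])
    note [simp] = a cf_closed[OF a] cf_R[OF a]
    have "\<epsilon> (a \<ominus> \<epsilon> a) = \<zero>" by (simp add: a_minus_def cf_add cf_neg cf_const r_neg)
    moreover have "a = (a \<ominus> \<epsilon> a) \<oplus> \<epsilon> a" by (simp add: a_minus_def a_assoc l_neg)
    ultimately show "case (a \<ominus> \<epsilon> a, \<epsilon> a) of (p, r) \<Rightarrow> p \<in> Ap \<and> r \<in> R \<and> a = p \<oplus> r"
      by (simp add: Ap_def)
    fix q assume "case q of (p, r) \<Rightarrow> p \<in> Ap \<and> r \<in> R \<and> a = p \<oplus> r"
    then obtain p r where q: "q = (p, r)" "p \<in> carrier A" "\<epsilon> p = \<zero>" "r \<in> R" "a = p \<oplus> r"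
      by (auto simp: Ap_def)
    then have "\<epsilon> a = r" by (simp add: cf_add cf_const R_sub)
    moreover have "a \<ominus> r = p" using q R_sub[OF q(4)] by (simp add: a_minus_def a_assoc r_neg)
    ultimately show "q = (a \<ominus> \<epsilon> a, \<epsilon> a)" using q by simp
  qed
  then show ?thesis unfolding augmentation_ideal_def using Ap_ideal by simp
qed

lemma Ap_component_sum: "Ap = component_sum A D {1..}"
proof
  show "Ap \<subseteq> component_sum A D {1..}"
  proof
    fix a assume a: "a \<in> Ap"
    then have a': "a \<in> carrier A" by (simp add: Ap_def)
    have "deg \<alpha> \<in> {1..}" if "cf a \<alpha> \<noteq> \<zero>" for \<alpha>
      using that a deg_zeroD[of \<alpha>] cf_outside[OF a'] by (fastforce simp: Ap_def Suc_le_eq)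
    then have "deg ` {\<alpha>. cf a \<alpha> \<noteq> \<zero>} \<subseteq> {1..}" by auto
    moreover have "a = (\<Oplus>k\<in>deg ` {\<alpha>. cf a \<alpha> \<noteq> \<zero>}. homog_part a k)"
      by (rule sum_homog_part[symmetric]) (auto simp: a' cf_finite)
    ultimately show "a \<in> component_sum A D {1..}"
      unfolding component_sum_def using cf_finite[OF a'] homog_part_D[OF a'] by blast
  qed
  show "component_sum A D {1..} \<subseteq> Ap"
  proof
    fix a assume "a \<in> component_sum A D {1..}"
    then obtain F y where a: "a = (\<Oplus>i\<in>F. y i)" "finite F" "F \<subseteq> {1..}" "\<forall>i\<in>F. y i \<in> D i"
      unfolding component_sum_def by blast
    have "a \<in> carrier A" unfolding a(1) by (rule finsum_closed) (use a D_closed in auto)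
    moreover have "cf a (\<lambda>_. 0) = \<zero>" unfolding a(1) using a(2-4)
      by (subst cf_graded_sum) (auto simp: deg_zero)
    ultimately show "a \<in> Ap" by (simp add: Ap_def)
  qed
qed

lemma central: "central_algebra (A\<lparr>carrier := R\<rparr>) A (\<lambda>r. r)"
  unfolding central_algebra_def using R_cring ring_axioms incl_hom by (auto intro: R_central)

end

text \<open>Keeps \<open>{1..n}\<close> from being rewritten to \<open>{Suc 0..n}\<close>.\<close>

declare One_nat_def [simp del]

text \<open>\<open>K_property\<close> wants resolutions indexed by lists; any injection from finite sets of indices would do.\<close>

definition enc :: "nat set \<Rightarrow> 'a list" where
  "enc S = replicate (set_encode S) undefined"

definition dec :: "'a list \<Rightarrow> nat set" where
  "dec l = set_decode (length l)"

lemma dec_enc: "finite S \<Longrightarrow> dec (enc S) = S"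
  by (simp add: enc_def dec_def)

text \<open>The cancellation behind d d = 0. Induction removes one index together with its row and
  its column; these two lines cancel entry by entry.\<close>

lemma (in abelian_group) antisymmetric_double_sum:
  assumes "finite M"
    and "\<And>i j. \<lbrakk>i \<in> M; j \<in> M\<rbrakk> \<Longrightarrow> t i j \<in> carrier G"
    and "\<And>i j. \<lbrakk>i \<in> M; j \<in> M; i \<noteq> j\<rbrakk> \<Longrightarrow> t i j \<oplus> t j i = \<zero>"
  shows "(\<Oplus>i\<in>M. \<Oplus>j\<in>M - {i}. t i j) = \<zero>"
  using assms
proof (induction M rule: finite_induct)
  case (insert a M)
  have t: "t i j \<in> carrier G" if "i \<in> insert a M" "j \<in> insert a M" for i j
    using insert.prems(1) that by blast
  have row: "(\<Oplus>j\<in>insert a M - {i}. t i j) = t i a \<oplus> (\<Oplus>j\<in>M - {i}. t i j)" if "i \<in> M" for i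
  proof -
    have "insert a M - {i} = insert a (M - {i})" using that insert.hyps by auto
    then show ?thesis using insert.hyps t that by (simp add: Pi_def)
  qed
  have "(\<Oplus>i\<in>insert a M. \<Oplus>j\<in>insert a M - {i}. t i j) =
      (\<Oplus>j\<in>insert a M - {a}. t a j) \<oplus> (\<Oplus>i\<in>M. \<Oplus>j\<in>insert a M - {i}. t i j)"
    by (rule finsum_insert) (use insert.hyps t in auto)
  also have "insert a M - {a} = M" using insert.hyps by auto
  also have "(\<Oplus>i\<in>M. \<Oplus>j\<in>insert a M - {i}. t i j) = (\<Oplus>i\<in>M. t i a \<oplus> (\<Oplus>j\<in>M - {i}. t i j))"
    by (rule finsum_cong') (use row t in auto)
  also have "\<dots> = (\<Oplus>i\<in>M. t i a) \<oplus> (\<Oplus>i\<in>M. \<Oplus>j\<in>M - {i}. t i j)"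
    by (rule finsum_addf) (use t in auto)
  also have "(\<Oplus>i\<in>M. \<Oplus>j\<in>M - {i}. t i j) = \<zero>"
    using insert.IH insert.prems by simp
  also have "(\<Oplus>j\<in>M. t a j) \<oplus> ((\<Oplus>i\<in>M. t i a) \<oplus> \<zero>) = (\<Oplus>j\<in>M. t a j \<oplus> t j a)"
    using t by (simp add: finsum_addf Pi_def)
  also have "\<dots> = \<zero>"
    by (rule add.finprod_one_eqI) (use insert in auto)
  finally show ?case .
qed simp

section \<open>Coefficients of the Koszul differential\<close>

context quantum_affine
begin

text \<open>
  The coefficient of \<open>x\<^sub>i e\<^sub>S\<close> in \<open>d e\<^bsub>S \<union> i\<^esub>\<close>. Counting only the indices above \<open>i\<close> makes the coefficient
  belonging to the largest index \<open>1\<close>; the factors \<open>-q\<^sub>j\<^sub>i\<close> make \<open>d \<circ> d\<close> vanish.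
\<close>

definition koszul_coeff :: "nat \<Rightarrow> nat set \<Rightarrow> 'a" where
  "koszul_coeff i S = finprod (A\<lparr>carrier := R\<rparr>) (\<lambda>j. \<ominus> Q j i) {j \<in> S. i < j}"

lemma koszul_coeff_R:
  assumes "i \<in> {1..n}" "S \<subseteq> {1..n}"
  shows "koszul_coeff i S \<in> R"
proof -
  interpret RR: cring "A\<lparr>carrier := R\<rparr>" by (rule R_cring)
  have "(\<lambda>j. \<ominus> Q j i) \<in> {j \<in> S. i < j} \<rightarrow> carrier (A\<lparr>carrier := R\<rparr>)"
    using assms by (auto intro!: R_neg Q_R)
  then show ?thesis unfolding koszul_coeff_def using RR.finprod_closed by simp
qed

lemma koszul_coeff_union:
  assumes "i \<in> {1..n}" "S \<union> T \<subseteq> {1..n}" "S \<inter> T = {}"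
  shows "koszul_coeff i (S \<union> T) = koszul_coeff i S \<otimes> koszul_coeff i T"
proof -
  interpret RR: cring "A\<lparr>carrier := R\<rparr>" by (rule R_cring)
  have c: "(\<lambda>j. \<ominus> Q j i) \<in> {j \<in> U. i < j} \<rightarrow> carrier (A\<lparr>carrier := R\<rparr>)" if "U \<subseteq> {1..n}" for U
    using assms that by (auto intro!: R_neg Q_R)
  have "finite {j \<in> S. i < j}" "finite {j \<in> T. i < j}"
    using assms finite_subset[of _ "{1..n}"] by auto
  moreover have "{j \<in> S \<union> T. i < j} = {j \<in> S. i < j} \<union> {j \<in> T. i < j}" by auto
  ultimately show ?thesis unfolding koszul_coeff_def using assms c[of S] c[of T]
    by (subst \<open>{j \<in> S \<union> T. i < j} = _\<close>, subst RR.finprod_Un_disjoint) auto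
qed

lemma koszul_coeff_top: "(\<And>j. j \<in> S \<Longrightarrow> j \<le> i) \<Longrightarrow> koszul_coeff i S = \<one>"
proof -
  assume "\<And>j. j \<in> S \<Longrightarrow> j \<le> i"
  then have e: "{j \<in> S. i < j} = {}" by fastforce
  interpret RR: cring "A\<lparr>carrier := R\<rparr>" by (rule R_cring)
  show ?thesis unfolding koszul_coeff_def e by simp
qed

lemma koszul_coeff_empty [simp]: "koszul_coeff i {} = \<one>"
  by (rule koszul_coeff_top) simp

lemma koszul_coeff_single:
  assumes "i \<in> {1..n}" "j \<in> {1..n}" shows "koszul_coeff i {j} = (if i < j then \<ominus> Q j i else \<one>)"
proof (cases "i < j")
  case True
  then have e: "{k \<in> {j}. i < k} = {j}" by auto
  interpret RR: cring "A\<lparr>carrier := R\<rparr>" by (rule R_cring)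
  show ?thesis unfolding koszul_coeff_def e using True Q_R[OF assms True]
    by (subst RR.finprod_insert) (auto simp: R_neg R_sub)
next
  case False
  then show ?thesis by (subst koszul_coeff_top) auto
qed

lemma koszul_coeff_insert:
  assumes "i \<in> {1..n}" "insert j S \<subseteq> {1..n}" "j \<notin> S"
  shows "koszul_coeff i (insert j S) = (if i < j then \<ominus> Q j i \<otimes> koszul_coeff i S else koszul_coeff i S)"
  using koszul_coeff_union[of i "{j}" S] assms koszul_coeff_R[of i S] by (simp add: koszul_coeff_single R_sub)

text \<open>Invertibility is what lets coefficients be cancelled when lifts are determined
  recursively, and, through \<open>shuffle_coeff_unit\<close>, what lets products of dual symbols be
  normalised.\<close>

lemma koszul_coeff_unit:
  assumes "i \<in> {1..n}" "S \<subseteq> {1..n}"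
  shows "\<exists>s\<in>R. s \<otimes> koszul_coeff i S = \<one>"
proof -
  have "finite S" using assms finite_subset by auto
  then show ?thesis using assms
  proof (induction S rule: finite_induct)
    case empty
    then show ?case by (auto simp: koszul_coeff_top intro!: bexI[of _ \<one>] R_one)
  next
    case (insert j S)
    then obtain s where s: "s \<in> R" "s \<otimes> koszul_coeff i S = \<one>" by auto
    show ?case
    proof (cases "i < j")
      case True
      have j: "j \<in> {1..n}" and q: "Q j i \<in> R" using insert.prems True by (auto intro: Q_R)
      obtain t where t: "t \<in> R" "t \<otimes> Q j i = \<one>" using Q_unit[of i j] insert.prems True j by auto
      have k: "koszul_coeff i S \<in> R" using insert.prems by (auto intro: koszul_coeff_R)
      have "(s \<otimes> \<ominus> t) \<otimes> (\<ominus> Q j i \<otimes> koszul_coeff i S) = s \<otimes> ((t \<otimes> Q j i) \<otimes> koszul_coeff i S)"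
        using R_sub[OF s(1)] R_sub[OF t(1)] R_sub[OF q] R_sub[OF k]
        by (simp add: m_assoc l_minus r_minus)
      also have "\<dots> = \<one>" using R_sub[OF k] s t by simp
      finally show ?thesis using insert.prems insert.hyps True s t
        by (intro bexI[of _ "s \<otimes> \<ominus> t"]) (auto simp: koszul_coeff_insert R_mult R_neg)
    next
      case False
      then show ?thesis using insert s by (auto simp: koszul_coeff_insert)
    qed
  qed
qed

subsection \<open>The Koszul complex\<close>

definition G :: "nat \<Rightarrow> 'a list set" where
  "G k = enc ` {S. S \<subseteq> {1..n} \<and> card S = k}"

abbreviation PM :: "nat \<Rightarrow> ('a, 'a list \<Rightarrow> 'a) module" where
  "PM k \<equiv> free_left_module A (G k)"

lemma dec_enc_N: "S \<subseteq> {1..n} \<Longrightarrow> dec (enc S) = S"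
  by (rule dec_enc) (rule finite_subset, auto)

lemma enc_eq_iff: "\<lbrakk>S \<subseteq> {1..n}; T \<subseteq> {1..n}\<rbrakk> \<Longrightarrow> enc S = enc T \<longleftrightarrow> S = T"
  using dec_enc_N by metis

lemma enc_G: "S \<subseteq> {1..n} \<Longrightarrow> enc S \<in> G k \<longleftrightarrow> card S = k"
  by (auto simp: G_def enc_eq_iff)

lemma G_enc: "G k \<subseteq> enc ` Pow {1..n}" by (auto simp: G_def)

lemma finite_G: "finite (G k)"
  by (rule finite_subset[OF G_enc]) simp

text \<open>The basis is finite, so the finite support condition in the free module holds
  automatically.\<close>

lemma PM_iff: "p \<in> carrier (PM k) \<longleftrightarrow> (\<forall>l. p l \<in> carrier A) \<and> (\<forall>l. l \<notin> G k \<longrightarrow> p l = \<zero>)"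
proof -
  have "finite {l. p l \<noteq> \<zero>}" if "\<forall>l. l \<notin> G k \<longrightarrow> p l = \<zero>"
    by (rule finite_subset[OF _ finite_G[of k]]) (use that in auto)
  then show ?thesis by (auto simp: free_left_module_def)
qed

lemma PM_closed: "p \<in> carrier (PM k) \<Longrightarrow> p l \<in> carrier A"
  by (simp add: PM_iff)

lemma PM_zero: "\<lbrakk>p \<in> carrier (PM k); S \<subseteq> {1..n}; card S \<noteq> k\<rbrakk> \<Longrightarrow> p (enc S) = \<zero>"
  using enc_G[of S k] by (simp add: PM_iff)

lemma PM_eqI:
  assumes "p \<in> carrier (PM k)" "q \<in> carrier (PM k)"
    and "\<And>S. \<lbrakk>S \<subseteq> {1..n}; card S = k\<rbrakk> \<Longrightarrow> p (enc S) = q (enc S)"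
  shows "p = q"
proof
  fix l
  show "p l = q l"
  proof (cases "l \<in> G k")
    case True
    then show ?thesis using assms(3) by (auto simp: G_def)
  qed (use assms(1,2) in \<open>simp add: PM_iff\<close>)
qed

lemma PM_add: "p \<oplus>\<^bsub>PM k\<^esub> q = (\<lambda>l. p l \<oplus> q l)"
  and PM_smult: "a \<odot>\<^bsub>PM k\<^esub> p = (\<lambda>l. a \<otimes> p l)"
  and PM_0: "\<zero>\<^bsub>PM k\<^esub> = (\<lambda>l. \<zero>)"
  by (simp_all add: free_left_module_def)

text \<open>The variables stand on the right so that d is linear for the left action of
  \<open>A\<close>. The size of the subset is not consulted: one function serves as the differential
  in every degree.\<close>

definition d :: "('a list \<Rightarrow> 'a) \<Rightarrow> ('a list \<Rightarrow> 'a)" where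
  "d p = (\<lambda>l. if l \<in> enc ` Pow {1..n}
     then (\<Oplus>i\<in>{1..n} - dec l. koszul_coeff i (dec l) \<otimes> p (enc (insert i (dec l))) \<otimes> x i) else \<zero>)"

lemma d_enc:
  "T \<subseteq> {1..n} \<Longrightarrow> d p (enc T) = (\<Oplus>i\<in>{1..n} - T. koszul_coeff i T \<otimes> p (enc (insert i T)) \<otimes> x i)"
  by (simp add: d_def dec_enc_N)

lemma d_term_closed:
  "\<lbrakk>\<And>l. p l \<in> carrier A; T \<subseteq> {1..n}; i \<in> {1..n}\<rbrakk> \<Longrightarrow> koszul_coeff i T \<otimes> p (enc (insert i T)) \<otimes> x i \<in> carrier A"
  by (simp add: x_closed koszul_coeff_R R_sub)

lemma d_closed: "(\<And>l. p l \<in> carrier A) \<Longrightarrow> d p l \<in> carrier A"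
  unfolding d_def using d_term_closed[of p] by (auto intro!: finsum_closed simp: dec_enc_N)

lemma card_insert_N: "\<lbrakk>T \<subseteq> {1..n}; i \<notin> T\<rbrakk> \<Longrightarrow> card (insert i T) = Suc (card T)"
  using finite_subset[of T "{1..n}"] by simp

lemma d_PM:
  assumes p: "p \<in> carrier (PM (Suc k))"
  shows "d p \<in> carrier (PM k)"
proof -
  have "d p l = \<zero>" if "l \<notin> G k" for l
  proof (cases "l \<in> enc ` Pow {1..n}")
    case True
    then obtain T where T: "T \<subseteq> {1..n}" "l = enc T" by auto
    then have "card T \<noteq> k" using that enc_G by simp
    then have "p (enc (insert i T)) = \<zero>" if "i \<in> {1..n} - T" for i
      using that T card_insert_N[of T i] by (intro PM_zero[OF p]) auto
    then show ?thesis unfolding T(2) d_enc[OF T(1)]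
      by (intro add.finprod_one_eqI) (use T in \<open>auto simp: koszul_coeff_R R_sub x_closed\<close>)
  qed (auto simp: d_def)
  then show ?thesis using d_closed PM_closed[OF p] by (simp add: PM_iff)
qed

lemma d_hom: "d \<in> left_module_hom A (PM (Suc k)) (PM k)"
proof -
  have add: "d (\<lambda>l. p l \<oplus> q l) = (\<lambda>l. d p l \<oplus> d q l)"
    if p: "p \<in> carrier (PM (Suc k))" and q: "q \<in> carrier (PM (Suc k))" for p q
  proof (rule ext)
    fix l
    note [simp] = PM_closed[OF p] PM_closed[OF q] x_closed
    show "d (\<lambda>l. p l \<oplus> q l) l = d p l \<oplus> d q l"
    proof (cases "l \<in> enc ` Pow {1..n}")
      case True
      then obtain T where T: "T \<subseteq> {1..n}" "l = enc T" by auto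
      have "(\<Oplus>i\<in>{1..n} - T. koszul_coeff i T \<otimes> (p (enc (insert i T)) \<oplus> q (enc (insert i T))) \<otimes> x i) =
          (\<Oplus>i\<in>{1..n} - T. koszul_coeff i T \<otimes> p (enc (insert i T)) \<otimes> x i \<oplus> koszul_coeff i T \<otimes> q (enc (insert i T)) \<otimes> x i)"
        by (rule finsum_cong') (use T in \<open>auto simp: koszul_coeff_R R_sub l_distr r_distr\<close>)
      then show ?thesis unfolding T(2) d_enc[OF T(1)]
        by (subst finsum_addf[symmetric]) (use T in \<open>auto simp: koszul_coeff_R R_sub\<close>)
    qed (simp add: d_def)
  qed
  have smult: "d (\<lambda>l. a \<otimes> p l) = (\<lambda>l. a \<otimes> d p l)"
    if p: "p \<in> carrier (PM (Suc k))" and a: "a \<in> carrier A" for p a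
  proof (rule ext)
    fix l
    note [simp] = PM_closed[OF p] x_closed a
    show "d (\<lambda>l. a \<otimes> p l) l = a \<otimes> d p l"
    proof (cases "l \<in> enc ` Pow {1..n}")
      case True
      then obtain T where T: "T \<subseteq> {1..n}" "l = enc T" by auto
      \<comment> \<open>Linearity over \<open>A\<close> and not only over \<open>R\<close>: the
        Koszul coefficient is central and x_i stays on the right, so a can be moved to the
        front.\<close>
      have e: "koszul_coeff i T \<otimes> (a \<otimes> p l) \<otimes> x i = a \<otimes> (koszul_coeff i T \<otimes> p l \<otimes> x i)" if "i \<in> {1..n}" for i l
        using R_central[OF koszul_coeff_R[OF that T(1)] a] R_sub[OF koszul_coeff_R[OF that T(1)]] that
        by (simp add: m_assoc[symmetric])
      show ?thesis unfolding T(2) d_enc[OF T(1)]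
        by (subst finsum_rdistr) (use T in \<open>auto simp: koszul_coeff_R R_sub e intro!: finsum_cong'\<close>)
    qed (simp add: d_def)
  qed
  show ?thesis unfolding left_module_hom_def using d_PM add smult
    by (auto simp: PM_add PM_smult)
qed

text \<open>The pairs (i, j) and (j, i) lead to the same symbol. For i < j only i counts j as a
  larger index, so exactly one of the two terms carries the factor - \<open>Q j i\<close>; in the
  other one the same scalar, with the opposite sign, appears when x_j x_i is put into order.\<close>

lemma d_d:
  assumes p: "p \<in> carrier (PM (Suc (Suc k)))"
  shows "d (d p) = (\<lambda>l. \<zero>)"
proof
  fix l
  show "d (d p) l = \<zero>"
  proof (cases "l \<in> enc ` Pow {1..n}")
    case True
    then obtain T where T: "T \<subseteq> {1..n}" "l = enc T" by auto
    define t where "t i j = koszul_coeff i T \<otimes> (koszul_coeff j (insert i T) \<otimes> p (enc (insert j (insert i T))) \<otimes> x j) \<otimes> x i" for i j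
    note [simp] = PM_closed[OF p] x_closed
    have k: "koszul_coeff i T \<in> carrier A" "j \<in> {1..n} \<Longrightarrow> koszul_coeff i (insert j T) \<in> carrier A" if "i \<in> {1..n}" for i j
      using T that by (auto intro!: R_sub koszul_coeff_R)
    have row: "koszul_coeff i T \<otimes> d p (enc (insert i T)) \<otimes> x i = (\<Oplus>j\<in>{1..n} - T - {i}. t i j)"
      if i: "i \<in> {1..n} - T" for i
    proof -
      have iT: "insert i T \<subseteq> {1..n}" using i T by auto
      have s: "{1..n} - insert i T = {1..n} - T - {i}" by auto
      have "koszul_coeff i T \<otimes> d p (enc (insert i T)) \<otimes> x i =
          (\<Oplus>j\<in>{1..n} - T - {i}. koszul_coeff i T \<otimes> (koszul_coeff j (insert i T) \<otimes> p (enc (insert j (insert i T))) \<otimes> x j)) \<otimes> x i"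
        unfolding d_enc[OF iT] s
        by (subst finsum_rdistr) (use i k in auto)
      also have "\<dots> = (\<Oplus>j\<in>{1..n} - T - {i}. t i j)"
        unfolding t_def by (rule finsum_ldistr) (use i k in auto)
      finally show ?thesis .
    qed
    have "d (d p) l = (\<Oplus>i\<in>{1..n} - T. \<Oplus>j\<in>{1..n} - T - {i}. t i j)"
      unfolding T(2) d_enc[OF T(1)]
      by (rule finsum_cong') (use row k in \<open>auto simp: t_def intro!: finsum_closed\<close>)
    also have "\<dots> = \<zero>"
    proof (rule antisymmetric_double_sum)
      fix i j assume ij: "i \<in> {1..n} - T" "j \<in> {1..n} - T"
      then show "t i j \<in> carrier A" using k by (simp add: t_def)
      have *: "t i j \<oplus> t j i = \<zero>" if "i < j" "i \<in> {1..n} - T" "j \<in> {1..n} - T" for i j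
      proof -
        define q where "q = p (enc (insert j (insert i T)))"
        have ins: "insert i (insert j T) = insert j (insert i T)" by auto
        have i: "i \<in> {1..n}" and j: "j \<in> {1..n}" using that by auto
        have Q: "Q j i \<in> R" using i j that by (auto intro: Q_R)
        have ki: "koszul_coeff i T \<in> R" and kj: "koszul_coeff j T \<in> R" using i j T koszul_coeff_R by auto
        have e: "koszul_coeff j (insert i T) = koszul_coeff j T" "koszul_coeff i (insert j T) = \<ominus> Q j i \<otimes> koszul_coeff i T"
          using that T by (subst koszul_coeff_insert; auto)+
        have [simp]: "q \<in> carrier A" by (simp add: q_def)
        note [simp] = R_sub[OF ki] R_sub[OF kj] R_sub[OF Q] x_closed[OF i] x_closed[OF j]
        let ?z = "koszul_coeff i T \<otimes> (koszul_coeff j T \<otimes> (q \<otimes> (Q j i \<otimes> (x i \<otimes> x j))))"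
        have "t i j = ?z" unfolding t_def e q_def[symmetric]
          by (simp add: m_assoc x_swap[OF i j \<open>i < j\<close>])
        moreover have "t j i = \<ominus> ?z"
        proof -
          have "t j i = \<ominus> (koszul_coeff j T \<otimes> (Q j i \<otimes> (koszul_coeff i T \<otimes> (q \<otimes> (x i \<otimes> x j)))))"
            unfolding t_def e ins q_def[symmetric] by (simp add: m_assoc l_minus r_minus)
          also have "koszul_coeff j T \<otimes> (Q j i \<otimes> (koszul_coeff i T \<otimes> (q \<otimes> (x i \<otimes> x j)))) =
              (Q j i \<otimes> (koszul_coeff i T \<otimes> koszul_coeff j T)) \<otimes> q \<otimes> (x i \<otimes> x j)"
          proof -
            have "koszul_coeff j T \<otimes> (Q j i \<otimes> koszul_coeff i T) = Q j i \<otimes> (koszul_coeff i T \<otimes> koszul_coeff j T)"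
              using R_comm[OF kj R_mult[OF Q ki]] by (simp add: m_assoc)
            then show ?thesis by (simp add: m_assoc[symmetric])
          qed
          also have "\<dots> = (koszul_coeff i T \<otimes> koszul_coeff j T) \<otimes> Q j i \<otimes> q \<otimes> (x i \<otimes> x j)"
            using R_comm[OF Q R_mult[OF ki kj]] by simp
          also have "\<dots> = ?z" using R_central[OF Q \<open>q \<in> carrier A\<close>] by (simp add: m_assoc[symmetric])
             (simp add: m_assoc)
          finally show ?thesis .
        qed
        ultimately show ?thesis by (simp add: r_neg)
      qed
      assume "i \<noteq> j"
      then consider "i < j" | "j < i" by linarith
      then show "t i j \<oplus> t j i = \<zero>"
      proof cases
        case 1 then show ?thesis using * ij by blast
      next
        case 2
        then have "t j i \<oplus> t i j = \<zero>" using * ij by blast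
        then show ?thesis using ij k by (subst a_comm) (auto simp: t_def)
      qed
    qed simp
    finally show ?thesis .
  qed (simp add: d_def)
qed


subsection \<open>Contracting homotopy\<close>

text \<open>
  If \<open>m\<close> is the largest index occurring in \<open>x\<^sup>\<beta> e\<^sub>T\<close>, the homotopy sends \<open>x\<^bsup>\<beta> + m\<^esup> e\<^bsub>T - m\<^esub>\<close> to
  \<open>x\<^sup>\<beta> e\<^sub>T\<close> for \<open>m \<in> T\<close>; this is the resulting coefficient of \<open>x\<^sup>\<beta> e\<^sub>T\<close>.
\<close>

definition homotopy_coeff :: "('a list \<Rightarrow> 'a) \<Rightarrow> nat set \<Rightarrow> (nat \<Rightarrow> nat) \<Rightarrow> 'a" where
  "homotopy_coeff p T \<beta> = (if T \<noteq> {} \<and> (\<forall>j. \<beta> j \<noteq> 0 \<longrightarrow> j \<le> Max T)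
     then cf (p (enc (T - {Max T}))) (incr \<beta> (Max T)) else \<zero>)"

definition h :: "('a list \<Rightarrow> 'a) \<Rightarrow> ('a list \<Rightarrow> 'a)" where
  "h p = (\<lambda>l. if l \<in> enc ` Pow {1..n} then comb (homotopy_coeff p (dec l)) else \<zero>)"

lemma inj_incr: "inj (\<lambda>\<beta>. incr \<beta> m)"
  by (rule injI) (metis diff_Suc_1 fun_upd_same fun_upd_triv fun_upd_upd)

lemma finite_N: "S \<subseteq> {1..n} \<Longrightarrow> finite S"
  by (rule finite_subset) auto

lemma homotopy_coeff_families:
  assumes p: "\<And>l. p l \<in> carrier A" and T: "T \<subseteq> {1..n}"
  shows "homotopy_coeff p T \<in> families"
proof (cases "T = {}")
  case True
  then show ?thesis by (simp add: families_def homotopy_coeff_def R_zero)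
next
  case False
  define m where "m = Max T"
  have m: "m \<in> {1..n}" using Max_in[OF finite_N[OF T] False] T by (auto simp: m_def)
  have "{\<beta>. homotopy_coeff p T \<beta> \<noteq> \<zero>} \<subseteq> (\<lambda>\<beta>. incr \<beta> m) -` {\<beta>. cf (p (enc (T - {m}))) \<beta> \<noteq> \<zero>}"
  proof
    fix \<beta>
    have "homotopy_coeff p T \<beta> = \<zero>" if "cf (p (enc (T - {m}))) (incr \<beta> m) = \<zero>" using that by (simp add: homotopy_coeff_def m_def)
    then show "\<beta> \<in> {\<beta>. homotopy_coeff p T \<beta> \<noteq> \<zero>} \<Longrightarrow> \<beta> \<in> (\<lambda>\<beta>. incr \<beta> m) -` {\<beta>. cf (p (enc (T - {m}))) \<beta> \<noteq> \<zero>}"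
      by blast
  qed
  moreover have "finite ((\<lambda>\<beta>. incr \<beta> m) -` {\<beta>. cf (p (enc (T - {m}))) \<beta> \<noteq> \<zero>})"
    by (rule finite_vimageI[OF cf_finite[OF p] inj_incr])
  ultimately have "finite {\<beta>. homotopy_coeff p T \<beta> \<noteq> \<zero>}" by (rule finite_subset)
  moreover have "homotopy_coeff p T \<beta> = \<zero>" if "\<beta> \<notin> exponents n" for \<beta>
  proof -
    have "incr \<beta> m \<notin> exponents n" using that m by (auto simp: exponents_def split: if_splits)
    then have "cf (p (enc (T - {m}))) (incr \<beta> m) = \<zero>" by (rule cf_outside[OF p])
    then show ?thesis by (simp add: homotopy_coeff_def m_def)
  qed
  moreover have "homotopy_coeff p T \<beta> \<in> R" for \<beta> by (simp add: homotopy_coeff_def cf_R p R_zero)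
  ultimately show ?thesis by (simp add: families_def)
qed

lemma h_enc: "T \<subseteq> {1..n} \<Longrightarrow> h p (enc T) = comb (homotopy_coeff p T)"
  by (simp add: h_def dec_enc_N)

lemma cf_h: "\<lbrakk>\<And>l. p l \<in> carrier A; T \<subseteq> {1..n}\<rbrakk> \<Longrightarrow> cf (h p (enc T)) = homotopy_coeff p T"
  by (simp add: h_enc cf_comb homotopy_coeff_families)

lemma h_PM:
  assumes p: "p \<in> carrier (PM k)"
  shows "h p \<in> carrier (PM (Suc k))"
proof -
  have "h p l = \<zero>" if "l \<notin> G (Suc k)" for l
  proof (cases "l \<in> enc ` Pow {1..n}")
    case True
    then obtain T where T: "T \<subseteq> {1..n}" "l = enc T" by auto
    then have c: "card T \<noteq> Suc k" using that enc_G by simp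
    have "homotopy_coeff p T = (\<lambda>_. \<zero>)"
    proof (cases "T = {}")
      case False
      have "card T = Suc (card (T - {Max T}))"
        using finite_N[OF T(1)] False by (metis Max_in card_Suc_Diff1)
      then have "p (enc (T - {Max T})) = \<zero>"
        by (intro PM_zero[OF p]) (use T c in auto)
      then show ?thesis by (auto simp: homotopy_coeff_def cf_zero)
    qed (auto simp: homotopy_coeff_def)
    then show ?thesis using T by (simp add: h_enc comb_def)
  qed (auto simp: h_def)
  moreover have "h p l \<in> carrier A" for l
    unfolding h_def using homotopy_coeff_families[of p] comb_closed PM_closed[OF p] by (auto simp: dec_enc_N)
  ultimately show ?thesis by (simp add: PM_iff)
qed

lemma cf_d:
  assumes p: "\<And>l. p l \<in> carrier A" and T: "T \<subseteq> {1..n}"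
  shows "cf (d p (enc T)) \<gamma> = (\<Oplus>i\<in>{1..n} - T. if \<gamma> i = 0 then \<zero>
     else koszul_coeff i T \<otimes> tw (decr \<gamma> i) i \<otimes> cf (p (enc (insert i T))) (decr \<gamma> i))"
proof -
  have "cf (d p (enc T)) \<gamma> = (\<Oplus>i\<in>{1..n} - T. cf (koszul_coeff i T \<otimes> p (enc (insert i T)) \<otimes> x i) \<gamma>)"
    unfolding d_enc[OF T] by (rule cf_finsum) (use d_term_closed[of p T] p T in auto)
  also have "\<dots> = (\<Oplus>i\<in>{1..n} - T. if \<gamma> i = 0 then \<zero>
     else koszul_coeff i T \<otimes> tw (decr \<gamma> i) i \<otimes> cf (p (enc (insert i T))) (decr \<gamma> i))"
  proof (rule finsum_cong')
    fix i assume i: "i \<in> {1..n} - T"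
    then have k: "koszul_coeff i T \<in> R" and t: "tw (decr \<gamma> i) i \<in> R" using koszul_coeff_R[OF _ T] tw_R by auto
    show "cf (koszul_coeff i T \<otimes> p (enc (insert i T)) \<otimes> x i) \<gamma> = (if \<gamma> i = 0 then \<zero>
       else koszul_coeff i T \<otimes> tw (decr \<gamma> i) i \<otimes> cf (p (enc (insert i T))) (decr \<gamma> i))"
      using i p k t R_sub[OF k] R_sub[OF t] R_comm[OF k t]
      by (simp add: cf_mult_x cf_smult m_assoc[symmetric] cf_closed)
  qed (use p T in \<open>auto simp: koszul_coeff_R R_sub tw_R cf_closed\<close>)
  finally show ?thesis .
qed

text \<open>This is d h + h d = 1, one coefficient at a time. The excluded place, empty set and
  exponent zero, is the copy of \<open>R\<close> in P_0 that the complex resolves. The cases ask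
  whether the largest index occurring in x^\<gamma> e_T lies in T; an index occurring in both counts
  as lying in T.\<close>

lemma homotopy:
  assumes p: "\<And>l. p l \<in> carrier A" and T: "T \<subseteq> {1..n}" and \<gamma>: "\<gamma> \<in> exponents n"
    and nz: "T \<noteq> {} \<or> \<gamma> \<noteq> (\<lambda>_. 0)"
  shows "cf (d (h p) (enc T)) \<gamma> \<oplus> homotopy_coeff (d p) T \<gamma> = cf (p (enc T)) \<gamma>"
proof -
  have hp: "h p l \<in> carrier A" for l
    unfolding h_def using homotopy_coeff_families[OF p] comb_closed by (auto simp: dec_enc_N)
  have fT: "finite T" by (rule finite_N[OF T])
  \<comment> \<open>The contribution of the index i to d h.\<close>
  define X where "X i = (if \<gamma> i = 0 then \<zero> else koszul_coeff i T \<otimes> tw (decr \<gamma> i) i \<otimes> homotopy_coeff p (insert i T) (decr \<gamma> i))" for i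
  have dh: "cf (d (h p) (enc T)) \<gamma> = (\<Oplus>i\<in>{1..n} - T. X i)"
    unfolding cf_d[OF hp T] X_def
    by (rule finsum_cong')
      (use T in \<open>auto simp: cf_h p koszul_coeff_R tw_R R_sub families_R[OF homotopy_coeff_families[OF p]]\<close>)
  show ?thesis
  proof (cases "T \<noteq> {} \<and> (\<forall>j. \<gamma> j \<noteq> 0 \<longrightarrow> j \<le> Max T)")
    case True
    define m where "m = Max T"
    have mT: "m \<in> T" and le: "\<And>j. j \<in> T \<Longrightarrow> j \<le> m" and le': "\<And>j. \<gamma> j \<noteq> 0 \<Longrightarrow> j \<le> m"
      using True fT by (auto simp: m_def)
    have m: "m \<in> {1..n}" using mT T by auto
    define S where "S = T - {m}"
    have S: "S \<subseteq> {1..n}" and TS: "T = insert m S" "m \<notin> S" using T mT by (auto simp: S_def)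
    \<comment> \<open>The contribution of an index i other than m to h d, where h takes m out of T
      and d is evaluated at the remaining set with the exponent of m raised.\<close>
    define Y where "Y i = (if \<gamma> i = 0 then \<zero> else
      koszul_coeff i S \<otimes> (Q m i \<otimes> tw (decr \<gamma> i) i) \<otimes> cf (p (enc (insert i S))) (incr (decr \<gamma> i) m))" for i
    have lt: "i < m" if "i \<in> {1..n} - T" "\<gamma> i \<noteq> 0" for i
      using that le'[of i] mT by (cases "i = m") auto
    have Yc: "Y i \<in> carrier A" if "i \<in> {1..n} - T" for i
      using that lt[OF that] m S unfolding Y_def
      by (auto simp: R_sub cf_closed p koszul_coeff_R tw_R Q_R)
    have XY: "X i = \<ominus> Y i" if i: "i \<in> {1..n} - T" for i
    proof (cases "\<gamma> i = 0")
      case True then show ?thesis by (simp add: X_def Y_def)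
    next
      case False
      have im: "i < m" by (rule lt[OF i False])
      have i': "i \<in> {1..n}" "i \<notin> T" using i by auto
      \<comment> \<open>Adding i < m leaves m the largest index, so in d h the homotopy moves m as
        well and reads the same entry of p. The two contributions then differ by the sign in -
        \<open>Q m i\<close>, the factor with which m enters the Koszul coefficient of i.\<close>
      have Max: "Max (insert i T) = m"
        using fT im mT le by (intro Max_eqI) auto
      have "\<forall>j. (decr \<gamma> i) j \<noteq> 0 \<longrightarrow> j \<le> m" using le' by (auto split: if_splits)
      moreover have "insert i T - {m} = insert i S" using im by (auto simp: S_def)
      ultimately have hcp: "homotopy_coeff p (insert i T) (decr \<gamma> i) = cf (p (enc (insert i S))) (incr (decr \<gamma> i) m)"
        unfolding homotopy_coeff_def Max by (simp del: fun_upd_apply)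
      have kcT: "koszul_coeff i T = \<ominus> Q m i \<otimes> koszul_coeff i S"
        unfolding TS(1) using koszul_coeff_insert[of i m S] i' im S m TS by simp
      have k: "koszul_coeff i S \<in> R" and q: "Q m i \<in> R" and t: "tw (decr \<gamma> i) i \<in> R"
        using koszul_coeff_R[OF i'(1) S] Q_R[OF i'(1) m im] tw_R[OF i'(1)] by auto
      note [simp] = R_sub[OF k] R_sub[OF q] R_sub[OF t]
      show ?thesis unfolding X_def Y_def hcp kcT using False cf_closed[OF p]
        by (simp add: l_minus R_comm[OF q k] m_assoc[symmetric])
    qed
    have "homotopy_coeff (d p) T \<gamma> = cf (d p (enc S)) (incr \<gamma> m)"
      using True by (simp add: homotopy_coeff_def m_def S_def)
    also have "\<dots> = (\<Oplus>i\<in>insert m ({1..n} - T). if incr \<gamma> m i = 0 then \<zero>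
       else koszul_coeff i S \<otimes> tw (decr (incr \<gamma> m) i) i \<otimes> cf (p (enc (insert i S))) (decr (incr \<gamma> m) i))"
    proof -
      have "{1..n} - S = insert m ({1..n} - T)" using m mT by (auto simp: S_def)
      then show ?thesis unfolding cf_d[OF p S] by (simp del: fun_upd_apply)
    qed
    also have "\<dots> = (\<Oplus>i\<in>insert m ({1..n} - T). if i = m then cf (p (enc T)) \<gamma> else Y i)"
    proof (rule finsum_cong')
      fix i assume i: "i \<in> insert m ({1..n} - T)"
      show "(if incr \<gamma> m i = 0 then \<zero>
         else koszul_coeff i S \<otimes> tw (decr (incr \<gamma> m) i) i \<otimes> cf (p (enc (insert i S))) (decr (incr \<gamma> m) i))
        = (if i = m then cf (p (enc T)) \<gamma> else Y i)"
      proof (cases "i = m")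
        case True
        \<comment> \<open>Nothing lies above m, neither in S nor in \<gamma>, so both scalars are 1
          and this one term of h d reproduces p.\<close>
        have "koszul_coeff m S = \<one>" by (rule koszul_coeff_top) (use le TS in auto)
        moreover have "tw \<gamma> m = \<one>" by (rule tw_one) (use le' in force)
        ultimately show ?thesis using True TS by (simp add: cf_closed p)
      next
        case False
        then have i': "i \<in> {1..n} - T" using i by auto
        show ?thesis
        proof (cases "\<gamma> i = 0")
          case True then show ?thesis using False by (simp add: Y_def)
        next
          case nz: False
          have "decr (incr \<gamma> m) i = incr (decr \<gamma> i) m" using False by (auto simp: fun_eq_iff)
          moreover have "tw (incr (decr \<gamma> i) m) i = Q m i \<otimes> tw (decr \<gamma> i) i"
            using i' m lt[OF i' nz] by (intro tw_incr) auto
          moreover have "incr \<gamma> m i = \<gamma> i" using False by simp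
          ultimately show ?thesis using False nz by (simp add: Y_def del: fun_upd_apply)
        qed
      qed
    qed (use Yc in \<open>auto simp: cf_closed p\<close>)
    also have "\<dots> = cf (p (enc T)) \<gamma> \<oplus> (\<Oplus>i\<in>{1..n} - T. Y i)"
    proof -
      have "(\<Oplus>i\<in>{1..n} - T. if i = m then cf (p (enc T)) \<gamma> else Y i) = (\<Oplus>i\<in>{1..n} - T. Y i)"
        by (rule finsum_cong') (use mT Yc in auto)
      then show ?thesis
        using mT Yc by (subst finsum_insert) (auto simp: cf_closed p)
    qed
    finally have hd: "homotopy_coeff (d p) T \<gamma> = cf (p (enc T)) \<gamma> \<oplus> (\<Oplus>i\<in>{1..n} - T. Y i)" .
    have "(\<Oplus>i\<in>{1..n} - T. X i) \<oplus> (\<Oplus>i\<in>{1..n} - T. Y i) = (\<Oplus>i\<in>{1..n} - T. X i \<oplus> Y i)"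
      by (rule finsum_addf[symmetric]) (use XY Yc in auto)
    also have "\<dots> = \<zero>" by (rule add.finprod_one_eqI) (use XY Yc in \<open>auto simp: l_neg\<close>)
    finally have XY0: "(\<Oplus>i\<in>{1..n} - T. X i) \<oplus> (\<Oplus>i\<in>{1..n} - T. Y i) = \<zero>" .
    have c: "(\<Oplus>i\<in>{1..n} - T. X i) \<in> carrier A" "(\<Oplus>i\<in>{1..n} - T. Y i) \<in> carrier A"
      using XY Yc by (auto intro!: finsum_closed)
    show ?thesis unfolding dh hd using XY0
      by (subst a_lcomm) (use c cf_closed[OF p] in simp_all)
  next
    case False
    \<comment> \<open>Now the largest index m occurs in the monomial only. The term h d vanishes at
      this place, and d h has to reproduce p alone.\<close>
    then have h0: "homotopy_coeff (d p) T \<gamma> = \<zero>" by (auto simp: homotopy_coeff_def)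
    define m where "m = Max {j. \<gamma> j \<noteq> 0}"
    have fin: "finite {j. \<gamma> j \<noteq> 0}"
      by (rule finite_subset[of _ "{1..n}"]) (use \<gamma> in \<open>auto simp: exponents_def\<close>)
    obtain j0 where j0: "\<gamma> j0 \<noteq> 0" "T \<noteq> {} \<longrightarrow> Max T < j0"
      using False nz by (cases "T = {}") (auto simp: not_le fun_eq_iff)
    have gm: "\<gamma> m \<noteq> 0" using Max_in[OF fin] j0 unfolding m_def by blast
    have le: "\<And>j. \<gamma> j \<noteq> 0 \<Longrightarrow> j \<le> m" using Max_ge[OF fin] unfolding m_def by simp
    have lt: "j < m" if "j \<in> T" for j
      using that j0 le[OF j0(1)] Max_ge[OF fT that] by fastforce
    have m: "m \<in> {1..n} - T" using gm \<gamma> lt by (auto simp: exponents_def)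
    have X: "X i = (if m = i then cf (p (enc T)) \<gamma> else \<zero>)" if i: "i \<in> {1..n} - T" for i
    proof (cases "\<gamma> i = 0")
      case True then show ?thesis using gm by (auto simp: X_def)
    next
      case nz: False
      show ?thesis
      proof (cases "i = m")
        case True
        have Max: "Max (insert m T) = m" using fT lt by (intro Max_eqI) (auto intro: less_imp_le)
        have "\<forall>j. (decr \<gamma> m) j \<noteq> 0 \<longrightarrow> j \<le> m" using le by (auto split: if_splits)
        moreover have "insert m T - {m} = T" using m by auto
        moreover have "incr (decr \<gamma> m) m = \<gamma>" using gm by auto
        ultimately have "homotopy_coeff p (insert m T) (decr \<gamma> m) = cf (p (enc T)) \<gamma>"
          unfolding homotopy_coeff_def Max by simp
        moreover have "koszul_coeff m T = \<one>" by (rule koszul_coeff_top) (use lt in \<open>auto intro: less_imp_le\<close>)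
        moreover have "tw (decr \<gamma> m) m = \<one>" by (rule tw_one) (use le in force)
        ultimately show ?thesis using True gm by (simp add: X_def cf_closed p)
      next
        case False
        \<comment> \<open>For i < m the variable x_m remains in the monomial above every element of
          \<open>insert i T\<close>, and there the homotopy coefficient is zero by
          definition.\<close>
        have "i < m" using le[OF nz] False by simp
        then have "Max (insert i T) < m" using fT lt by simp
        moreover have "(decr \<gamma> i) m \<noteq> 0" using gm False by simp
        ultimately have "homotopy_coeff p (insert i T) (decr \<gamma> i) = \<zero>" unfolding homotopy_coeff_def by (meson not_le)
        then show ?thesis using False i T nz by (auto simp: X_def koszul_coeff_R tw_R R_sub)
      qed
    qed
    have "(\<Oplus>i\<in>{1..n} - T. X i) = (\<Oplus>i\<in>{1..n} - T. if m = i then cf (p (enc T)) \<gamma> else \<zero>)"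
      by (rule finsum_cong') (use X in \<open>auto simp: cf_closed p\<close>)
    also have "\<dots> = cf (p (enc T)) \<gamma>"
      by (rule add.finprod_singleton[OF m]) (auto simp: cf_closed p)
    finally show ?thesis unfolding dh h0 by (simp add: cf_closed p)
  qed
qed

text \<open>The homotopy identity gives everything except at the excluded place, which occurs only
  for k = 0. There the left side is zero by the last hypothesis, the right side because the entries
  of a boundary have no constant term.\<close>

lemma cycle_boundary:
  assumes p: "p \<in> carrier (PM k)" and z: "\<And>l. d p l = \<zero>" and e: "k = 0 \<Longrightarrow> cf (p (enc {})) (\<lambda>_. 0) = \<zero>"
  shows "p = d (h p)"
proof (rule PM_eqI[OF p d_PM[OF h_PM[OF p]]])
  fix T assume T: "T \<subseteq> {1..n}" "card T = k"
  note cl = PM_closed[OF p]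
  have cl': "h p l \<in> carrier A" for l by (rule PM_closed[OF h_PM[OF p]])
  have hz: "homotopy_coeff (d p) T \<gamma> = \<zero>" for \<gamma> by (simp add: homotopy_coeff_def z cf_zero)
  show "p (enc T) = d (h p) (enc T)"
  proof (rule cf_eqD)
    fix \<gamma>
    show "cf (p (enc T)) \<gamma> = cf (d (h p) (enc T)) \<gamma>"
    proof (cases "\<gamma> \<in> exponents n")
      case False
      then show ?thesis using cf_outside cl d_closed[OF cl'] by simp
    next
      case True
      show ?thesis
      proof (cases "T \<noteq> {} \<or> \<gamma> \<noteq> (\<lambda>_. 0)")
        case nz: True
        show ?thesis using homotopy[of p, OF cl T(1) True nz] hz cf_closed[OF d_closed[OF cl']] by simp
      next
        case False
        then have "T = {}" "\<gamma> = (\<lambda>_. 0)" by auto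
        moreover have "cf (d (h p) (enc {})) (\<lambda>_. 0) = \<zero>"
          by (subst cf_d[OF cl']) auto
        ultimately show ?thesis using e T by auto
      qed
    qed
  qed (use cl d_closed[OF cl'] in auto)
qed

subsection \<open>The Koszul resolution\<close>

abbreviation M :: "('a, 'a set) module" where "M \<equiv> quotient_left_module A Ap"

definition \<pi> :: "'a \<Rightarrow> 'a set" where "\<pi> a = Ap +>\<^bsub>A\<^esub> a"

lemma M_carrier: "carrier M = \<pi> ` carrier A"
  by (auto simp: quotient_left_module_def \<pi>_def FactRing_def A_RCOSETS_def')

lemma M_add: "\<lbrakk>a \<in> carrier A; b \<in> carrier A\<rbrakk> \<Longrightarrow> \<pi> a \<oplus>\<^bsub>M\<^esub> \<pi> b = \<pi> (a \<oplus> b)"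
  using ring_hom_add[OF ideal.rcos_ring_hom[OF Ap_ideal]] by (simp add: quotient_left_module_def \<pi>_def)

lemma M_smult: "\<lbrakk>a \<in> carrier A; b \<in> carrier A\<rbrakk> \<Longrightarrow> a \<odot>\<^bsub>M\<^esub> \<pi> b = \<pi> (a \<otimes> b)"
  using ring_hom_mult[OF ideal.rcos_ring_hom[OF Ap_ideal]] by (simp add: quotient_left_module_def \<pi>_def)

lemma M_zero: "\<zero>\<^bsub>M\<^esub> = \<pi> \<zero>"
  by (simp add: quotient_left_module_def \<pi>_def FactRing_def a_coset_add_zero
      additive_subgroup.a_subset[OF ideal.axioms(1)[OF Ap_ideal]])

text \<open>Identifies \<open>M\<close> with \<open>R\<close>: an equation in \<open>M\<close>
  becomes an equation between constant terms.\<close>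

lemma \<pi>_eq_iff:
  assumes a: "a \<in> carrier A" and b: "b \<in> carrier A"
  shows "\<pi> a = \<pi> b \<longleftrightarrow> \<epsilon> a = \<epsilon> b"
proof -
  have "\<pi> a = \<pi> b \<longleftrightarrow> a \<ominus> b \<in> Ap"
    unfolding \<pi>_def using quotient_eq_iff_same_a_r_cos[OF Ap_ideal a b] by simp
  also have "\<dots> \<longleftrightarrow> \<epsilon> a \<oplus> \<ominus> \<epsilon> b = \<zero>"
    using a b by (simp add: Ap_def a_minus_def cf_add cf_neg)
  also have "\<dots> \<longleftrightarrow> \<epsilon> a = \<epsilon> b"
    using r_right_minus_eq[of "\<epsilon> a" "\<epsilon> b"] cf_closed a b by (simp add: a_minus_def)
  finally show ?thesis .
qed

lemma \<pi>_closed: "a \<in> carrier A \<Longrightarrow> \<pi> a \<in> carrier M"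
  by (simp add: M_carrier)

definition K :: "('a list, 'a, 'a set) resolution" where
  "K = \<lparr>gens = G, diff = (\<lambda>k. d), aug = (\<lambda>p. \<pi> (p (enc {})))\<rparr>"

lemma K_simps: "gens K = G" "diff K k = d" "aug K p = \<pi> (p (enc {}))" "res_module A K k = PM k"
  by (simp_all add: K_def res_module_def)

lemma aug_hom: "aug K \<in> left_module_hom A (PM 0) M"
  unfolding left_module_hom_def
  by (auto simp: K_simps PM_add PM_smult PM_closed \<pi>_closed M_add M_smult)

lemma resolution: "free_resolution A M K"
proof -
  have "\<pi> a \<in> aug K ` carrier (PM 0)" if "a \<in> carrier A" for a
  proof (rule image_eqI)
    show "(\<lambda>l. if l = enc {} then a else \<zero>) \<in> carrier (PM 0)"
      using that enc_G[of "{}" 0] by (auto simp: PM_iff)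
  qed (simp add: K_simps)
  then have surj: "aug K ` carrier (PM 0) = carrier M"
    by (auto simp: M_carrier K_simps PM_closed)
  have im0: "d ` carrier (PM 1) = {p \<in> carrier (PM 0). aug K p = \<zero>\<^bsub>M\<^esub>}"
  proof (intro equalityI subsetI)
    fix q assume "q \<in> d ` carrier (PM 1)"
    then obtain p where p: "p \<in> carrier (PM 1)" "q = d p" by auto
    have "cf (d p (enc {})) (\<lambda>_. 0) = \<zero>" by (subst cf_d) (auto simp: PM_closed[OF p(1)])
    then show "q \<in> {p \<in> carrier (PM 0). aug K p = \<zero>\<^bsub>M\<^esub>}"
      using p d_PM[of p 0] by (simp add: One_nat_def K_simps M_zero \<pi>_eq_iff PM_closed cf_zero)
  next
    fix p assume "p \<in> {p \<in> carrier (PM 0). aug K p = \<zero>\<^bsub>M\<^esub>}"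
    then have p: "p \<in> carrier (PM 0)" and e: "cf (p (enc {})) (\<lambda>_. 0) = \<zero>"
      by (auto simp: K_simps M_zero \<pi>_eq_iff PM_closed cf_zero)
    \<comment> \<open>\<open>cycle_boundary\<close> expects a cycle in degree 0 as well, where d has
      no target. As a function d vanishes there, since it only reads entries at nonempty
      subsets.\<close>
    have "d p l = \<zero>" for l
    proof (cases "l \<in> enc ` Pow {1..n}")
      case True
      then obtain T where T: "T \<subseteq> {1..n}" "l = enc T" by auto
      have "p (enc (insert i T)) = \<zero>" if "i \<in> {1..n} - T" for i
        using that T card_insert_N[of T i] by (intro PM_zero[OF p]) auto
      then show ?thesis unfolding T(2) d_enc[OF T(1)]
        by (intro add.finprod_one_eqI) (use T in \<open>auto simp: koszul_coeff_R R_sub x_closed\<close>)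
    qed (simp add: d_def)
    then have "p = d (h p)" using e by (rule cycle_boundary[OF p])
    then show "p \<in> d ` carrier (PM 1)" using h_PM[OF p] by (auto simp: One_nat_def)
  qed
  have im: "d ` carrier (PM (Suc (Suc k))) = {p \<in> carrier (PM (Suc k)). d p = \<zero>\<^bsub>PM k\<^esub>}" for k
  proof (intro equalityI subsetI)
    fix q assume "q \<in> d ` carrier (PM (Suc (Suc k)))"
    then show "q \<in> {p \<in> carrier (PM (Suc k)). d p = \<zero>\<^bsub>PM k\<^esub>}"
      using d_PM d_d by (auto simp: PM_0)
  next
    fix p assume "p \<in> {p \<in> carrier (PM (Suc k)). d p = \<zero>\<^bsub>PM k\<^esub>}"
    then have p: "p \<in> carrier (PM (Suc k))" and z: "d p = (\<lambda>l. \<zero>)" by (auto simp: PM_0)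
    have "p = d (h p)" by (rule cycle_boundary[OF p]) (auto simp: z)
    then show "p \<in> d ` carrier (PM (Suc (Suc k)))" using h_PM[OF p] by auto
  qed
  show ?thesis unfolding free_resolution_def K_simps(2,4)
    using aug_hom d_hom surj im0 im by simp
qed

end

lemma (in abelian_monoid) finsum_swap:
  assumes "finite I" "finite J" "\<And>i j. \<lbrakk>i \<in> I; j \<in> J\<rbrakk> \<Longrightarrow> f i j \<in> carrier G"
  shows "(\<Oplus>i\<in>I. \<Oplus>j\<in>J. f i j) = (\<Oplus>j\<in>J. \<Oplus>i\<in>I. f i j)"
  using assms(1,3)
proof (induction I rule: finite_induct)
  case (insert a I)
  have "(\<Oplus>i\<in>insert a I. \<Oplus>j\<in>J. f i j) = (\<Oplus>j\<in>J. f a j) \<oplus> (\<Oplus>i\<in>I. \<Oplus>j\<in>J. f i j)"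
    by (rule finsum_insert) (use insert in \<open>auto intro!: finsum_closed\<close>)
  also have "\<dots> = (\<Oplus>j\<in>J. f a j) \<oplus> (\<Oplus>j\<in>J. \<Oplus>i\<in>I. f i j)" using insert by simp
  also have "\<dots> = (\<Oplus>j\<in>J. f a j \<oplus> (\<Oplus>i\<in>I. f i j))"
    by (rule finsum_addf[symmetric]) (use insert in \<open>auto intro!: finsum_closed\<close>)
  also have "\<dots> = (\<Oplus>j\<in>J. \<Oplus>i\<in>insert a I. f i j)"
    by (rule finsum_cong') (use insert in \<open>auto intro!: finsum_closed simp: Pi_def\<close>)
  finally show ?case .
qed simp

context quantum_affine
begin

subsection \<open>The cohomology\<close>

abbreviation Sub :: "nat \<Rightarrow> nat set set" where
  "Sub m \<equiv> {S. S \<subseteq> {1..n} \<and> card S = m}"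

lemma finite_Sub: "finite (Sub m)"
  by (rule finite_subset[of _ "Pow {1..n}"]) auto

text \<open>The left linear map with value \<open>\<pi> (c S)\<close> on e_S, that is, the
  combination of the dual symbols \<xi>_S with coefficients c.\<close>

definition cochain :: "(nat set \<Rightarrow> 'a) \<Rightarrow> nat \<Rightarrow> ('a list \<Rightarrow> 'a) \<Rightarrow> 'a set" where
  "cochain c m p = \<pi> (\<Oplus>S\<in>Sub m. p (enc S) \<otimes> c S)"

abbreviation Hom :: "nat \<Rightarrow> (('a list \<Rightarrow> 'a) \<Rightarrow> 'a set) set" where
  "Hom m \<equiv> left_module_hom A (PM m) M"

definition e :: "nat set \<Rightarrow> 'a list \<Rightarrow> 'a" where
  "e S = (\<lambda>l. if l = enc S then \<one> else \<zero>)"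

lemma e_PM: "\<lbrakk>S \<subseteq> {1..n}; card S = m\<rbrakk> \<Longrightarrow> e S \<in> carrier (PM m)"
  using enc_G[of S m] by (auto simp: e_def PM_iff)

lemma PM_smult_closed: "\<lbrakk>a \<in> carrier A; p \<in> carrier (PM m)\<rbrakk> \<Longrightarrow> (\<lambda>l. a \<otimes> p l) \<in> carrier (PM m)"
  and PM_zero_closed: "(\<lambda>l. \<zero>) \<in> carrier (PM m)"
  by (auto simp: PM_iff)

lemma cochain_arg_closed:
  "\<lbrakk>p \<in> carrier (PM m); \<And>S. c S \<in> R\<rbrakk> \<Longrightarrow> (\<Oplus>S\<in>Sub m. p (enc S) \<otimes> c S) \<in> carrier A"
  by (rule finsum_closed) (auto simp: PM_closed R_sub)

lemma cochain_hom:
  assumes c: "\<And>S. c S \<in> R"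
  shows "cochain c m \<in> Hom m"
proof -
  have "cochain c m (\<lambda>l. p l \<oplus> q l) = cochain c m p \<oplus>\<^bsub>M\<^esub> cochain c m q"
    if p: "p \<in> carrier (PM m)" and q: "q \<in> carrier (PM m)" for p q
  proof -
    have "(\<Oplus>S\<in>Sub m. (p (enc S) \<oplus> q (enc S)) \<otimes> c S) = (\<Oplus>S\<in>Sub m. p (enc S) \<otimes> c S \<oplus> q (enc S) \<otimes> c S)"
      by (rule finsum_cong') (auto simp: PM_closed[OF p] PM_closed[OF q] R_sub c l_distr)
    also have "\<dots> = (\<Oplus>S\<in>Sub m. p (enc S) \<otimes> c S) \<oplus> (\<Oplus>S\<in>Sub m. q (enc S) \<otimes> c S)"
      by (rule finsum_addf) (auto simp: PM_closed[OF p] PM_closed[OF q] R_sub c)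
    finally show ?thesis unfolding cochain_def using cochain_arg_closed[OF p c] cochain_arg_closed[OF q c]
      by (simp add: M_add)
  qed
  moreover have "cochain c m (\<lambda>l. a \<otimes> p l) = a \<odot>\<^bsub>M\<^esub> cochain c m p"
    if p: "p \<in> carrier (PM m)" and a: "a \<in> carrier A" for p a
  proof -
    have "a \<otimes> (\<Oplus>S\<in>Sub m. p (enc S) \<otimes> c S) = (\<Oplus>S\<in>Sub m. a \<otimes> (p (enc S) \<otimes> c S))"
      by (rule finsum_rdistr[OF finite_Sub a]) (auto simp: PM_closed[OF p] R_sub c)
    also have "\<dots> = (\<Oplus>S\<in>Sub m. a \<otimes> p (enc S) \<otimes> c S)"
      by (rule finsum_cong') (auto simp: PM_closed[OF p] R_sub c a m_assoc)
    finally show ?thesis unfolding cochain_def using cochain_arg_closed[OF p c] a by (simp add: M_smult)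
  qed
  ultimately show ?thesis unfolding left_module_hom_def
    by (auto simp: PM_add PM_smult cochain_def cochain_arg_closed \<pi>_closed c)
qed

lemma cochain_e:
  assumes c: "\<And>S. c S \<in> R" and S: "S \<subseteq> {1..n}" "card S = m"
  shows "cochain c m (e S) = \<pi> (c S)"
proof -
  have "(\<Oplus>T\<in>Sub m. e S (enc T) \<otimes> c T) = (\<Oplus>T\<in>Sub m. if S = T then c T else \<zero>)"
    by (rule finsum_cong') (use S in \<open>auto simp: e_def enc_eq_iff c R_sub\<close>)
  also have "\<dots> = c S"
    by (rule add.finprod_singleton[OF _ finite_Sub]) (use S c R_sub in auto)
  finally show ?thesis by (simp add: cochain_def)
qed

lemma restrict_insert:
  assumes p: "p \<in> carrier (PM m)" and S: "S \<in> Sub m" "S \<notin> J" "J \<subseteq> Sub m"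
  shows "(\<lambda>l. if l \<in> enc ` insert S J then p l else \<zero>) =
    (\<lambda>l. (p (enc S) \<otimes> e S l) \<oplus> (if l \<in> enc ` J then p l else \<zero>))"
proof
  fix l
  have "enc S \<notin> (enc ` J :: 'a list set)"
  proof
    assume "enc S \<in> (enc ` J :: 'a list set)"
    then obtain T where T: "T \<in> J" "enc S = (enc T :: 'a list)" by blast
    then have "S = T" using S(1,3) by (intro enc_eq_iff[THEN iffD1, OF _ _ T(2)]) auto
    then show False using T S by simp
  qed
  then show "(if l \<in> enc ` insert S J then p l else \<zero>) =
    (p (enc S) \<otimes> e S l) \<oplus> (if l \<in> enc ` J then p l else \<zero>)"
    by (auto simp: e_def PM_closed[OF p])
qed

lemma restrict_all:
  "p \<in> carrier (PM m) \<Longrightarrow> (\<lambda>l. if l \<in> enc ` Sub m then p l else \<zero>) = p"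
  by (rule ext) (auto simp: PM_iff G_def[symmetric])

lemma restrict_PM:
  "p \<in> carrier (PM m) \<Longrightarrow> (\<lambda>l. if l \<in> L then p l else \<zero>) \<in> carrier (PM m)"
  by (auto simp: PM_iff)

lemma hom_zero:
  assumes f: "f \<in> Hom m" shows "f (\<lambda>l. \<zero>) = \<pi> \<zero>"
proof -
  have "f (\<lambda>l. \<zero>) \<in> carrier M" using f PM_zero_closed by (auto simp: left_module_hom_def)
  then obtain a where a: "a \<in> carrier A" "f (\<lambda>l. \<zero>) = \<pi> a" by (auto simp: M_carrier)
  have "f (\<zero> \<odot>\<^bsub>PM m\<^esub> (\<lambda>l. \<zero>)) = \<zero> \<odot>\<^bsub>M\<^esub> f (\<lambda>l. \<zero>)"
    using f PM_zero_closed[of m] unfolding left_module_hom_def by blast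
  then show ?thesis using a by (simp add: PM_smult M_smult)
qed

text \<open>A homomorphism on a free module is determined on the basis. The induction enlarges the
  support of the argument by one symbol at a time, which avoids sums inside the function
  module.\<close>

lemma hom_expand:
  assumes f: "f \<in> Hom m" and b: "\<And>S. b S \<in> R" and fe: "\<And>S. S \<in> Sub m \<Longrightarrow> f (e S) = \<pi> (b S)"
    and p: "p \<in> carrier (PM m)"
  shows "f p = cochain b m p"
proof -
  have "f (\<lambda>l. if l \<in> enc ` J then p l else \<zero>) = \<pi> (\<Oplus>S\<in>J. p (enc S) \<otimes> b S)"
    if "finite J" "J \<subseteq> Sub m" for J
    using that
  proof (induction J rule: finite_induct)
    case empty
    then show ?case using hom_zero[OF f] by simp
  next
    case (insert S J)
    let ?r = "\<lambda>l. if l \<in> enc ` J then p l else \<zero>"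
    have S: "S \<in> Sub m" "e S \<in> carrier (PM m)" using insert.prems e_PM by auto
    have cl: "(\<Oplus>S\<in>J. p (enc S) \<otimes> b S) \<in> carrier A" "p (enc S) \<in> carrier A" "b S \<in> carrier A"
      using PM_closed[OF p] b R_sub by auto
    have "f (\<lambda>l. if l \<in> enc ` insert S J then p l else \<zero>) = f ((p (enc S) \<odot>\<^bsub>PM m\<^esub> e S) \<oplus>\<^bsub>PM m\<^esub> ?r)"
      using restrict_insert[OF p S(1) insert.hyps(2)] insert.prems by (simp add: PM_add PM_smult)
    also have "\<dots> = (p (enc S) \<odot>\<^bsub>M\<^esub> f (e S)) \<oplus>\<^bsub>M\<^esub> f ?r"
    proof -
      have "p (enc S) \<odot>\<^bsub>PM m\<^esub> e S \<in> carrier (PM m)"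
        using PM_smult_closed[OF cl(2) S(2)] by (simp add: PM_smult)
      then show ?thesis using f S cl restrict_PM[OF p, of "enc ` J"] unfolding left_module_hom_def by simp
    qed
    also have "\<dots> = \<pi> (p (enc S) \<otimes> b S \<oplus> (\<Oplus>S\<in>J. p (enc S) \<otimes> b S))"
      using insert cl by (simp add: fe[OF S(1)] M_smult M_add)
    also have "p (enc S) \<otimes> b S \<oplus> (\<Oplus>S\<in>J. p (enc S) \<otimes> b S) = (\<Oplus>S\<in>insert S J. p (enc S) \<otimes> b S)"
      using insert.hyps cl PM_closed[OF p] b R_sub by (subst finsum_insert) auto
    finally show ?case .
  qed
  from this[OF finite_Sub subset_refl] show ?thesis
    unfolding restrict_all[OF p] by (simp add: cochain_def)
qed

lemma M_rep: "y \<in> carrier M \<Longrightarrow> \<exists>r\<in>R. y = \<pi> r"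
proof -
  assume "y \<in> carrier M"
  then obtain a where a: "a \<in> carrier A" "y = \<pi> a" by (auto simp: M_carrier)
  then have "y = \<pi> (\<epsilon> a)" by (simp add: \<pi>_eq_iff cf_closed cf_const cf_R)
  then show ?thesis using a cf_R by blast
qed

lemma hom_coefficients:
  assumes f: "f \<in> Hom m"
  shows "\<exists>c. (\<forall>S. c S \<in> R) \<and> (\<forall>p\<in>carrier (PM m). f p = cochain c m p)"
proof -
  have "\<exists>r\<in>R. S \<in> Sub m \<longrightarrow> f (e S) = \<pi> r" for S
  proof (cases "S \<in> Sub m")
    case True
    then have "f (e S) \<in> carrier M" using f e_PM[of S m] unfolding left_module_hom_def by auto
    then show ?thesis using M_rep by blast
  qed (auto intro: R_zero)
  then obtain c where c: "\<And>S. c S \<in> R" "\<And>S. S \<in> Sub m \<Longrightarrow> f (e S) = \<pi> (c S)" by metis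
  show ?thesis using c hom_expand[OF f, of c] by blast
qed

lemma M_abelian_monoid: "abelian_monoid M"
  by (rule abelian_monoidI) (auto simp: M_carrier M_add M_zero a_ac)

text \<open>Entries of a boundary have no constant term and \<open>M\<close> sees nothing else, so
  all differentials of the complex of homomorphisms into \<open>M\<close> are zero.\<close>

lemma cochain_d:
  assumes c: "\<And>S. c S \<in> R" and p: "p \<in> carrier (PM (Suc k))"
  shows "cochain c k (d p) = \<zero>\<^bsub>M\<^esub>"
proof -
  note dp = d_PM[OF p]
  have z: "\<epsilon> (d p (enc S)) = \<zero>" if "S \<subseteq> {1..n}" for S
    by (subst cf_d) (use PM_closed[OF p] that in auto)
  have "\<epsilon> (\<Oplus>S\<in>Sub k. d p (enc S) \<otimes> c S) = (\<Oplus>S\<in>Sub k. \<epsilon> (d p (enc S) \<otimes> c S))"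
    by (rule cf_finsum) (auto simp: PM_closed[OF dp] c R_sub)
  also have "\<dots> = \<zero>"
    by (rule add.finprod_one_eqI) (auto simp: \<epsilon>_mult PM_closed[OF dp] c R_sub z cf_closed)
  finally show ?thesis
    unfolding cochain_def M_zero using cochain_arg_closed[OF dp c] by (simp add: \<pi>_eq_iff cf_zero)
qed

lemma hom_d: "\<lbrakk>f \<in> Hom k; p \<in> carrier (PM (Suc k))\<rbrakk> \<Longrightarrow> f (d p) = \<zero>\<^bsub>M\<^esub>"
  using hom_coefficients[of f k] cochain_d d_PM by metis

lemma cocycles: "ext_cocycles A M K m = Hom m"
  unfolding ext_cocycles_def K_simps(2,4) using hom_d by auto

text \<open>Coboundaries vanish, so being cohomologous is equality on the carrier. The function f is
  required only to take values in \<open>M\<close>, because in the Yoneda product it is a sum of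
  composites and not a given homomorphism.\<close>

lemma cohomologous_iff:
  assumes f: "\<And>p. p \<in> carrier (PM m) \<Longrightarrow> f p \<in> carrier M"
  shows "cohomologous A M K m f g \<longleftrightarrow> (\<forall>p\<in>carrier (PM m). g p = f p)"
proof (cases m)
  case (Suc k)
  interpret M: abelian_monoid M by (rule M_abelian_monoid)
  have "cochain (\<lambda>_. \<zero>) k \<in> Hom k" by (rule cochain_hom) (rule R_zero)
  moreover have "f p \<oplus>\<^bsub>M\<^esub> b (d p) = f p" if "b \<in> Hom k" "p \<in> carrier (PM m)" for b p
    using f[OF that(2)] hom_d[OF that(1)] that(2) Suc by simp
  ultimately show ?thesis unfolding cohomologous_def K_simps(2,4) Suc nat.case by (metis Suc)
qed (simp add: cohomologous_def K_simps)

text \<open>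
  All cochains are cocycles and no two of them are cohomologous, so a family \<open>c\<close> of elements of \<open>R\<close>
  is the same as an element \<open>\<Sum> c\<^sub>S \<xi>\<^sub>S\<close> of the Yoneda algebra.
\<close>

definition \<Theta> :: "(nat set \<Rightarrow> 'a) \<Rightarrow> nat \<Rightarrow> (('a list \<Rightarrow> 'a) \<Rightarrow> 'a set) set" where
  "\<Theta> c m = {g \<in> Hom m. \<forall>p\<in>carrier (PM m). g p = cochain c m p}"

lemma ext_class_eq:
  assumes "\<And>S. c S \<in> R" and f: "\<And>p. p \<in> carrier (PM m) \<Longrightarrow> f p = cochain c m p"
  shows "ext_class A M K m f = \<Theta> c m"
proof -
  have "f p \<in> carrier M" if "p \<in> carrier (PM m)" for p
    using cochain_hom[of c m] assms that unfolding left_module_hom_def by auto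
  then show ?thesis unfolding ext_class_def \<Theta>_def cocycles
    using f by (auto simp: cohomologous_iff)
qed

lemma Ext_eq: "Ext A M K m = {\<Theta> c m | c. \<forall>S. c S \<in> R}"
proof -
  have "ext_class A M K m f \<in> {\<Theta> c m | c. \<forall>S. c S \<in> R}" if "f \<in> Hom m" for f
    using hom_coefficients[OF that] ext_class_eq by blast
  moreover have "\<Theta> c m \<in> ext_class A M K m ` Hom m" if "\<forall>S. c S \<in> R" for c
    using ext_class_eq[of c m "cochain c m"] cochain_hom[of c m] that by blast
  ultimately show ?thesis unfolding Ext_def cocycles by blast
qed

lemma \<Theta>_cong: "(\<And>S. S \<in> Sub m \<Longrightarrow> c S = c' S) \<Longrightarrow> (\<And>S. c' S \<in> R) \<Longrightarrow> \<Theta> c m = \<Theta> c' m"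
proof -
  assume c: "\<And>S. S \<in> Sub m \<Longrightarrow> c S = c' S" and c': "\<And>S. c' S \<in> R"
  have "cochain c m p = cochain c' m p" if "p \<in> carrier (PM m)" for p
    unfolding cochain_def by (rule arg_cong[where f = \<pi>], rule finsum_cong')
      (use c c' R_sub PM_closed[OF that] in auto)
  then show ?thesis unfolding \<Theta>_def by auto
qed

lemma cochain_\<Theta>: "(\<And>S. c S \<in> R) \<Longrightarrow> cochain c m \<in> \<Theta> c m"
  by (simp add: \<Theta>_def cochain_hom)

lemma ext_zero_eq: "ext_zero A M K m = \<Theta> (\<lambda>_. \<zero>) m"
proof -
  have "cochain (\<lambda>_. \<zero>) m p = \<zero>\<^bsub>M\<^esub>" if p: "p \<in> carrier (PM m)" for p
  proof -
    have "(\<Oplus>S\<in>Sub m. p (enc S) \<otimes> \<zero>) = \<zero>"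
      by (rule add.finprod_one_eqI) (simp add: PM_closed[OF p])
    then show ?thesis by (simp add: cochain_def M_zero)
  qed
  then show ?thesis unfolding ext_zero_def by (intro ext_class_eq) (auto simp: R_zero)
qed

abbreviation E :: "(nat \<Rightarrow> (('a list \<Rightarrow> 'a) \<Rightarrow> 'a set) set) ring" where
  "E \<equiv> yoneda_algebra A M K"

lemma E_carrier: "carrier E = {\<Theta> c | c. \<forall>S. c S \<in> R}"
proof
  show "carrier E \<subseteq> {\<Theta> c | c. \<forall>S. c S \<in> R}"
  proof
    fix u assume "u \<in> carrier E"
    then have "u m \<in> Ext A M K m" for m by (simp add: yoneda_algebra_def)
    then have "\<forall>m. \<exists>c. (\<forall>S. c S \<in> R) \<and> u m = \<Theta> c m"
      unfolding Ext_eq by blast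
    then obtain C where C: "\<And>m S. C m S \<in> R" "\<And>m. u m = \<Theta> (C m) m" by metis
    \<comment> \<open>A subset S is read only in degree \<open>card S\<close>, so the families
      chosen degree by degree glue to a single one.\<close>
    have "u = \<Theta> (\<lambda>S. C (card S) S)"
      by (rule ext) (subst C(2), rule \<Theta>_cong, auto simp: C(1))
    then show "u \<in> {\<Theta> c | c. \<forall>S. c S \<in> R}" using C(1) by blast
  qed
next
  have "finite {m. \<Theta> c m \<noteq> \<Theta> (\<lambda>_. \<zero>) m}" for c
  proof (rule finite_subset)
    \<comment> \<open>No subset of {1..n} has more than n elements, so a family has no influence in
      these degrees.\<close>
    have "\<Theta> c m = \<Theta> (\<lambda>_. \<zero>) m" if "n < m" for m
    proof (rule \<Theta>_cong)
      fix S assume "S \<in> Sub m"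
      then have "m \<le> n" using card_mono[of "{1..n}" S] by auto
      then show "c S = \<zero>" using that by simp
    qed (rule R_zero)
    then show "{m. \<Theta> c m \<noteq> \<Theta> (\<lambda>_. \<zero>) m} \<subseteq> {..n}" by (auto simp: not_less[symmetric])
  qed simp
  then show "{\<Theta> c | c. \<forall>S. c S \<in> R} \<subseteq> carrier E"
    by (auto simp: yoneda_algebra_def Ext_eq ext_zero_eq)
qed

lemma E_zero: "\<zero>\<^bsub>E\<^esub> = \<Theta> (\<lambda>_. \<zero>)"
  by (rule ext) (simp add: yoneda_algebra_def ext_zero_eq)

lemma cochain_add:
  assumes c: "\<And>S. c S \<in> R" and c': "\<And>S. c' S \<in> R" and p: "p \<in> carrier (PM m)"
  shows "cochain c m p \<oplus>\<^bsub>M\<^esub> cochain c' m p = cochain (\<lambda>S. c S \<oplus> c' S) m p"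
proof -
  have "(\<Oplus>S\<in>Sub m. p (enc S) \<otimes> (c S \<oplus> c' S)) = (\<Oplus>S\<in>Sub m. p (enc S) \<otimes> c S \<oplus> p (enc S) \<otimes> c' S)"
    by (rule finsum_cong') (auto simp: PM_closed[OF p] R_sub c c' r_distr)
  also have "\<dots> = (\<Oplus>S\<in>Sub m. p (enc S) \<otimes> c S) \<oplus> (\<Oplus>S\<in>Sub m. p (enc S) \<otimes> c' S)"
    by (rule finsum_addf) (auto simp: PM_closed[OF p] R_sub c c')
  finally show ?thesis unfolding cochain_def using cochain_arg_closed[OF p c] cochain_arg_closed[OF p c'] by (simp add: M_add)
qed

lemma E_add:
  assumes c: "\<And>S. c S \<in> R" and c': "\<And>S. c' S \<in> R"
  shows "\<Theta> c \<oplus>\<^bsub>E\<^esub> \<Theta> c' = \<Theta> (\<lambda>S. c S \<oplus> c' S)"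
proof
  fix m
  have cl: "f p \<oplus>\<^bsub>M\<^esub> g p = cochain (\<lambda>S. c S \<oplus> c' S) m p" "f p \<oplus>\<^bsub>M\<^esub> g p \<in> carrier M"
    if "f \<in> \<Theta> c m" "g \<in> \<Theta> c' m" "p \<in> carrier (PM m)" for f g p
  proof -
    show "f p \<oplus>\<^bsub>M\<^esub> g p = cochain (\<lambda>S. c S \<oplus> c' S) m p"
      using that cochain_add[OF c c' that(3)] by (simp add: \<Theta>_def)
    also have "\<dots> \<in> carrier M"
      using cochain_hom[of "\<lambda>S. c S \<oplus> c' S" m] that(3) c c' R_add unfolding left_module_hom_def by auto
    finally show "f p \<oplus>\<^bsub>M\<^esub> g p \<in> carrier M" .
  qed
  have "(\<Theta> c \<oplus>\<^bsub>E\<^esub> \<Theta> c') m = {h \<in> Hom m. \<exists>f\<in>\<Theta> c m. \<exists>g\<in>\<Theta> c' m.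
     \<forall>p\<in>carrier (PM m). h p = f p \<oplus>\<^bsub>M\<^esub> g p}"
    using cl by (auto simp: yoneda_algebra_def cocycles cohomologous_iff)
  also have "\<dots> = \<Theta> (\<lambda>S. c S \<oplus> c' S) m"
    using cl cochain_\<Theta>[of c m, OF c] cochain_\<Theta>[of c' m, OF c'] unfolding \<Theta>_def[of "\<lambda>S. c S \<oplus> c' S"] by fastforce
  finally show "(\<Theta> c \<oplus>\<^bsub>E\<^esub> \<Theta> c') m = \<Theta> (\<lambda>S. c S \<oplus> c' S) m" .
qed

text \<open>\<open>generate_ring\<close> is closed under additive inverses; this is what keeps those
  inverses inside the Yoneda algebra.\<close>

lemma E_abelian_group: "abelian_group E"
proof (rule abelian_groupI)
  fix u assume "u \<in> carrier E"
  then obtain c where c: "u = \<Theta> c" "\<And>S. c S \<in> R" by (auto simp: E_carrier)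
  have "\<Theta> (\<lambda>S. \<ominus> c S) \<oplus>\<^bsub>E\<^esub> u = \<zero>\<^bsub>E\<^esub>"
    unfolding c(1) E_zero by (subst E_add) (auto simp: c R_neg l_neg R_sub)
  moreover have "\<Theta> (\<lambda>S. \<ominus> c S) \<in> carrier E" using c R_neg by (auto simp: E_carrier)
  ultimately show "\<exists>v\<in>carrier E. v \<oplus>\<^bsub>E\<^esub> u = \<zero>\<^bsub>E\<^esub>" by blast
next
  fix u v w assume "u \<in> carrier E" "v \<in> carrier E" "w \<in> carrier E"
  then show "u \<oplus>\<^bsub>E\<^esub> v \<oplus>\<^bsub>E\<^esub> w = u \<oplus>\<^bsub>E\<^esub> (v \<oplus>\<^bsub>E\<^esub> w)"
    by (auto simp: E_carrier E_add R_add a_assoc R_sub)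
next
  fix u v assume "u \<in> carrier E" "v \<in> carrier E"
  then obtain c c' where c: "u = \<Theta> c" "\<And>S. c S \<in> R" and c': "v = \<Theta> c'" "\<And>S. c' S \<in> R"
    by (auto simp: E_carrier)
  have "\<Theta> (\<lambda>S. c S \<oplus> c' S) \<in> carrier E" using c c' R_add by (auto simp: E_carrier)
  then show "u \<oplus>\<^bsub>E\<^esub> v \<in> carrier E" by (simp add: c c' E_add)
  show "u \<oplus>\<^bsub>E\<^esub> v = v \<oplus>\<^bsub>E\<^esub> u" using c(2) c'(2) by (simp add: c(1) c'(1) E_add a_comm R_sub)
qed (auto simp: E_zero E_carrier E_add R_zero R_sub)


subsection \<open>The Yoneda product\<close>

text \<open>
  The coefficient relating \<open>\<xi>\<^sub>T \<xi>\<^bsub>S - T\<^esub>\<close> to \<open>\<xi>\<^sub>S\<close>. It is forced by \<open>shuffle_coeff_step\<close>, which is the condition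
  for the lifts of cocycles to commute with \<open>d\<close>.
\<close>

definition shuffle_coeff :: "nat set \<Rightarrow> nat set \<Rightarrow> 'a" where
  "shuffle_coeff S T = finprod (A\<lparr>carrier := R\<rparr>) (\<lambda>i. koszul_coeff i (S - T)) T"

lemma shuffle_coeff_R: "\<lbrakk>S \<subseteq> {1..n}; T \<subseteq> S\<rbrakk> \<Longrightarrow> shuffle_coeff S T \<in> R"
proof -
  assume S: "S \<subseteq> {1..n}" and T: "T \<subseteq> S"
  interpret RR: cring "A\<lparr>carrier := R\<rparr>" by (rule R_cring)
  have "(\<lambda>i. koszul_coeff i (S - T)) \<in> T \<rightarrow> carrier (A\<lparr>carrier := R\<rparr>)" using S T by (auto intro!: koszul_coeff_R)
  then show ?thesis unfolding shuffle_coeff_def using RR.finprod_closed by simp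
qed

lemma shuffle_coeff_empty [simp]: "shuffle_coeff S {} = \<one>"
proof -
  interpret RR: cring "A\<lparr>carrier := R\<rparr>" by (rule R_cring)
  show ?thesis by (simp add: shuffle_coeff_def)
qed

text \<open>With U = \<open>S - insert i T\<close>, both sides are the product of
  \<open>koszul_coeff j U\<close> over j in \<open>insert i T\<close>, times
  \<open>koszul_coeff i T\<close>. On the right this uses that Koszul coefficients are
  multiplicative over the disjoint union of U and T.\<close>

lemma shuffle_coeff_step:
  assumes S: "S \<subseteq> {1..n}" and i: "i \<notin> T" "insert i T \<subseteq> S"
  shows "shuffle_coeff S (insert i T) \<otimes> koszul_coeff i T = koszul_coeff i (S - {i}) \<otimes> shuffle_coeff (S - {i}) T"
proof -
  interpret RR: cring "A\<lparr>carrier := R\<rparr>" by (rule R_cring)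
  define U where "U = S - insert i T"
  have U: "S - {i} - T = U" "S - {i} = U \<union> T" "U \<inter> T = {}" "U \<subseteq> {1..n}" "T \<subseteq> {1..n}" "i \<in> {1..n}"
    unfolding U_def using i S by blast+
  have fin: "finite T" using U finite_N by simp
  have cl: "(\<lambda>i. koszul_coeff i U) \<in> T \<rightarrow> carrier (A\<lparr>carrier := R\<rparr>)" "koszul_coeff i U \<in> carrier (A\<lparr>carrier := R\<rparr>)"
    using koszul_coeff_R[OF _ U(4)] U(5,6) by auto
  have p: "finprod (A\<lparr>carrier := R\<rparr>) (\<lambda>i. koszul_coeff i U) T \<in> R" using RR.finprod_closed[OF cl(1)] by simp
  have k: "koszul_coeff i U \<in> R" "koszul_coeff i T \<in> R" using koszul_coeff_R[OF U(6)] U(4,5) by simp_all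
  have "shuffle_coeff S (insert i T) = koszul_coeff i U \<otimes> finprod (A\<lparr>carrier := R\<rparr>) (\<lambda>i. koszul_coeff i U) T"
    unfolding shuffle_coeff_def U_def[symmetric] using RR.finprod_insert[OF fin i(1) cl] by simp
  moreover have "shuffle_coeff (S - {i}) T = finprod (A\<lparr>carrier := R\<rparr>) (\<lambda>i. koszul_coeff i U) T"
    unfolding shuffle_coeff_def U(1) ..
  moreover have "koszul_coeff i (S - {i}) = koszul_coeff i U \<otimes> koszul_coeff i T"
    unfolding U(2) using U by (intro koszul_coeff_union) auto
  ultimately show ?thesis using R_comm[OF p k(2)] R_sub[OF p] R_sub[OF k(1)] R_sub[OF k(2)]
    by (simp add: m_assoc)
qed

lemma shuffle_coeff_unit:
  assumes S: "S \<subseteq> {1..n}" and T: "T \<subseteq> S"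
  shows "\<exists>s\<in>R. s \<otimes> shuffle_coeff S T = \<one>"
proof -
  interpret RR: cring "A\<lparr>carrier := R\<rparr>" by (rule R_cring)
  define U where "U = S - T"
  have U: "U \<subseteq> {1..n}" using S by (auto simp: U_def)
  have "\<exists>s\<in>R. s \<otimes> finprod (A\<lparr>carrier := R\<rparr>) (\<lambda>i. koszul_coeff i U) J = \<one>" if "finite J" "J \<subseteq> {1..n}" for J
    using that
  proof (induction J rule: finite_induct)
    case empty then show ?case using R_one by (intro bexI[of _ \<one>]) auto
  next
    case (insert i J)
    then obtain s where s: "s \<in> R" "s \<otimes> finprod (A\<lparr>carrier := R\<rparr>) (\<lambda>i. koszul_coeff i U) J = \<one>" by auto
    obtain t where t: "t \<in> R" "t \<otimes> koszul_coeff i U = \<one>" using koszul_coeff_unit[OF _ U, of i] insert.prems by auto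
    have cl: "(\<lambda>i. koszul_coeff i U) \<in> J \<rightarrow> carrier (A\<lparr>carrier := R\<rparr>)" "koszul_coeff i U \<in> carrier (A\<lparr>carrier := R\<rparr>)"
      using U insert.prems by (auto intro!: koszul_coeff_R)
    let ?p = "finprod (A\<lparr>carrier := R\<rparr>) (\<lambda>i. koszul_coeff i U) J"
    have p: "?p \<in> carrier A" using RR.finprod_closed[OF cl(1)] R_sub by simp
    have k: "koszul_coeff i U \<in> carrier A" using cl(2) R_sub by simp
    have "(s \<otimes> t) \<otimes> (koszul_coeff i U \<otimes> ?p) = s \<otimes> ((t \<otimes> koszul_coeff i U) \<otimes> ?p)"
      using p k R_sub[OF s(1)] R_sub[OF t(1)] by (simp add: m_assoc)
    also have "\<dots> = \<one>" using s t p by simp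
    finally show ?case using s t insert.hyps cl RR.finprod_insert[of J i "\<lambda>i. koszul_coeff i U"]
      by (intro bexI[of _ "s \<otimes> t"]) (auto simp: R_mult)
  qed
  moreover have "T \<subseteq> {1..n}" using S T by auto
  ultimately show ?thesis unfolding shuffle_coeff_def U_def[symmetric] using finite_N by blast
qed

section \<open>Constant terms, linear terms and lifts of cocycles\<close>

definition unit_exp :: "nat \<Rightarrow> nat \<Rightarrow> nat" where "unit_exp i = incr (\<lambda>_. 0) i"

text \<open>In the coefficient of x_i only the constant term of a single entry survives, and the
  twist at exponent zero is 1. Up to a unit, constant terms can therefore be recovered from the
  linear terms of a boundary.\<close>

lemma cf_d_var:
  assumes p: "\<And>l. p l \<in> carrier A" and T: "T \<subseteq> {1..n}" and i: "i \<in> {1..n}"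
  shows "cf (d p (enc T)) (unit_exp i) = (if i \<in> T then \<zero> else koszul_coeff i T \<otimes> \<epsilon> (p (enc (insert i T))))"
proof -
  let ?f = "\<lambda>j. koszul_coeff i T \<otimes> \<epsilon> (p (enc (insert i T)))"
  have k: "?f j \<in> carrier A" for j
    using koszul_coeff_R[OF i T] R_sub cf_closed[OF p] by simp
  have dz: "decr (unit_exp i) i = (\<lambda>_. 0)" by (auto simp: unit_exp_def)
  have "cf (d p (enc T)) (unit_exp i) = (\<Oplus>j\<in>{1..n} - T. if i = j then ?f j else \<zero>)"
    unfolding cf_d[of p, OF p T]
  proof (rule finsum_cong')
    fix j assume j: "j \<in> {1..n} - T"
    show "(if unit_exp i j = 0 then \<zero>
        else koszul_coeff j T \<otimes> tw (decr (unit_exp i) j) j \<otimes> cf (p (enc (insert j T))) (decr (unit_exp i) j)) =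
      (if i = j then ?f j else \<zero>)"
    proof (cases "i = j")
      case True
      have "tw (\<lambda>_. 0) j = \<one>" by (rule tw_one) simp
      then show ?thesis using True dz koszul_coeff_R[OF i T] R_sub by (simp add: unit_exp_def)
    qed (simp add: unit_exp_def)
  qed (use k in auto)
  also have "\<dots> = (if i \<in> T then \<zero> else ?f i)"
  proof (cases "i \<in> T")
    case True
    then show ?thesis by (auto intro: add.finprod_one_eqI)
  next
    case False
    then show ?thesis using i k by (subst add.finprod_singleton) auto
  qed
  finally show ?thesis .
qed

text \<open>The linear term of a product obeys a Leibniz rule; the summand with the constant term of
  a has disappeared.\<close>

lemma cf_mult_var:
  assumes a: "a \<in> carrier A" and b: "b \<in> carrier A" and z: "\<epsilon> a = \<zero>" and i: "i \<in> {1..n}"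
  shows "cf (a \<otimes> b) (unit_exp i) = cf a (unit_exp i) \<otimes> \<epsilon> b"
proof (rule cf_mult_constant_term[OF a b])
  fix \<beta> m assume m: "m \<in> {1..n}"
  show "cf (a \<otimes> mon \<beta> \<otimes> x m) (unit_exp i) = \<zero>"
  proof (cases "i = m")
    case True
    have "decr (unit_exp m) m = (\<lambda>_. 0)" by (auto simp: unit_exp_def)
    then show ?thesis using True m z R_sub[OF tw_R]
      by (simp add: cf_mult_x a mon_closed \<epsilon>_mult cf_closed unit_exp_def)
  next
    case False
    then show ?thesis using m by (simp add: cf_mult_x a mon_closed unit_exp_def)
  qed
qed

lemma PM_hom_expand:
  assumes f: "f \<in> left_module_hom A (PM m) (PM k)" and p: "p \<in> carrier (PM m)"
  shows "f p l = (\<Oplus>S\<in>Sub m. p (enc S) \<otimes> f (e S) l)"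
proof -
  have fcl: "f q l \<in> carrier A" if "q \<in> carrier (PM m)" for q
    using f that PM_closed unfolding left_module_hom_def by blast
  have fadd: "f (\<lambda>l. q l \<oplus> q' l) l = f q l \<oplus> f q' l" if "q \<in> carrier (PM m)" "q' \<in> carrier (PM m)" for q q'
    using f that unfolding left_module_hom_def by (simp add: PM_add)
  have fsmult: "f (\<lambda>l. a \<otimes> q l) l = a \<otimes> f q l" if "q \<in> carrier (PM m)" "a \<in> carrier A" for q a
    using f that unfolding left_module_hom_def by (simp add: PM_smult)
  have "f (\<lambda>l. if l \<in> enc ` J then p l else \<zero>) l = (\<Oplus>S\<in>J. p (enc S) \<otimes> f (e S) l)"
    if "finite J" "J \<subseteq> Sub m" for J
    using that
  proof (induction J rule: finite_induct)
    case empty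
    then show ?case using fsmult[OF PM_zero_closed, of \<zero>] fcl[OF PM_zero_closed] by simp
  next
    case (insert S J)
    let ?r = "\<lambda>l. if l \<in> enc ` J then p l else \<zero>"
    have S: "S \<in> Sub m" "e S \<in> carrier (PM m)" using insert.prems e_PM by auto
    have cl: "p (enc S) \<in> carrier A" "f (e T) l \<in> carrier A" if "T \<in> Sub m" for T S
      using PM_closed[OF p] fcl[OF e_PM[of T m]] that by auto
    have "f (\<lambda>l. if l \<in> enc ` insert S J then p l else \<zero>) l =
        f (\<lambda>l. p (enc S) \<otimes> e S l \<oplus> ?r l) l"
      using restrict_insert[OF p S(1) insert.hyps(2)] insert.prems by simp
    also have "\<dots> = p (enc S) \<otimes> f (e S) l \<oplus> f ?r l"
      using PM_closed[OF p] S(2)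
      by (simp add: fadd[OF PM_smult_closed[OF _ S(2)] restrict_PM[OF p]] fsmult)
    also have "\<dots> = (\<Oplus>S\<in>insert S J. p (enc S) \<otimes> f (e S) l)"
      using insert cl by (subst finsum_insert) auto
    finally show ?case .
  qed
  from this[OF finite_Sub subset_refl] show ?thesis
    unfolding restrict_all[OF p] .
qed

text \<open>The coefficient of e_T in the lifted image of e_S. As in a comultiplication, S is split
  into T and its complement, and c is evaluated on the complement.\<close>

definition lift_coeff :: "(nat set \<Rightarrow> 'a) \<Rightarrow> nat set \<Rightarrow> nat set \<Rightarrow> 'a" where
  "lift_coeff c S T = (if T \<subseteq> S then shuffle_coeff S T \<otimes> c (S - T) else \<zero>)"

lemma lift_coeff_R: "\<lbrakk>S \<subseteq> {1..n}; \<And>S. c S \<in> R\<rbrakk> \<Longrightarrow> lift_coeff c S T \<in> R"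
  by (simp add: lift_coeff_def R_mult shuffle_coeff_R R_zero)

text \<open>This compares the coefficients of x_i e_T in d F e_S and in F d e_S. It serves both to
  determine an unknown lift and to verify the explicit one.\<close>

lemma lift_coeff_step:
  assumes S: "S \<subseteq> {1..n}" and T: "T \<subseteq> {1..n}" and i: "i \<in> {1..n}" "i \<notin> T" and c: "\<And>S. c S \<in> R"
  shows "koszul_coeff i T \<otimes> lift_coeff c S (insert i T) = (if i \<in> S then koszul_coeff i (S - {i}) \<otimes> lift_coeff c (S - {i}) T else \<zero>)"
proof (cases "insert i T \<subseteq> S")
  case True
  then have shuffle_coeff: "shuffle_coeff S (insert i T) \<in> R" "shuffle_coeff (S - {i}) T \<in> R" using S i(2) by (auto intro!: shuffle_coeff_R)
  have k: "koszul_coeff i T \<in> R" "koszul_coeff i (S - {i}) \<in> R" using T S i by (auto intro!: koszul_coeff_R)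
  have "S - {i} - T = S - insert i T" by auto
  moreover have "koszul_coeff i T \<otimes> shuffle_coeff S (insert i T) = koszul_coeff i (S - {i}) \<otimes> shuffle_coeff (S - {i}) T"
    using shuffle_coeff_step[OF S i(2) True] R_comm[OF shuffle_coeff(1) k(1)] by simp
  ultimately show ?thesis using True R_sub[OF shuffle_coeff(1)] R_sub[OF shuffle_coeff(2)] R_sub[OF k(1)] R_sub[OF k(2)] R_sub[OF c] i
    by (auto simp: lift_coeff_def m_assoc[symmetric])
next
  case False
  moreover have "koszul_coeff i T \<in> carrier A" "koszul_coeff i (S - {i}) \<in> carrier A" using T S i by (auto intro!: R_sub koszul_coeff_R)
  ultimately show ?thesis using i by (auto simp: lift_coeff_def)
qed

text \<open>A lift of a cocycle is unique modulo the augmentation ideal: comparing the coefficients of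
  \<open>x\<^sub>i e\<^sub>T\<close> in \<open>d F = F d\<close> determines the constant terms recursively.\<close>

lemma lift_leading:
  assumes lift: "cocycle_lift A M K j g F" and g: "g \<in> \<Theta> c j" and c: "\<And>S. c S \<in> R"
    and S: "S \<subseteq> {1..n}" "card S = j + k" and T: "T \<subseteq> {1..n}" "card T = k"
  shows "\<epsilon> (F k (e S) (enc T)) = lift_coeff c S T"
  using S T
proof (induction k arbitrary: S T)
  case 0
  then have T: "T = {}" using finite_N by auto
  have eS: "e S \<in> carrier (PM j)" using 0 e_PM by simp
  have F0: "F 0 \<in> left_module_hom A (PM (j + 0)) (PM 0)"
    using lift unfolding cocycle_lift_def K_simps(4) by blast
  then have "F 0 (e S) \<in> carrier (PM 0)" using eS unfolding left_module_hom_def by auto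
  then have cl: "F 0 (e S) (enc {}) \<in> carrier A" by (rule PM_closed)
  have "\<pi> (F 0 (e S) (enc {})) = g (e S)"
    using lift eS unfolding cocycle_lift_def K_simps(3,4) by blast
  also have "\<dots> = \<pi> (c S)" using g eS cochain_e[of c S j] c 0 by (simp add: \<Theta>_def)
  finally have "\<epsilon> (F 0 (e S) (enc {})) = c S" using cl R_sub[OF c] by (simp add: \<pi>_eq_iff cf_const c)
  then show ?case using T R_sub[OF c] by (simp add: lift_coeff_def)
next
  case (Suc k)
  have "T \<noteq> {}" using Suc.prems by auto
  \<comment> \<open>Any element of T will do: the comparison at x_i gives the same value for each
    choice.\<close>
  then obtain i where i: "i \<in> T" by auto
  define T' where "T' = T - {i}"
  have T': "T' \<subseteq> {1..n}" "card T' = k" "T = insert i T'" "i \<notin> T'" "i \<in> {1..n}"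
    using Suc.prems i finite_N[of T] by (auto simp: T'_def)
  have hom: "F k \<in> left_module_hom A (PM (j + k)) (PM k)" for k
    using lift unfolding cocycle_lift_def K_simps(4) by blast
  have eS: "e S \<in> carrier (PM (j + Suc k))" using Suc.prems e_PM by simp
  have deS: "d (e S) \<in> carrier (PM (j + k))" by (rule d_PM) (use eS in simp)
  have comm: "d (F (Suc k) (e S)) = F k (d (e S))"
    using lift eS unfolding cocycle_lift_def K_simps(2,4) by blast
  have FS: "F (Suc k) (e S) \<in> carrier (PM (Suc k))"
    using hom[of "Suc k"] eS unfolding left_module_hom_def by auto
  have lhs: "cf (d (F (Suc k) (e S)) (enc T')) (unit_exp i) = koszul_coeff i T' \<otimes> \<epsilon> (F (Suc k) (e S) (enc T))"
    using T' by (subst cf_d_var) (auto simp: PM_closed[OF FS])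
  have Fcl: "F k (e S') (enc T') \<in> carrier A" if "S' \<in> Sub (j + k)" for S'
    using hom[of k] e_PM[of S' "j + k"] that PM_closed unfolding left_module_hom_def by blast
  have z: "\<epsilon> (d (e S) (enc S')) = \<zero>" if "S' \<subseteq> {1..n}" for S'
    by (subst cf_d) (use PM_closed[OF eS] that in auto)
  have kv: "koszul_coeff i (S - {i}) \<otimes> lift_coeff c (S - {i}) T' \<in> carrier A"
    using T' Suc.prems c by (intro R_sub R_mult lift_coeff_R koszul_coeff_R) auto
  have "cf (F k (d (e S)) (enc T')) (unit_exp i) =
      (\<Oplus>S'\<in>Sub (j + k). cf (d (e S) (enc S') \<otimes> F k (e S') (enc T')) (unit_exp i))"
    unfolding PM_hom_expand[OF hom deS]
    by (rule cf_finsum) (use PM_closed[OF deS] Fcl in auto)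
  also have "\<dots> = (\<Oplus>S'\<in>Sub (j + k). if S' = S - {i} \<and> i \<in> S then koszul_coeff i (S - {i}) \<otimes> lift_coeff c (S - {i}) T' else \<zero>)"
  proof (rule finsum_cong')
    show "(\<lambda>S'. if S' = S - {i} \<and> i \<in> S then koszul_coeff i (S - {i}) \<otimes> lift_coeff c (S - {i}) T' else \<zero>) \<in> Sub (j + k) \<rightarrow> carrier A"
      using kv by auto
    fix S' assume S': "S' \<in> Sub (j + k)"
    have ez: "\<epsilon> (e S l) = (if l = enc S then \<one> else \<zero>)" for l
      by (simp add: e_def cf_const R_one R_zero)
    \<comment> \<open>The entries of d e_S have no constant term, so of F e_S' only the constant
      term matters, and that is known by induction.\<close>
    have "cf (d (e S) (enc S') \<otimes> F k (e S') (enc T')) (unit_exp i) =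
        cf (d (e S) (enc S')) (unit_exp i) \<otimes> lift_coeff c S' T'"
      using S' T' z[of S'] Fcl[OF S'] PM_closed[OF deS] Suc.IH[of S' T'] by (simp add: cf_mult_var)
    also have "cf (d (e S) (enc S')) (unit_exp i) = (if i \<notin> S' \<and> insert i S' = S then koszul_coeff i S' else \<zero>)"
      using S' T' Suc.prems koszul_coeff_R[of i S'] R_sub
      by (subst cf_d_var) (auto simp: PM_closed[OF eS] ez enc_eq_iff)
    also have "i \<notin> S' \<and> insert i S' = S \<longleftrightarrow> S' = S - {i} \<and> i \<in> S" by auto
    finally show "cf (d (e S) (enc S') \<otimes> F k (e S') (enc T')) (unit_exp i) =
      (if S' = S - {i} \<and> i \<in> S then koszul_coeff i (S - {i}) \<otimes> lift_coeff c (S - {i}) T' else \<zero>)"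
      using S' R_sub[OF lift_coeff_R[OF _ c]] by (cases "S' = S - {i} \<and> i \<in> S") (simp_all only: simp_thms if_True if_False, simp_all)
  qed simp
  also have "\<dots> = (if i \<in> S then koszul_coeff i (S - {i}) \<otimes> lift_coeff c (S - {i}) T' else \<zero>)"
  proof (cases "i \<in> S")
    case True
    have "card (S - {i}) = j + k" using Suc.prems finite_N[of S] True by simp
    then have mem: "S - {i} \<in> Sub (j + k)" using Suc.prems by auto
    have "(\<Oplus>S'\<in>Sub (j + k). if S - {i} = S' then koszul_coeff i (S - {i}) \<otimes> lift_coeff c (S - {i}) T' else \<zero>) =
        koszul_coeff i (S - {i}) \<otimes> lift_coeff c (S - {i}) T'"
      by (rule add.finprod_singleton[OF mem finite_Sub])
        (use kv in auto)
    then show ?thesis using True by (simp add: eq_commute[of _ "S - {i}"])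
  qed simp
  also have "\<dots> = koszul_coeff i T' \<otimes> lift_coeff c S T"
    unfolding T'(3) using lift_coeff_step[OF Suc.prems(1) T'(1,5,4), of c] c by simp
  finally have eq: "koszul_coeff i T' \<otimes> \<epsilon> (F (Suc k) (e S) (enc T)) = koszul_coeff i T' \<otimes> lift_coeff c S T"
    using lhs comm by simp
  \<comment> \<open>The common factor is a unit; cancelling it isolates the constant term of the
    lift.\<close>
  obtain s where s: "s \<in> R" "s \<otimes> koszul_coeff i T' = \<one>" using koszul_coeff_unit[of i T'] T' by auto
  have cl: "\<epsilon> (F (Suc k) (e S) (enc T)) \<in> carrier A" "lift_coeff c S T \<in> carrier A" "koszul_coeff i T' \<in> carrier A"
    using cf_closed[OF PM_closed[OF FS]] Suc.prems(1) c T' by (auto intro!: R_sub lift_coeff_R koszul_coeff_R)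
  have "s \<otimes> (koszul_coeff i T' \<otimes> \<epsilon> (F (Suc k) (e S) (enc T))) = s \<otimes> (koszul_coeff i T' \<otimes> lift_coeff c S T)" using eq by simp
  then show ?case using cl s R_sub[OF s(1)] by (simp add: m_assoc[symmetric])
qed


text \<open>The sum runs over subsets of all sizes, so that one function lifts in every degree and
  commutes with d for any c. The degree of the cocycle enters only through the support of c, in
  \<open>lift_PM\<close>.\<close>

definition lift :: "(nat set \<Rightarrow> 'a) \<Rightarrow> ('a list \<Rightarrow> 'a) \<Rightarrow> ('a list \<Rightarrow> 'a)" where
  "lift c p = (\<lambda>l. if l \<in> enc ` Pow {1..n} then (\<Oplus>S\<in>Pow {1..n}. p (enc S) \<otimes> lift_coeff c S (dec l)) else \<zero>)"

lemma lift_enc: "T \<subseteq> {1..n} \<Longrightarrow> lift c p (enc T) = (\<Oplus>S\<in>Pow {1..n}. p (enc S) \<otimes> lift_coeff c S T)"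
  by (simp add: lift_def dec_enc_N)

lemma lift_closed:
  "\<lbrakk>\<And>l. p l \<in> carrier A; \<And>S. c S \<in> R\<rbrakk> \<Longrightarrow> lift c p l \<in> carrier A"
  unfolding lift_def by (auto intro!: finsum_closed simp: R_sub lift_coeff_R)

lemma lift_PM:
  assumes p: "p \<in> carrier (PM (j + k))" and c: "\<And>S. c S \<in> R" and cj: "\<And>S. card S \<noteq> j \<Longrightarrow> c S = \<zero>"
  shows "lift c p \<in> carrier (PM k)"
proof -
  have "lift c p l = \<zero>" if "l \<notin> G k" for l
  proof (cases "l \<in> enc ` Pow {1..n}")
    case True
    then obtain T where T: "T \<subseteq> {1..n}" "l = enc T" by auto
    then have k: "card T \<noteq> k" using that enc_G by simp
    have "p (enc S) \<otimes> lift_coeff c S T = \<zero>" if S: "S \<subseteq> {1..n}" for S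
    proof (cases "T \<subseteq> S \<and> card S = j + k")
      case True
      then have "card (S - T) \<noteq> j"
        using k finite_N[OF T(1)] finite_N[OF S] card_mono[of S T] by (simp add: card_Diff_subset)
      then show ?thesis using True S PM_closed[OF p] by (simp add: lift_coeff_def cj shuffle_coeff_R R_sub)
    next
      case False
      then show ?thesis using PM_zero[OF p S] PM_closed[OF p] R_sub[OF lift_coeff_R[OF S], of c T] c by (auto simp: lift_coeff_def)
    qed
    then show ?thesis unfolding T(2) lift_enc[OF T(1)] by (intro add.finprod_one_eqI) auto
  qed (simp add: lift_def)
  then show ?thesis using lift_closed PM_closed[OF p] c by (simp add: PM_iff)
qed

lemma lift_hom:
  assumes c: "\<And>S. c S \<in> R" and cj: "\<And>S. card S \<noteq> j \<Longrightarrow> c S = \<zero>"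
  shows "lift c \<in> left_module_hom A (PM (j + k)) (PM k)"
proof -
  have add: "lift c (\<lambda>l. p l \<oplus> q l) = (\<lambda>l. lift c p l \<oplus> lift c q l)"
    if p: "p \<in> carrier (PM m)" and q: "q \<in> carrier (PM m)" for p q m
  proof
    fix l
    note [simp] = PM_closed[OF p] PM_closed[OF q]
    show "lift c (\<lambda>l. p l \<oplus> q l) l = lift c p l \<oplus> lift c q l"
    proof (cases "l \<in> enc ` Pow {1..n}")
      case True
      then obtain T where T: "T \<subseteq> {1..n}" "l = enc T" by auto
      have "(\<Oplus>S\<in>Pow {1..n}. (p (enc S) \<oplus> q (enc S)) \<otimes> lift_coeff c S T) =
          (\<Oplus>S\<in>Pow {1..n}. p (enc S) \<otimes> lift_coeff c S T \<oplus> q (enc S) \<otimes> lift_coeff c S T)"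
        by (rule finsum_cong') (auto simp: R_sub lift_coeff_R c l_distr)
      also have "\<dots> = (\<Oplus>S\<in>Pow {1..n}. p (enc S) \<otimes> lift_coeff c S T) \<oplus> (\<Oplus>S\<in>Pow {1..n}. q (enc S) \<otimes> lift_coeff c S T)"
        by (rule finsum_addf) (auto simp: R_sub lift_coeff_R c)
      finally show ?thesis unfolding T(2) lift_enc[OF T(1)] .
    qed (simp add: lift_def)
  qed
  have smult: "lift c (\<lambda>l. a \<otimes> p l) = (\<lambda>l. a \<otimes> lift c p l)"
    if p: "p \<in> carrier (PM m)" and a: "a \<in> carrier A" for p a m
  proof
    fix l
    note [simp] = PM_closed[OF p] a
    show "lift c (\<lambda>l. a \<otimes> p l) l = a \<otimes> lift c p l"
    proof (cases "l \<in> enc ` Pow {1..n}")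
      case True
      then obtain T where T: "T \<subseteq> {1..n}" "l = enc T" by auto
      have "a \<otimes> (\<Oplus>S\<in>Pow {1..n}. p (enc S) \<otimes> lift_coeff c S T) = (\<Oplus>S\<in>Pow {1..n}. a \<otimes> (p (enc S) \<otimes> lift_coeff c S T))"
        by (rule finsum_rdistr) (auto simp: R_sub lift_coeff_R c)
      also have "\<dots> = (\<Oplus>S\<in>Pow {1..n}. a \<otimes> p (enc S) \<otimes> lift_coeff c S T)"
        by (rule finsum_cong') (auto simp: R_sub lift_coeff_R c m_assoc)
      finally show ?thesis unfolding T(2) lift_enc[OF T(1)] by simp
    qed (simp add: lift_def)
  qed
  show ?thesis unfolding left_module_hom_def
    using lift_PM[of _ j k c, OF _ c cj] add smult by (simp add: PM_add PM_smult)
qed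

text \<open>By \<open>lift_coeff_step\<close> an index i added to T on one side becomes an index
  removed from S on the other. What remains is to exchange the sums over i and S after writing S as
  \<open>insert i\<close> of a smaller set.\<close>

lemma lift_d:
  assumes p: "\<And>l. p l \<in> carrier A" and c: "\<And>S. c S \<in> R"
  shows "d (lift c p) = lift c (d p)"
proof
  fix l
  show "d (lift c p) l = lift c (d p) l"
  proof (cases "l \<in> enc ` Pow {1..n}")
    case True
    then obtain T where T: "T \<subseteq> {1..n}" "l = enc T" by auto
    note [simp] = p x_closed
    \<comment> \<open>The form that \<open>lift_coeff_step\<close> gives to the term for i and S. It
      is zero for i in T by definition, which lets the sum over i be extended to all of
      {1..n}.\<close>
    define L where "L i S = (if i \<in> S \<and> i \<notin> T then (koszul_coeff i (S - {i}) \<otimes> lift_coeff c (S - {i}) T) \<otimes> (p (enc S) \<otimes> x i) else \<zero>)" for i S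
    have kv: "i \<in> {1..n} \<Longrightarrow> koszul_coeff i S \<in> R" "lift_coeff c S T \<in> R" if "S \<subseteq> {1..n}" for i S T
      using that c by (auto intro!: koszul_coeff_R lift_coeff_R)
    have Lcl: "L i S \<in> carrier A" if "i \<in> {1..n}" "S \<subseteq> {1..n}" for i S
    proof -
      have "S - {i} \<subseteq> {1..n}" using that by auto
      then show ?thesis using kv[of "S - {i}"] kv[OF that(2)] that by (simp add: L_def R_sub)
    qed
    have "d (lift c p) l = (\<Oplus>i\<in>{1..n} - T. koszul_coeff i T \<otimes> (\<Oplus>S\<in>Pow {1..n}. p (enc S) \<otimes> lift_coeff c S (insert i T)) \<otimes> x i)"
      unfolding T(2) d_enc[OF T(1)]
      by (rule finsum_cong') (use T in \<open>auto simp: lift_enc kv R_sub\<close>)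
    also have "\<dots> = (\<Oplus>i\<in>{1..n} - T. \<Oplus>S\<in>Pow {1..n}. L i S)"
    proof (rule finsum_cong')
      fix i assume i: "i \<in> {1..n} - T"
      have k: "koszul_coeff i T \<in> R" using i T kv by simp
      have "koszul_coeff i T \<otimes> (\<Oplus>S\<in>Pow {1..n}. p (enc S) \<otimes> lift_coeff c S (insert i T)) \<otimes> x i =
         (\<Oplus>S\<in>Pow {1..n}. koszul_coeff i T \<otimes> (p (enc S) \<otimes> lift_coeff c S (insert i T))) \<otimes> x i"
        by (subst finsum_rdistr) (use i R_sub[OF k] kv in \<open>auto simp: R_sub\<close>)
      also have "\<dots> = (\<Oplus>S\<in>Pow {1..n}. koszul_coeff i T \<otimes> (p (enc S) \<otimes> lift_coeff c S (insert i T)) \<otimes> x i)"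
        by (rule finsum_ldistr) (use i R_sub[OF k] kv in \<open>auto simp: R_sub\<close>)
      also have "\<dots> = (\<Oplus>S\<in>Pow {1..n}. L i S)"
      proof (rule finsum_cong')
        fix S assume "S \<in> Pow {1..n}"
        then have S: "S \<subseteq> {1..n}" by simp
        have lift_coeff: "lift_coeff c S (insert i T) \<in> R" using S i kv by simp
        have "koszul_coeff i T \<otimes> (p (enc S) \<otimes> lift_coeff c S (insert i T)) \<otimes> x i =
            (koszul_coeff i T \<otimes> lift_coeff c S (insert i T)) \<otimes> (p (enc S) \<otimes> x i)"
          by (subst R_central[OF lift_coeff p, symmetric]) (use R_sub[OF lift_coeff] R_sub[OF k] i in \<open>simp add: m_assoc\<close>)
        also have "\<dots> = L i S"
          using lift_coeff_step[OF S T(1), of i c] i c by (simp add: L_def)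
        finally show "koszul_coeff i T \<otimes> (p (enc S) \<otimes> lift_coeff c S (insert i T)) \<otimes> x i = L i S" .
      qed (use Lcl i in auto)
      finally show "koszul_coeff i T \<otimes> (\<Oplus>S\<in>Pow {1..n}. p (enc S) \<otimes> lift_coeff c S (insert i T)) \<otimes> x i = (\<Oplus>S\<in>Pow {1..n}. L i S)" .
    qed (use Lcl in \<open>auto intro!: finsum_closed\<close>)
    also have "\<dots> = (\<Oplus>i\<in>{1..n}. \<Oplus>S\<in>Pow {1..n}. L i S)"
    proof (rule add.finprod_mono_neutral_cong_left)
      show "(\<Oplus>S\<in>Pow {1..n}. L i S) = \<zero>" if "i \<in> {1..n} - ({1..n} - T)" for i using that
        by (auto simp: L_def intro!: add.finprod_one_eqI)
    qed (use Lcl in \<open>auto intro!: finsum_closed\<close>)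
    also have "\<dots> = (\<Oplus>i\<in>{1..n}. \<Oplus>S\<in>{S \<in> Pow {1..n}. i \<notin> S}.
        (koszul_coeff i S \<otimes> lift_coeff c S T) \<otimes> (p (enc (insert i S)) \<otimes> x i))"
    proof (rule finsum_cong')
      fix i assume i: "i \<in> {1..n}"
      let ?g = "\<lambda>S. (koszul_coeff i S \<otimes> lift_coeff c S T) \<otimes> (p (enc (insert i S)) \<otimes> x i)"
      have gcl: "?g S \<in> carrier A" if "S \<in> {S \<in> Pow {1..n}. i \<notin> S}" for S
        using that i kv by (simp add: R_sub)
      have img: "insert i ` {S \<in> Pow {1..n}. i \<notin> S} = {S \<in> Pow {1..n}. i \<in> S}"
      proof (intro equalityI subsetI)
        fix S assume "S \<in> {S \<in> Pow {1..n}. i \<in> S}"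
        then have "S = insert i (S - {i})" "S - {i} \<in> {S \<in> Pow {1..n}. i \<notin> S}" by auto
        then show "S \<in> insert i ` {S \<in> Pow {1..n}. i \<notin> S}" by blast
      qed (use i in auto)
      have "(\<Oplus>S\<in>Pow {1..n}. L i S) = (\<Oplus>S\<in>insert i ` {S \<in> Pow {1..n}. i \<notin> S}. L i S)"
        unfolding img using Lcl[OF i]
        by (intro add.finprod_mono_neutral_cong_right) (auto simp: L_def)
      also have "\<dots> = (\<Oplus>S\<in>{S \<in> Pow {1..n}. i \<notin> S}. L i (insert i S))"
      proof (rule finsum_reindex)
        show "inj_on (insert i) {S \<in> Pow {1..n}. i \<notin> S}"
          by (rule inj_onI) (metis (lifting) Diff_insert_absorb mem_Collect_eq)
      qed (use Lcl[OF i] i in auto)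
      also have "\<dots> = (\<Oplus>S\<in>{S \<in> Pow {1..n}. i \<notin> S}. ?g S)"
      proof (rule finsum_cong')
        fix S assume S: "S \<in> {S \<in> Pow {1..n}. i \<notin> S}"
        then have e: "insert i S - {i} = S" by auto
        show "L i (insert i S) = ?g S"
        \<comment> \<open>For i in T the left side is zero by definition of \<open>L\<close>. The
          right side is zero too, because T cannot be contained in a set S that lacks i.\<close>
        proof (cases "i \<in> T")
          case True
          then have "\<not> T \<subseteq> S" using S by auto
          then show ?thesis using True S i kv by (simp add: L_def lift_coeff_def R_sub)
        next
          case False
          then show ?thesis by (simp add: L_def e)
        qed
      qed (use gcl in auto)
      finally show "(\<Oplus>S\<in>Pow {1..n}. L i S) = (\<Oplus>S\<in>{S \<in> Pow {1..n}. i \<notin> S}. ?g S)" .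
    qed (use kv in \<open>auto intro!: finsum_closed simp: R_sub\<close>)
    also have "\<dots> = (\<Oplus>i\<in>{1..n}. \<Oplus>S\<in>Pow {1..n}. if i \<in> S then \<zero> else
        (koszul_coeff i S \<otimes> lift_coeff c S T) \<otimes> (p (enc (insert i S)) \<otimes> x i))"
    proof (rule finsum_cong')
      fix i assume i: "i \<in> {1..n}"
      show "(\<Oplus>S\<in>{S \<in> Pow {1..n}. i \<notin> S}. (koszul_coeff i S \<otimes> lift_coeff c S T) \<otimes> (p (enc (insert i S)) \<otimes> x i)) =
        (\<Oplus>S\<in>Pow {1..n}. if i \<in> S then \<zero> else (koszul_coeff i S \<otimes> lift_coeff c S T) \<otimes> (p (enc (insert i S)) \<otimes> x i))"
        by (rule add.finprod_mono_neutral_cong_left) (use kv i in \<open>auto simp: R_sub\<close>)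
    qed (use kv in \<open>auto intro!: finsum_closed simp: R_sub\<close>)
    also have "\<dots> = (\<Oplus>S\<in>Pow {1..n}. \<Oplus>i\<in>{1..n}. if i \<in> S then \<zero> else
        (koszul_coeff i S \<otimes> lift_coeff c S T) \<otimes> (p (enc (insert i S)) \<otimes> x i))"
      by (rule finsum_swap) (use kv in \<open>auto simp: R_sub\<close>)
    also have "\<dots> = (\<Oplus>S\<in>Pow {1..n}. d p (enc S) \<otimes> lift_coeff c S T)"
    proof (rule finsum_cong')
      fix S assume "S \<in> Pow {1..n}"
      then have S: "S \<subseteq> {1..n}" by simp
      have "d p (enc S) \<otimes> lift_coeff c S T = (\<Oplus>i\<in>{1..n} - S. koszul_coeff i S \<otimes> p (enc (insert i S)) \<otimes> x i \<otimes> lift_coeff c S T)"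
        unfolding d_enc[OF S] by (rule finsum_ldistr) (use S kv[OF S] c in \<open>auto simp: R_sub lift_coeff_R\<close>)
      also have "\<dots> = (\<Oplus>i\<in>{1..n} - S. (koszul_coeff i S \<otimes> lift_coeff c S T) \<otimes> (p (enc (insert i S)) \<otimes> x i))"
      proof (rule finsum_cong')
        fix i assume i: "i \<in> {1..n} - S"
        then have kS: "koszul_coeff i S \<in> R" and vS: "lift_coeff c S T \<in> R" using kv[OF S] by auto
        show "koszul_coeff i S \<otimes> p (enc (insert i S)) \<otimes> x i \<otimes> lift_coeff c S T = (koszul_coeff i S \<otimes> lift_coeff c S T) \<otimes> (p (enc (insert i S)) \<otimes> x i)"
          using R_central[OF vS, of "p (enc (insert i S)) \<otimes> x i"] R_sub[OF kS] R_sub[OF vS] i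
          by (simp add: m_assoc)
      qed (use kv[OF S] in \<open>auto simp: R_sub\<close>)
      also have "\<dots> = (\<Oplus>i\<in>{1..n}. if i \<in> S then \<zero> else
        (koszul_coeff i S \<otimes> lift_coeff c S T) \<otimes> (p (enc (insert i S)) \<otimes> x i))"
        by (rule add.finprod_mono_neutral_cong_left) (use kv[OF S] in \<open>auto simp: R_sub\<close>)
      finally show "(\<Oplus>i\<in>{1..n}. if i \<in> S then \<zero> else
        (koszul_coeff i S \<otimes> lift_coeff c S T) \<otimes> (p (enc (insert i S)) \<otimes> x i)) = d p (enc S) \<otimes> lift_coeff c S T" by simp
    qed (use c d_closed in \<open>auto simp: R_sub lift_coeff_R\<close>)
    finally show ?thesis unfolding T(2) lift_enc[OF T(1)] .
  qed (simp add: d_def lift_def)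
qed

text \<open>The family is cut down to subsets of size j, as \<open>lift\<close> lowers degrees by
  exactly j only then; the cochain on P_j is the same.\<close>

lemma lift_exists:
  assumes c: "\<And>S. c S \<in> R"
  shows "cocycle_lift A M K j (cochain c j) (\<lambda>k. lift (\<lambda>S. if card S = j then c S else \<zero>))"
proof -
  let ?c = "\<lambda>S. if card S = j then c S else \<zero>"
  have c': "\<And>S. ?c S \<in> R" using c R_zero by simp
  have "\<pi> (lift ?c p (enc {})) = cochain c j p" if p: "p \<in> carrier (PM j)" for p
  proof -
    have "lift ?c p (enc {}) = (\<Oplus>S\<in>Sub j. p (enc S) \<otimes> c S)"
      unfolding lift_enc[OF empty_subsetI] using PM_closed[OF p] R_sub[OF c]
      by (intro add.finprod_mono_neutral_cong_right) (auto simp: lift_coeff_def)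
    then show ?thesis by (simp add: cochain_def)
  qed
  then show ?thesis unfolding cocycle_lift_def K_simps
    using lift_hom[of ?c j] c' lift_d[of _ ?c] PM_closed by simp
qed

text \<open>The coefficients of the product in the basis \<xi>_S. The second factor is the one that
  is lifted, so c' is evaluated on the complement of T; c is applied afterwards and receives
  T.\<close>

definition conv :: "(nat set \<Rightarrow> 'a) \<Rightarrow> (nat set \<Rightarrow> 'a) \<Rightarrow> nat set \<Rightarrow> 'a" where
  "conv c c' S = (if S \<subseteq> {1..n} then (\<Oplus>T\<in>Pow S. lift_coeff c' S T \<otimes> c T) else \<zero>)"

lemma conv_R: "\<lbrakk>\<And>S. c S \<in> R; \<And>S. c' S \<in> R\<rbrakk> \<Longrightarrow> conv c c' S \<in> R"
  by (auto simp: conv_def R_zero intro!: R_finsum R_mult lift_coeff_R)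

lemma cochain_finsum:
  assumes b: "\<And>i S. b i S \<in> R" and p: "p \<in> carrier (PM m)" and I: "finite I"
  shows "(\<Oplus>\<^bsub>M\<^esub>i\<in>I. cochain (b i) m p) = cochain (\<lambda>S. \<Oplus>i\<in>I. b i S) m p"
proof -
  interpret M: abelian_monoid M by (rule M_abelian_monoid)
  have cl: "cochain (b i) m p \<in> carrier M" for i
    using cochain_hom[of "b i" m] b p unfolding left_module_hom_def by auto
  show ?thesis using I
  proof (induction I rule: finite_induct)
    case empty
    have "(\<Oplus>S\<in>Sub m. p (enc S) \<otimes> \<zero>) = \<zero>"
      by (rule add.finprod_one_eqI) (simp add: PM_closed[OF p])
    then show ?case by (simp add: cochain_def M_zero)
  next
    case (insert i I)
    have "(\<Oplus>\<^bsub>M\<^esub>i\<in>insert i I. cochain (b i) m p) = cochain (b i) m p \<oplus>\<^bsub>M\<^esub> cochain (\<lambda>S. \<Oplus>i\<in>I. b i S) m p"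
      using insert cl by (simp add: Pi_def)
    also have "\<dots> = cochain (\<lambda>S. b i S \<oplus> (\<Oplus>i\<in>I. b i S)) m p"
      by (rule cochain_add) (use b p in \<open>auto intro!: R_finsum\<close>)
    also have "(\<lambda>S. b i S \<oplus> (\<Oplus>i\<in>I. b i S)) = (\<lambda>S. \<Oplus>i\<in>insert i I. b i S)"
      using insert b R_sub by (simp add: Pi_def)
    finally show ?case .
  qed
qed

text \<open>Representatives and lifts are arbitrary here. A homomorphism into \<open>M\<close> sees
  only the constant terms of the lifted element, and \<open>lift_leading\<close> has determined
  those for every lift.\<close>

lemma product_value:
  assumes c: "\<And>S. c S \<in> R" and c': "\<And>S. c' S \<in> R"
    and f: "\<And>i. i \<le> m \<Longrightarrow> f i \<in> \<Theta> c i" and g: "\<And>j. j \<le> m \<Longrightarrow> g j \<in> \<Theta> c' j"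
    and F: "\<And>j. j \<le> m \<Longrightarrow> cocycle_lift A M K j (g j) (F j)"
    and p: "p \<in> carrier (PM m)"
  shows "(\<Oplus>\<^bsub>M\<^esub>i\<in>{..m}. f i (F (m - i) i p)) = cochain (conv c c') m p"
proof -
  interpret M: abelian_monoid M by (rule M_abelian_monoid)
  \<comment> \<open>The part of \<open>conv\<close> that comes from the summand f i: only subsets T
    of size i are used.\<close>
  define b where "b i S = (if S \<subseteq> {1..n} then (\<Oplus>T\<in>Sub i. lift_coeff c' S T \<otimes> c T) else \<zero>)" for i S
  have b: "b i S \<in> R" for i S
    using c c' by (auto simp: b_def R_zero intro!: R_finsum R_mult lift_coeff_R)
  have bcl: "cochain (b i) m p \<in> carrier M" for i
    using cochain_hom[of "b i" m] b p unfolding left_module_hom_def by auto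
  have each: "f i (F (m - i) i p) = cochain (b i) m p" if i: "i \<le> m" for i
  proof (rule hom_expand)
    have hF: "F (m - i) i \<in> left_module_hom A (PM m) (PM i)"
      using F[of "m - i"] i unfolding cocycle_lift_def K_simps(4)
      by (metis diff_le_self le_add_diff_inverse2)
    have hf: "f i \<in> Hom i" using f[OF i] by (simp add: \<Theta>_def)
    show "(\<lambda>p. f i (F (m - i) i p)) \<in> Hom m"
      using hF hf unfolding left_module_hom_def by (auto simp: Pi_def)
    fix S assume S: "S \<in> Sub m"
    have eS: "e S \<in> carrier (PM m)" using e_PM S by simp
    have FS: "F (m - i) i (e S) \<in> carrier (PM i)" using hF eS unfolding left_module_hom_def by auto
    have "f i (F (m - i) i (e S)) = \<pi> (\<Oplus>T\<in>Sub i. F (m - i) i (e S) (enc T) \<otimes> c T)"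
      using f[OF i] FS by (simp add: \<Theta>_def cochain_def)
    also have "\<dots> = \<pi> (b i S)"
    proof -
      have lead: "\<epsilon> (F (m - i) i (e S) (enc T)) = lift_coeff c' S T" if "T \<in> Sub i" for T
        using lift_leading[of "m - i" "g (m - i)" "F (m - i)" c' S i T] F[of "m - i"] g[of "m - i"] c' S that i by simp
      have "\<epsilon> (\<Oplus>T\<in>Sub i. F (m - i) i (e S) (enc T) \<otimes> c T) = (\<Oplus>T\<in>Sub i. \<epsilon> (F (m - i) i (e S) (enc T) \<otimes> c T))"
        by (rule cf_finsum) (use PM_closed[OF FS] c R_sub in auto)
      also have "\<dots> = b i S"
        using S unfolding b_def
        by (simp, intro finsum_cong')
          (auto simp: \<epsilon>_mult PM_closed[OF FS] c c' R_sub lead cf_const lift_coeff_R)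
      finally show ?thesis
        using cochain_arg_closed[OF FS, of c] c b[of i S] by (simp add: \<pi>_eq_iff R_sub cf_const)
    qed
    finally show "f i (F (m - i) i (e S)) = \<pi> (b i S)" .
  qed (use b p in auto)
  have "(\<Oplus>\<^bsub>M\<^esub>i\<in>{..m}. f i (F (m - i) i p)) = (\<Oplus>\<^bsub>M\<^esub>i\<in>{..m}. cochain (b i) m p)"
    by (rule M.finsum_cong') (use each bcl in auto)
  also have "\<dots> = cochain (\<lambda>S. \<Oplus>i\<in>{..m}. b i S) m p" by (rule cochain_finsum) (use b p in auto)
  also have "\<dots> = cochain (conv c c') m p"
  proof -
    have "(\<Oplus>i\<in>{..m}. b i S) = conv c c' S" if S: "S \<in> Sub m" for S
    proof -
      have S': "S \<subseteq> {1..n}" "card S = m" using S by auto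
      let ?X = "\<lambda>i. {T \<in> Pow S. card T = i}"
      have vc: "lift_coeff c' S T \<otimes> c T \<in> carrier A" for T using lift_coeff_R[OF S'(1), of c' T] c c' by (simp add: R_sub)
      \<comment> \<open>Subsets T not contained in S contribute zero, and the sizes from 0 to m
        exhaust the subsets of S.\<close>
      have "(\<Oplus>i\<in>{..m}. b i S) = (\<Oplus>i\<in>{..m}. \<Oplus>T\<in>?X i. lift_coeff c' S T \<otimes> c T)"
      proof (rule finsum_cong')
        fix i
        show "b i S = (\<Oplus>T\<in>?X i. lift_coeff c' S T \<otimes> c T)"
          unfolding b_def using S' vc R_sub[OF c]
          by (simp, intro add.finprod_mono_neutral_cong_right) (auto simp: lift_coeff_def intro: finite_Sub)
      qed (use vc in \<open>auto intro!: finsum_closed\<close>)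
      also have "\<dots> = (\<Oplus>T\<in>(\<Union>i\<in>{..m}. ?X i). lift_coeff c' S T \<otimes> c T)"
        by (rule add.finprod_UN_disjoint[symmetric]) (use vc finite_N[OF S'(1)] in \<open>auto simp: pairwise_def disjnt_def\<close>)
      also have "(\<Union>i\<in>{..m}. ?X i) = Pow S"
        using S' finite_N[OF S'(1)] card_mono[of S] by auto
      finally show ?thesis using S' by (simp add: conv_def)
    qed
    then show ?thesis unfolding cochain_def
      by (intro arg_cong[where f = \<pi>] finsum_cong') (auto simp: PM_closed[OF p] R_sub conv_R c c')
  qed
  finally show ?thesis .
qed

text \<open>The product is the set of all cocycles obtained from some choice of representatives and
  lifts. One inclusion says that every choice gives the same value, the other that a choice
  exists.\<close>

lemma E_mult:
  assumes c: "\<And>S. c S \<in> R" and c': "\<And>S. c' S \<in> R"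
  shows "\<Theta> c \<otimes>\<^bsub>E\<^esub> \<Theta> c' = \<Theta> (conv c c')"
proof
  fix m
  have cl: "cochain (conv c c') m p \<in> carrier M" if "p \<in> carrier (PM m)" for p
    using cochain_hom[of "conv c c'" m] conv_R[of c c'] c c' that unfolding left_module_hom_def by auto
  have mult: "(\<Theta> c \<otimes>\<^bsub>E\<^esub> \<Theta> c') m = {h \<in> Hom m. \<exists>f g F.
      (\<forall>i\<le>m. f i \<in> \<Theta> c i) \<and> (\<forall>j\<le>m. g j \<in> \<Theta> c' j \<and> cocycle_lift A M K j (g j) (F j)) \<and>
      cohomologous A M K m (\<lambda>p. \<Oplus>\<^bsub>M\<^esub>i\<in>{..m}. f i (F (m - i) i p)) h}"
    by (simp add: yoneda_algebra_def cocycles)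
  have coh: "cohomologous A M K m (\<lambda>p. \<Oplus>\<^bsub>M\<^esub>i\<in>{..m}. f i (F (m - i) i p)) h \<longleftrightarrow>
      (\<forall>p\<in>carrier (PM m). h p = cochain (conv c c') m p)"
    if "\<forall>i\<le>m. f i \<in> \<Theta> c i" "\<forall>j\<le>m. g j \<in> \<Theta> c' j \<and> cocycle_lift A M K j (g j) (F j)" for f g F h
  proof -
    have val: "(\<Oplus>\<^bsub>M\<^esub>i\<in>{..m}. f i (F (m - i) i p)) = cochain (conv c c') m p" if "p \<in> carrier (PM m)" for p
      by (rule product_value[of c c' m f g F p]) (use c c' that \<open>\<forall>i\<le>m. f i \<in> \<Theta> c i\<close>
          \<open>\<forall>j\<le>m. g j \<in> \<Theta> c' j \<and> cocycle_lift A M K j (g j) (F j)\<close> in auto)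
    show ?thesis by (subst cohomologous_iff) (use val cl in auto)
  qed
  have ex: "(\<forall>i\<le>m. cochain c i \<in> \<Theta> c i) \<and> (\<forall>j\<le>m. cochain c' j \<in> \<Theta> c' j \<and>
      cocycle_lift A M K j (cochain c' j) (\<lambda>k. lift (\<lambda>S. if card S = j then c' S else \<zero>)))"
    using cochain_\<Theta>[of c] cochain_\<Theta>[of c'] c c' lift_exists[of c'] by simp
  show "(\<Theta> c \<otimes>\<^bsub>E\<^esub> \<Theta> c') m = \<Theta> (conv c c') m"
  proof (intro equalityI subsetI)
    fix h assume "h \<in> (\<Theta> c \<otimes>\<^bsub>E\<^esub> \<Theta> c') m"
    then show "h \<in> \<Theta> (conv c c') m" unfolding mult \<Theta>_def[of "conv c c'"] using coh by blast
  next
    fix h assume "h \<in> \<Theta> (conv c c') m"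
    then have h: "h \<in> Hom m" "\<forall>p\<in>carrier (PM m). h p = cochain (conv c c') m p"
      by (auto simp: \<Theta>_def[of "conv c c'"])
    let ?F = "\<lambda>j k. lift (\<lambda>S. if card S = j then c' S else \<zero>)"
    have "cohomologous A M K m (\<lambda>p. \<Oplus>\<^bsub>M\<^esub>i\<in>{..m}. cochain c i (?F (m - i) i p)) h"
      using coh[of "cochain c" "cochain c'" ?F h] ex h(2) by simp
    then show "h \<in> (\<Theta> c \<otimes>\<^bsub>E\<^esub> \<Theta> c') m"
      unfolding mult using h(1) ex
      by (intro CollectI conjI exI[of _ "cochain c"] exI[of _ "cochain c'"] exI[of _ ?F]) simp_all
  qed
qed


subsection \<open>Generation in degree one\<close>

text \<open>\<open>\<Theta> (single S r)\<close> is the multiple r \<xi>_S of a dual symbol.\<close>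

definition single :: "nat set \<Rightarrow> 'a \<Rightarrow> nat set \<Rightarrow> 'a" where
  "single S r = (\<lambda>T. if T = S then r else \<zero>)"

lemma single_R: "r \<in> R \<Longrightarrow> single S r T \<in> R"
  by (simp add: single_def R_zero)

lemma \<Theta>_single_zero: "\<lbrakk>card S \<noteq> m; r \<in> R\<rbrakk> \<Longrightarrow> \<Theta> (single S r) m = ext_zero A M K m"
  unfolding ext_zero_eq by (rule \<Theta>_cong) (auto simp: single_def R_zero)

lemma scalar_eq:
  assumes r: "r \<in> R"
  shows "(\<lambda>m. if m = 0 then ext_class A M K 0 (\<lambda>p. r \<odot>\<^bsub>M\<^esub> aug K p) else ext_zero A M K m) = \<Theta> (single {} r)"
proof
  fix m
  have Sub0: "Sub 0 = {{}}" using finite_N by auto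
  show "(if m = 0 then ext_class A M K 0 (\<lambda>p. r \<odot>\<^bsub>M\<^esub> aug K p) else ext_zero A M K m) = \<Theta> (single {} r) m"
  proof (cases "m = 0")
    case True
    have "r \<odot>\<^bsub>M\<^esub> aug K p = cochain (single {} r) 0 p" if p: "p \<in> carrier (PM 0)" for p
      unfolding cochain_def Sub0 using R_sub[OF r] PM_closed[OF p] R_central[OF r, of "p (enc {})"]
      by (simp add: K_simps M_smult single_def)
    then have "ext_class A M K 0 (\<lambda>p. r \<odot>\<^bsub>M\<^esub> aug K p) = \<Theta> (single {} r) 0"
      by (intro ext_class_eq single_R[OF r]) auto
    then show ?thesis using True by simp
  next
    case False
    then show ?thesis using \<Theta>_single_zero[of "{}" m r] r by simp
  qed
qed

lemma scalars_eq: "yoneda_scalars (A\<lparr>carrier := R\<rparr>) A (\<lambda>r. r) M K = (\<lambda>r. \<Theta> (single {} r)) ` R"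
  unfolding yoneda_scalars_def using scalar_eq by (simp cong: image_cong)

lemma E_one: "\<one>\<^bsub>E\<^esub> = \<Theta> (single {} \<one>)"
proof -
  have eq: "ext_class A M K 0 (aug K) = ext_class A M K 0 (\<lambda>p. \<one> \<odot>\<^bsub>M\<^esub> aug K p)"
  proof -
    have "\<one> \<odot>\<^bsub>M\<^esub> aug K p = cochain (single {} \<one>) 0 p" "aug K p = \<one> \<odot>\<^bsub>M\<^esub> aug K p" if p: "p \<in> carrier (PM 0)" for p
    proof -
      have Sub0: "Sub 0 = {{}}" using finite_N by auto
      show "\<one> \<odot>\<^bsub>M\<^esub> aug K p = cochain (single {} \<one>) 0 p"
        unfolding cochain_def Sub0 using PM_closed[OF p] by (simp add: K_simps M_smult single_def)
      show "aug K p = \<one> \<odot>\<^bsub>M\<^esub> aug K p" using PM_closed[OF p] by (simp add: K_simps M_smult)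
    qed
    then show ?thesis using ext_class_eq[of "single {} \<one>" 0] single_R[OF R_one] by metis
  qed
  have "\<one>\<^bsub>E\<^esub> = (\<lambda>m. if m = 0 then ext_class A M K 0 (\<lambda>p. \<one> \<odot>\<^bsub>M\<^esub> aug K p) else ext_zero A M K m)"
    by (subst eq[symmetric]) (simp add: yoneda_algebra_def)
  then show ?thesis using scalar_eq[OF R_one] by (rule trans)
qed

lemma single_component:
  assumes "r \<in> R" "i \<in> {1..n}" shows "\<Theta> (single {i} r) \<in> yoneda_component A M K 1"
proof -
  have "\<Theta> (single {i} r) \<in> carrier E" using single_R[OF assms(1)] by (auto simp: E_carrier)
  then show ?thesis unfolding yoneda_component_def using \<Theta>_single_zero[of "{i}" _ r] assms by auto
qed

text \<open>At a subset U only the summand T = S with complement {i} survives, so the product of a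
  multiple of \<xi>_S with \<xi>_i is again a multiple of a single dual symbol.\<close>

lemma single_product:
  assumes S: "insert i S \<subseteq> {1..n}" "i \<notin> S" and r: "r \<in> R"
  shows "\<Theta> (conv (single S r) (single {i} \<one>)) = \<Theta> (single (insert i S) (shuffle_coeff (insert i S) S \<otimes> r))"
proof
  fix m
  have wR: "shuffle_coeff (insert i S) S \<in> R" using S by (intro shuffle_coeff_R) auto
  show "\<Theta> (conv (single S r) (single {i} \<one>)) m = \<Theta> (single (insert i S) (shuffle_coeff (insert i S) S \<otimes> r)) m"
  proof (rule \<Theta>_cong)
    fix U assume "U \<in> Sub m"
    then have U: "U \<subseteq> {1..n}" by simp
    have z: "lift_coeff (single {i} \<one>) U T \<otimes> single S r T =
        (if S = T then (if U = insert i S then shuffle_coeff (insert i S) S \<otimes> r else \<zero>) else \<zero>)" if T: "T \<subseteq> U" for T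
    proof (cases "S = T")
      case True
      have "U - T = {i} \<longleftrightarrow> U = insert i S" using True T S(2) by auto
      moreover have "shuffle_coeff U T \<in> carrier A" by (rule R_sub[OF shuffle_coeff_R[OF U T]])
      ultimately show ?thesis using True T R_sub[OF r] by (auto simp: lift_coeff_def single_def)
    next
      case False
      then show ?thesis using R_sub[OF lift_coeff_R[OF U, of "single {i} \<one>" T]] single_R[OF R_one] by (simp add: single_def)
    qed
    have cl: "(if U = insert i S then shuffle_coeff (insert i S) S \<otimes> r else \<zero>) \<in> carrier A"
      using R_sub[OF wR] R_sub[OF r] by simp
    have "conv (single S r) (single {i} \<one>) U = (\<Oplus>T\<in>Pow U. lift_coeff (single {i} \<one>) U T \<otimes> single S r T)"
      using U by (simp add: conv_def)
    also have "\<dots> = (\<Oplus>T\<in>Pow U. if S = T then (if U = insert i S then shuffle_coeff (insert i S) S \<otimes> r else \<zero>) else \<zero>)"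
      by (rule finsum_cong') (use cl z in auto)
    also have "\<dots> = (if U = insert i S then shuffle_coeff (insert i S) S \<otimes> r else \<zero>)"
    proof (cases "S \<in> Pow U")
      case True
      show ?thesis
        by (rule add.finprod_singleton[OF True]) (use finite_N[OF U] cl in auto)
    next
      case False
      then have "U \<noteq> insert i S" by auto
      then show ?thesis by simp
    qed
    finally show "conv (single S r) (single {i} \<one>) U = single (insert i S) (shuffle_coeff (insert i S) S \<otimes> r) U"
      by (simp add: single_def)
  qed (use wR r in \<open>simp add: single_R R_mult\<close>)
qed

lemma koszul: "K_property 1 (A\<lparr>carrier := R\<rparr>) A (\<lambda>r. r) Ap"
proof -
  let ?H = "yoneda_scalars (A\<lparr>carrier := R\<rparr>) A (\<lambda>r. r) M K \<union> (\<Union>i\<in>{1..1}. yoneda_component A M K i)"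
  interpret E: abelian_group E by (rule E_abelian_group)
  have H: "?H \<subseteq> carrier E"
    using single_R unfolding scalars_eq yoneda_component_def by (auto simp: E_carrier)
  have mult: "u \<otimes>\<^bsub>E\<^esub> u' \<in> carrier E" if uu: "u \<in> carrier E" "u' \<in> carrier E" for u u'
  proof -
    obtain c c' where c: "u = \<Theta> c" "\<And>S. c S \<in> R" "u' = \<Theta> c'" "\<And>S. c' S \<in> R"
      using uu by (auto simp: E_carrier)
    have "u \<otimes>\<^bsub>E\<^esub> u' = \<Theta> (conv c c')" unfolding c(1,3) by (rule E_mult) (use c in auto)
    then show ?thesis using conv_R[of c c'] c(2,4) by (auto simp: E_carrier)
  qed
  have "generate_ring E ?H \<subseteq> carrier E"
  proof
    fix u assume "u \<in> generate_ring E ?H"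
    then show "u \<in> carrier E"
    proof (induction rule: generate_ring.induct)
      case one
      show ?case unfolding E_one E_carrier using single_R[OF R_one] by blast
    next
      case (incl h) then show ?case using H by blast
    qed (use mult in auto)
  qed
  moreover have "carrier E \<subseteq> generate_ring E ?H"
  proof
    fix u assume "u \<in> carrier E"
    then obtain c where c: "u = \<Theta> c" "\<And>S. c S \<in> R" by (auto simp: E_carrier)
    have scal: "\<Theta> (single {} r) \<in> generate_ring E ?H" if "r \<in> R" for r
      by (rule generate_ring.incl) (use that in \<open>auto simp: scalars_eq\<close>)
    \<comment> \<open>The coefficient r is kept arbitrary so that the induction hypothesis can be
      applied with a corrected coefficient.\<close>
    have sing: "\<Theta> (single S r) \<in> generate_ring E ?H" if "finite S" "S \<subseteq> {1..n}" "r \<in> R" for S r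
      using that
    proof (induction S arbitrary: r rule: finite_induct)
      case empty then show ?case using scal by simp
    next
      case (insert i S)
      then have i: "i \<in> {1..n}" by simp
      \<comment> \<open>The inverse of the shuffle coefficient goes into the first factor
        beforehand; the product then has coefficient exactly r.\<close>
      obtain s where s: "s \<in> R" "s \<otimes> shuffle_coeff (insert i S) S = \<one>" using shuffle_coeff_unit[of "insert i S" S] insert.prems by auto
      have wR: "shuffle_coeff (insert i S) S \<in> R" using insert.prems by (intro shuffle_coeff_R) auto
      have "\<Theta> (single {i} \<one>) \<in> generate_ring E ?H"
        using single_component[OF R_one i] by (intro generate_ring.incl) auto
      moreover have "\<Theta> (single S (s \<otimes> r)) \<in> generate_ring E ?H"
        using insert s R_mult by simp
      ultimately have "\<Theta> (single S (s \<otimes> r)) \<otimes>\<^bsub>E\<^esub> \<Theta> (single {i} \<one>) \<in> generate_ring E ?H"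
        by (intro generate_ring.eng_mult)
      also have "\<Theta> (single S (s \<otimes> r)) \<otimes>\<^bsub>E\<^esub> \<Theta> (single {i} \<one>) =
          \<Theta> (single (insert i S) (shuffle_coeff (insert i S) S \<otimes> (s \<otimes> r)))"
        using single_product[of i S "s \<otimes> r"] insert s R_mult
        by (simp add: E_mult single_R R_one)
      also have "shuffle_coeff (insert i S) S \<otimes> (s \<otimes> r) = r"
        using s R_comm[OF wR s(1)] R_sub[OF wR] R_sub[OF s(1)] R_sub[OF insert.prems(2)]
        by (simp add: m_assoc[symmetric])
      finally show ?case .
    qed
    \<comment> \<open>There are only finitely many subsets, so an arbitrary element is assembled
      from multiples of dual symbols one at a time.\<close>
    have "\<Theta> (\<lambda>S. if S \<in> J then c S else \<zero>) \<in> generate_ring E ?H" if "finite J" "J \<subseteq> Pow {1..n}" for J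
      using that
    proof (induction J rule: finite_induct)
      case empty
      have "single {} \<zero> = (\<lambda>_. \<zero>)" by (auto simp: single_def)
      then show ?case using scal[OF R_zero] by simp
    next
      case (insert S J)
      have "\<Theta> (single S (c S)) \<oplus>\<^bsub>E\<^esub> \<Theta> (\<lambda>S. if S \<in> J then c S else \<zero>) \<in> generate_ring E ?H"
        using insert finite_N[of S] c(2) sing[of S "c S"] by (intro generate_ring.eng_add) auto
      also have "\<Theta> (single S (c S)) \<oplus>\<^bsub>E\<^esub> \<Theta> (\<lambda>S. if S \<in> J then c S else \<zero>) =
          \<Theta> (\<lambda>T. single S (c S) T \<oplus> (if T \<in> J then c T else \<zero>))"
        by (rule E_add) (use c(2) in \<open>auto simp: single_R R_zero\<close>)
      also have "(\<lambda>T. single S (c S) T \<oplus> (if T \<in> J then c T else \<zero>)) =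
          (\<lambda>T. if T \<in> insert S J then c T else \<zero>)"
        using insert.hyps c(2) R_sub by (auto simp: single_def fun_eq_iff)
      finally show ?case .
    qed
    from this[of "Pow {1..n}"] have "\<Theta> (\<lambda>S. if S \<in> Pow {1..n} then c S else \<zero>) \<in> generate_ring E ?H" by simp
    moreover have "\<Theta> (\<lambda>S. if S \<in> Pow {1..n} then c S else \<zero>) = \<Theta> c"
      by (rule ext, rule \<Theta>_cong) (use c(2) in auto)
    ultimately show "u \<in> generate_ring E ?H" using c(1) by simp
  qed
  ultimately show ?thesis unfolding K_property_def Let_def using resolution by blast
qed

end

subsection \<open>Homomorphisms from quotients of free rings\<close>

definition word :: "'x list \<Rightarrow> 'x list \<Rightarrow> int" where
  "word w = (\<lambda>u. if u = w then 1 else 0)"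

lemma letter_eq_word: "letter a = word [a]"
  by (simp add: letter_def word_def)

lemma free_ring_carrier:
  "f \<in> carrier (free_ring L) \<longleftrightarrow> finite {w. f w \<noteq> 0} \<and> (\<forall>w. f w \<noteq> 0 \<longrightarrow> set w \<subseteq> L)"
  and free_ring_add: "f \<oplus>\<^bsub>free_ring L\<^esub> g = (\<lambda>w. f w + g w)"
  and free_ring_mult: "f \<otimes>\<^bsub>free_ring L\<^esub> g = (\<lambda>w. \<Sum>i\<le>length w. f (take i w) * g (drop i w))"
  and free_ring_zero: "\<zero>\<^bsub>free_ring L\<^esub> = (\<lambda>w. 0)"
  and free_ring_one: "\<one>\<^bsub>free_ring L\<^esub> = word []"
  by (simp_all add: free_ring_def word_def)

lemma word_closed: "set w \<subseteq> L \<Longrightarrow> word w \<in> carrier (free_ring L)"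
  by (auto simp: free_ring_carrier word_def)

lemma word_mult: "word u \<otimes>\<^bsub>free_ring L\<^esub> word v = word (u @ v)"
proof
  fix w :: "'a list"
  have "(\<Sum>i\<le>length w. word u (take i w) * word v (drop i w)) =
      (\<Sum>i\<le>length w. if i = length u then word (u @ v) w else 0)"
  proof (rule sum.cong[OF refl])
    fix i assume i: "i \<in> {..length w}"
    show "word u (take i w) * word v (drop i w) = (if i = length u then word (u @ v) w else 0)"
    proof (cases "i = length u")
      case True
      then show ?thesis using append_eq_conv_conj[of u v w] by (auto simp: word_def)
    next
      case False
      then have "take i w \<noteq> u" using i by auto
      then show ?thesis using False by (simp add: word_def)
    qed
  qed
  also have "\<dots> = word (u @ v) w"
    by (auto simp: word_def)
  finally show "(word u \<otimes>\<^bsub>free_ring L\<^esub> word v) w = word (u @ v) w"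
    by (simp add: free_ring_mult)
qed

lemma free_ring_mult_closed:
  assumes f: "f \<in> carrier (free_ring L)" and g: "g \<in> carrier (free_ring L)"
  shows "f \<otimes>\<^bsub>free_ring L\<^esub> g \<in> carrier (free_ring L)"
proof -
  have ex: "\<exists>u v. w = u @ v \<and> f u \<noteq> 0 \<and> g v \<noteq> 0" if "(f \<otimes>\<^bsub>free_ring L\<^esub> g) w \<noteq> 0" for w
  proof -
    obtain i where "f (take i w) * g (drop i w) \<noteq> 0"
      using \<open>(f \<otimes>\<^bsub>free_ring L\<^esub> g) w \<noteq> 0\<close> sum.not_neutral_contains_not_neutral
      unfolding free_ring_mult by blast
    then show ?thesis by (intro exI[of _ "take i w"] exI[of _ "drop i w"]) simp
  qed
  have "{w. (f \<otimes>\<^bsub>free_ring L\<^esub> g) w \<noteq> 0} \<subseteq> (\<lambda>(u, v). u @ v) ` ({w. f w \<noteq> 0} \<times> {w. g w \<noteq> 0})"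
    using ex by fastforce
  moreover have "finite ((\<lambda>(u, v). u @ v) ` ({w. f w \<noteq> 0} \<times> {w. g w \<noteq> 0}))"
    using f g by (simp add: free_ring_carrier)
  ultimately have "finite {w. (f \<otimes>\<^bsub>free_ring L\<^esub> g) w \<noteq> 0}" by (rule finite_subset)
  moreover have "set w \<subseteq> L" if "(f \<otimes>\<^bsub>free_ring L\<^esub> g) w \<noteq> 0" for w
  proof -
    obtain u v where "w = u @ v" "f u \<noteq> 0" "g v \<noteq> 0" using ex \<open>(f \<otimes>\<^bsub>free_ring L\<^esub> g) w \<noteq> 0\<close> by blast
    then show ?thesis using f g by (simp add: free_ring_carrier)
  qed
  ultimately show ?thesis by (simp add: free_ring_carrier)
qed

lemma free_ring_add_closed:
  assumes "f \<in> carrier (free_ring L)" "g \<in> carrier (free_ring L)"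
  shows "(\<lambda>w. f w + g w) \<in> carrier (free_ring L)"
proof -
  have "{w. f w + g w \<noteq> 0} \<subseteq> {w. f w \<noteq> 0} \<union> {w. g w \<noteq> 0}" by auto
  then have "finite {w. f w + g w \<noteq> 0}"
    by (rule finite_subset) (use assms in \<open>simp add: free_ring_carrier\<close>)
  moreover have "set w \<subseteq> L" if "f w + g w \<noteq> 0" for w
  proof -
    have "f w \<noteq> 0 \<or> g w \<noteq> 0" using that by auto
    then show ?thesis using assms unfolding free_ring_carrier by blast
  qed
  ultimately show ?thesis by (simp add: free_ring_carrier)
qed

text \<open>Both sides sum over the ways to cut w into three consecutive pieces. On the left k is
  the position of the second cut and j that of the first; the reindexing replaces k by the length l
  = k - j of the middle piece.\<close>

lemma free_ring_assoc:
  "(f \<otimes>\<^bsub>free_ring L\<^esub> g) \<otimes>\<^bsub>free_ring L\<^esub> h = f \<otimes>\<^bsub>free_ring L\<^esub> (g \<otimes>\<^bsub>free_ring L\<^esub> h)"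
proof
  fix w :: "'a list"
  let ?G = "\<lambda>j l. f (take j w) * (g (take l (drop j w)) * h (drop (j + l) w))"
  have "((f \<otimes>\<^bsub>free_ring L\<^esub> g) \<otimes>\<^bsub>free_ring L\<^esub> h) w =
      (\<Sum>k\<le>length w. \<Sum>j\<le>k. ?G j (k - j))"
    by (auto simp: free_ring_mult sum_distrib_right drop_take mult.assoc min_def intro!: sum.cong)
  also have "\<dots> = (\<Sum>(j, l)\<in>{(j, l). j + l \<le> length w}. ?G j l)"
    by (rule sum.triangle_reindex_eq[symmetric])
  also have "{(j, l). j + l \<le> length w} = Sigma {..length w} (\<lambda>j. {..length w - j})" by auto
  also have "(\<Sum>(j, l)\<in>Sigma {..length w} (\<lambda>j. {..length w - j}). ?G j l) =
      (\<Sum>j\<le>length w. \<Sum>l\<le>length w - j. ?G j l)"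
    by (rule sum.Sigma[symmetric]) auto
  also have "\<dots> = (f \<otimes>\<^bsub>free_ring L\<^esub> (g \<otimes>\<^bsub>free_ring L\<^esub> h)) w"
    by (simp add: free_ring_mult sum_distrib_left add.commute)
  finally show "((f \<otimes>\<^bsub>free_ring L\<^esub> g) \<otimes>\<^bsub>free_ring L\<^esub> h) w = (f \<otimes>\<^bsub>free_ring L\<^esub> (g \<otimes>\<^bsub>free_ring L\<^esub> h)) w" .
qed

lemma free_ring_one_mult: "word [] \<otimes>\<^bsub>free_ring L\<^esub> f = f" "f \<otimes>\<^bsub>free_ring L\<^esub> word [] = f"
proof -
  show "word [] \<otimes>\<^bsub>free_ring L\<^esub> f = f"
  proof
    fix w :: "'a list"
    have "(\<Sum>i\<le>length w. word [] (take i w) * f (drop i w)) = (\<Sum>i\<le>length w. if i = 0 then f w else 0)"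
      by (rule sum.cong) (auto simp: word_def)
    then show "(word [] \<otimes>\<^bsub>free_ring L\<^esub> f) w = f w" by (simp add: free_ring_mult)
  qed
  show "f \<otimes>\<^bsub>free_ring L\<^esub> word [] = f"
  proof
    fix w :: "'a list"
    have "(\<Sum>i\<le>length w. f (take i w) * word [] (drop i w)) = (\<Sum>i\<le>length w. if i = length w then f w else 0)"
      by (rule sum.cong) (auto simp: word_def)
    then show "(f \<otimes>\<^bsub>free_ring L\<^esub> word []) w = f w" by (simp add: free_ring_mult)
  qed
qed

lemma free_ring_ring: "ring (free_ring L)"
proof (rule ringI)
  show "abelian_group (free_ring L)"
  proof (rule abelian_groupI)
    fix f assume f: "f \<in> carrier (free_ring L)"
    then have "(\<lambda>w. - f w) \<in> carrier (free_ring L)" by (simp add: free_ring_carrier)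
    moreover have "(\<lambda>w. - f w) \<oplus>\<^bsub>free_ring L\<^esub> f = \<zero>\<^bsub>free_ring L\<^esub>"
      by (simp add: free_ring_add free_ring_zero)
    ultimately show "\<exists>g\<in>carrier (free_ring L). g \<oplus>\<^bsub>free_ring L\<^esub> f = \<zero>\<^bsub>free_ring L\<^esub>" by blast
  next
    show "\<zero>\<^bsub>free_ring L\<^esub> \<in> carrier (free_ring L)" by (simp add: free_ring_carrier free_ring_zero)
  qed (simp_all add: free_ring_add free_ring_zero free_ring_add_closed ac_simps)
  show "monoid (free_ring L)"
    by (rule monoidI)
      (auto simp: free_ring_mult_closed free_ring_assoc free_ring_one free_ring_one_mult word_closed)
qed (auto simp: free_ring_mult free_ring_add fun_eq_iff distrib_left distrib_right sum.distrib)

lemma free_ring_neg: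
  assumes "f \<in> carrier (free_ring L)" shows "\<ominus>\<^bsub>free_ring L\<^esub> f = (\<lambda>w. - f w)"
proof -
  interpret F: ring "free_ring L" by (rule free_ring_ring)
  show ?thesis
    by (rule F.minus_equality)
      (use assms in \<open>auto simp: free_ring_add free_ring_zero free_ring_carrier\<close>)
qed

text \<open>An induction principle for the free ring: H is the set of elements with the desired
  property, and words, addition and negation reach everything.\<close>

lemma free_ring_span:
  fixes H :: "('x list \<Rightarrow> int) set"
  assumes f: "finite {w. f w \<noteq> 0}" and words: "\<And>w. f w \<noteq> 0 \<Longrightarrow> word w \<in> H"
    and zero: "(\<lambda>w. 0) \<in> H" and add: "\<And>g h. \<lbrakk>g \<in> H; h \<in> H\<rbrakk> \<Longrightarrow> (\<lambda>w. g w + h w) \<in> H"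
    and neg: "\<And>g. g \<in> H \<Longrightarrow> (\<lambda>w. - g w) \<in> H"
  shows "f \<in> H"
proof -
  have mult: "(\<lambda>u. k * word w u) \<in> H" if "word w \<in> H" for w k
  proof (induction k rule: int_induct[where k = 0])
    case base then show ?case using zero by simp
  next
    case (step1 k) then show ?case using add[OF step1(2) that] by (simp add: algebra_simps)
  next
    case (step2 k) then show ?case using add[OF step2(2) neg[OF that]] by (simp add: algebra_simps)
  qed
  have "(\<lambda>u. if u \<in> S then f u else 0) \<in> H" if "finite S" "S \<subseteq> {w. f w \<noteq> 0}" for S
    using that
  proof (induction S rule: finite_induct)
    case empty then show ?case using zero by simp
  next
    case (insert w S)
    have "(\<lambda>u. f w * word w u + (if u \<in> S then f u else 0)) \<in> H"
      by (rule add) (use insert words mult in auto)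
    also have "(\<lambda>u. f w * word w u + (if u \<in> S then f u else 0)) = (\<lambda>u. if u \<in> insert w S then f u else 0)"
      using insert.hyps by (auto simp: word_def fun_eq_iff)
    finally show ?case .
  qed
  from this[OF f] have "(\<lambda>u. if u \<in> {w. f w \<noteq> 0} then f u else 0) \<in> H" by blast
  also have "(\<lambda>u. if u \<in> {w. f w \<noteq> 0} then f u else 0) = f" by auto
  finally show ?thesis .
qed

lemma free_ring_additive_eq:
  fixes S (structure)
  assumes S: "abelian_group S" and f: "f \<in> carrier (free_ring L)"
    and g: "\<And>f. f \<in> carrier (free_ring L) \<Longrightarrow> g f \<in> carrier S"
      "\<And>f f'. \<lbrakk>f \<in> carrier (free_ring L); f' \<in> carrier (free_ring L)\<rbrakk> \<Longrightarrow> g (\<lambda>w. f w + f' w) = g f \<oplus> g f'"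
    and h: "\<And>f. f \<in> carrier (free_ring L) \<Longrightarrow> h f \<in> carrier S"
      "\<And>f f'. \<lbrakk>f \<in> carrier (free_ring L); f' \<in> carrier (free_ring L)\<rbrakk> \<Longrightarrow> h (\<lambda>w. f w + f' w) = h f \<oplus> h f'"
    and words: "\<And>w. set w \<subseteq> L \<Longrightarrow> g (word w) = h (word w)"
  shows "g f = h f"
proof -
  interpret S: abelian_group S by (rule S)
  have zc: "(\<lambda>_. 0) \<in> carrier (free_ring L)" by (simp add: free_ring_carrier)
  have zero: "k (\<lambda>_. 0) = \<zero>"
    if "\<And>f. f \<in> carrier (free_ring L) \<Longrightarrow> k f \<in> carrier S"
      "\<And>f f'. \<lbrakk>f \<in> carrier (free_ring L); f' \<in> carrier (free_ring L)\<rbrakk> \<Longrightarrow> k (\<lambda>w. f w + f' w) = k f \<oplus> k f'" for k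
    using that(1)[OF zc] that(2)[OF zc zc] S.add.r_cancel_one' by simp
  have nc: "(\<lambda>w. - f w) \<in> carrier (free_ring L)" if "f \<in> carrier (free_ring L)" for f
    using that by (simp add: free_ring_carrier)
  have neg: "k (\<lambda>w. - f w) = \<ominus> k f"
    if k: "\<And>f. f \<in> carrier (free_ring L) \<Longrightarrow> k f \<in> carrier S"
      "\<And>f f'. \<lbrakk>f \<in> carrier (free_ring L); f' \<in> carrier (free_ring L)\<rbrakk> \<Longrightarrow> k (\<lambda>w. f w + f' w) = k f \<oplus> k f'"
      and f: "f \<in> carrier (free_ring L)" for k f
  proof -
    have "k (\<lambda>_. 0) = \<zero>" using zero[of k] k by blast
    then have "k (\<lambda>w. - f w) \<oplus> k f = \<zero>" using k(2)[OF nc[OF f] f] by simp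
    then show ?thesis using S.minus_equality[OF _ k(1)[OF f] k(1)[OF nc[OF f]]] by simp
  qed
  have zeros: "g (\<lambda>_. 0) = \<zero>" "h (\<lambda>_. 0) = \<zero>" using zero[of g] zero[of h] g h by blast+
  have negs: "g (\<lambda>w. - f w) = \<ominus> g f" "h (\<lambda>w. - f w) = \<ominus> h f" if "f \<in> carrier (free_ring L)" for f
    using neg[of g f] neg[of h f] g h that by blast+
  have "f \<in> {f \<in> carrier (free_ring L). g f = h f}"
  proof (rule free_ring_span)
    show "finite {w. f w \<noteq> 0}" using f by (simp add: free_ring_carrier)
    fix w assume "f w \<noteq> 0"
    then have "set w \<subseteq> L" using f by (simp add: free_ring_carrier)
    then show "word w \<in> {f \<in> carrier (free_ring L). g f = h f}" using words by (simp add: word_closed)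
  qed (simp_all add: zc zeros negs g(2) h(2) nc free_ring_add_closed)
  then show ?thesis by simp
qed

section \<open>Evaluation of integer combinations of words in a ring\<close>

definition word_eval :: "('b, 'm) ring_scheme \<Rightarrow> ('x \<Rightarrow> 'b) \<Rightarrow> 'x list \<Rightarrow> 'b" where
  "word_eval B \<phi> w = foldr (\<lambda>a b. \<phi> a \<otimes>\<^bsub>B\<^esub> b) w \<one>\<^bsub>B\<^esub>"

definition free_eval :: "('b, 'm) ring_scheme \<Rightarrow> ('x \<Rightarrow> 'b) \<Rightarrow> ('x list \<Rightarrow> int) \<Rightarrow> 'b" where
  "free_eval B \<phi> f = (\<Oplus>\<^bsub>B\<^esub>w\<in>{w. f w \<noteq> 0}. [f w] \<cdot>\<^bsub>B\<^esub> word_eval B \<phi> w)"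

context ring
begin

lemma word_eval_closed: "(\<And>a. a \<in> set w \<Longrightarrow> \<phi> a \<in> carrier R) \<Longrightarrow> word_eval R \<phi> w \<in> carrier R"
  unfolding word_eval_def by (rule foldr_mult_closed) auto

lemma word_eval_append:
  assumes "\<And>a. a \<in> set u \<union> set v \<Longrightarrow> \<phi> a \<in> carrier R"
  shows "word_eval R \<phi> (u @ v) = word_eval R \<phi> u \<otimes> word_eval R \<phi> v"
proof -
  have "word_eval R \<phi> v \<in> carrier R" by (rule word_eval_closed) (use assms in auto)
  then show ?thesis
    using foldr_mult_assoc[of u \<phi> \<one> "word_eval R \<phi> v"] assms by (simp add: word_eval_def)
qed

lemma int_pow_zero: "[(0 :: int)] \<cdot> a = \<zero>"
  by (simp add: add_pow_def)

lemma free_eval_superset: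
  assumes S: "finite S" "{w. f w \<noteq> 0} \<subseteq> S" and cl: "\<And>w. w \<in> S \<Longrightarrow> word_eval R \<phi> w \<in> carrier R"
  shows "free_eval R \<phi> f = (\<Oplus>w\<in>S. [f w] \<cdot> word_eval R \<phi> w)"
  unfolding free_eval_def
  by (rule add.finprod_mono_neutral_cong_left) (use S cl in \<open>auto simp: int_pow_zero\<close>)

context
  fixes L \<phi> assumes \<phi>: "\<And>a. a \<in> L \<Longrightarrow> \<phi> a \<in> carrier R"
begin

lemma eval_closed: "set w \<subseteq> L \<Longrightarrow> word_eval R \<phi> w \<in> carrier R"
  by (rule word_eval_closed) (use \<phi> in auto)

lemma free_eval_closed: "f \<in> carrier (free_ring L) \<Longrightarrow> free_eval R \<phi> f \<in> carrier R"
  unfolding free_eval_def by (rule finsum_closed) (auto simp: free_ring_carrier eval_closed)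

lemma free_eval_word: "set w \<subseteq> L \<Longrightarrow> free_eval R \<phi> (word w) = word_eval R \<phi> w"
  by (subst free_eval_superset[of "{w}"]) (auto simp: word_def eval_closed)

lemma free_eval_add:
  assumes f: "f \<in> carrier (free_ring L)" and g: "g \<in> carrier (free_ring L)"
  shows "free_eval R \<phi> (\<lambda>w. f w + g w) = free_eval R \<phi> f \<oplus> free_eval R \<phi> g"
proof -
  define S where "S = {w. f w \<noteq> 0} \<union> {w. g w \<noteq> 0}"
  have S: "finite S" "\<And>w. w \<in> S \<Longrightarrow> word_eval R \<phi> w \<in> carrier R"
    using f g by (auto simp: S_def free_ring_carrier eval_closed)
  have "free_eval R \<phi> (\<lambda>w. f w + g w) = (\<Oplus>w\<in>S. [(f w + g w)] \<cdot> word_eval R \<phi> w)"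
    by (rule free_eval_superset) (use S in \<open>auto simp: S_def\<close>)
  also have "\<dots> = (\<Oplus>w\<in>S. [f w] \<cdot> word_eval R \<phi> w \<oplus> [g w] \<cdot> word_eval R \<phi> w)"
    by (rule finsum_cong') (use S in \<open>auto simp: add.int_pow_mult\<close>)
  also have "\<dots> = (\<Oplus>w\<in>S. [f w] \<cdot> word_eval R \<phi> w) \<oplus> (\<Oplus>w\<in>S. [g w] \<cdot> word_eval R \<phi> w)"
    by (rule finsum_addf) (use S in auto)
  also have "(\<Oplus>w\<in>S. [f w] \<cdot> word_eval R \<phi> w) = free_eval R \<phi> f"
    by (rule free_eval_superset[symmetric]) (use S in \<open>auto simp: S_def\<close>)
  also have "(\<Oplus>w\<in>S. [g w] \<cdot> word_eval R \<phi> w) = free_eval R \<phi> g"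
    by (rule free_eval_superset[symmetric]) (use S in \<open>auto simp: S_def\<close>)
  finally show ?thesis .
qed

text \<open>Multiplicativity is an equation between maps additive in each factor, so it is reduced
  to words one factor at a time: a word is kept on the right while f varies, and this settles the
  words needed when g varies.\<close>

lemma free_eval_hom: "free_eval R \<phi> \<in> ring_hom (free_ring L) R"
proof -
  interpret F: ring "free_ring L" by (rule free_ring_ring)
  let ?\<psi> = "free_eval R \<phi>"
  note [simp] = free_eval_closed free_eval_add free_ring_mult_closed free_ring_add_closed word_closed
  have word_right: "?\<psi> (f \<otimes>\<^bsub>free_ring L\<^esub> word v) = ?\<psi> f \<otimes> ?\<psi> (word v)"
    if f: "f \<in> carrier (free_ring L)" and v: "set v \<subseteq> L" for f v
  proof (rule free_ring_additive_eq[OF is_abelian_group f])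
    fix f f' assume "f \<in> carrier (free_ring L)" "f' \<in> carrier (free_ring L)"
    then show "?\<psi> ((\<lambda>w. f w + f' w) \<otimes>\<^bsub>free_ring L\<^esub> word v) =
        ?\<psi> (f \<otimes>\<^bsub>free_ring L\<^esub> word v) \<oplus> ?\<psi> (f' \<otimes>\<^bsub>free_ring L\<^esub> word v)"
      using F.l_distr[of f f' "word v"] v by (simp add: free_ring_add)
  next
    fix u assume "set u \<subseteq> L"
    then show "?\<psi> (word u \<otimes>\<^bsub>free_ring L\<^esub> word v) = ?\<psi> (word u) \<otimes> ?\<psi> (word v)"
      using v \<phi> by (auto simp: word_mult free_eval_word intro!: word_eval_append)
  qed (use v in \<open>simp_all add: l_distr\<close>)
  have mult: "?\<psi> (f \<otimes>\<^bsub>free_ring L\<^esub> g) = ?\<psi> f \<otimes> ?\<psi> g"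
    if f: "f \<in> carrier (free_ring L)" and g: "g \<in> carrier (free_ring L)" for f g
  proof (rule free_ring_additive_eq[OF is_abelian_group g])
    fix g g' assume "g \<in> carrier (free_ring L)" "g' \<in> carrier (free_ring L)"
    then show "?\<psi> (f \<otimes>\<^bsub>free_ring L\<^esub> (\<lambda>w. g w + g' w)) =
        ?\<psi> (f \<otimes>\<^bsub>free_ring L\<^esub> g) \<oplus> ?\<psi> (f \<otimes>\<^bsub>free_ring L\<^esub> g')"
      using F.r_distr[of g g' f] f by (simp add: free_ring_add)
  qed (use f word_right in \<open>simp_all add: r_distr\<close>)
  show ?thesis
  proof (rule ring_hom_memI)
    show "?\<psi> \<one>\<^bsub>free_ring L\<^esub> = \<one>" by (simp add: free_ring_one free_eval_word word_eval_def)
  qed (use mult in \<open>auto simp: free_ring_add\<close>)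
qed

end
end

lemma (in ring_hom_ring) induced_hom:
  assumes J: "ideal J R" and ker: "\<And>a. a \<in> J \<Longrightarrow> h a = \<zero>\<^bsub>S\<^esub>"
  shows "\<exists>k. k \<in> ring_hom (R Quot J) S \<and> (\<forall>a\<in>carrier R. k (J +> a) = h a)"
proof -
  interpret J: ideal J R by (rule J)
  \<comment> \<open>On a coset of J the map h is constant, so its image is a singleton and
    \<open>the_elem\<close> extracts the value.\<close>
  let ?k = "\<lambda>X. the_elem (h ` X)"
  have k: "?k (J +> a) = h a" if a: "a \<in> carrier R" for a
  proof -
    have "h ` (J +> a) = {h a}"
    proof (intro equalityI subsetI)
      fix y assume "y \<in> h ` (J +> a)"
      then obtain i where "i \<in> J" "y = h (i \<oplus> a)" by (auto simp: a_r_coset_def')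
      then show "y \<in> {h a}" using a ker[of i] J.a_Hcarr by simp
    next
      fix y assume "y \<in> {h a}"
      then show "y \<in> h ` (J +> a)" using J.a_rcos_self[OF a] by blast
    qed
    then show ?thesis by simp
  qed
  have car: "carrier (R Quot J) = (\<lambda>a. J +> a) ` carrier R"
    by (auto simp: FactRing_def A_RCOSETS_def')
  have q: "(+>) J \<in> ring_hom R (R Quot J)" by (rule J.rcos_ring_hom)
  have "?k \<in> ring_hom (R Quot J) S"
  proof (rule ring_hom_memI)
    fix X Y assume "X \<in> carrier (R Quot J)" "Y \<in> carrier (R Quot J)"
    then obtain a b where ab: "a \<in> carrier R" "b \<in> carrier R" "X = J +> a" "Y = J +> b"
      by (auto simp: car)
    show "?k (X \<otimes>\<^bsub>R Quot J\<^esub> Y) = ?k X \<otimes>\<^bsub>S\<^esub> ?k Y"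
      unfolding ab(3,4) ring_hom_mult[OF q ab(1,2), symmetric] by (simp add: k ab)
    show "?k (X \<oplus>\<^bsub>R Quot J\<^esub> Y) = ?k X \<oplus>\<^bsub>S\<^esub> ?k Y"
      unfolding ab(3,4) ring_hom_add[OF q ab(1,2), symmetric] by (simp add: k ab)
  next
    show "?k \<one>\<^bsub>R Quot J\<^esub> = \<one>\<^bsub>S\<^esub>"
      using k[OF R.one_closed] ring_hom_one[OF q] by simp
  qed (auto simp: car k)
  then show ?thesis using k by blast
qed

lemma free_ring_finsum:
  assumes "\<And>k. k \<in> I \<Longrightarrow> f k \<in> carrier (free_ring L)"
  shows "finsum (free_ring L) f I w = (\<Sum>k\<in>I. f k w)"
proof -
  interpret F: ring "free_ring L" by (rule free_ring_ring)
  show ?thesis using assms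
  proof (induction I rule: infinite_finite_induct)
    case (insert i I)
    then show ?case by (subst F.finsum_insert) (auto simp: free_ring_add)
  qed (simp_all add: free_ring_zero)
qed

lemma (in ring) coset_eqI:
  assumes "ideal J R" "a \<in> carrier R" "b \<in> carrier R" "a \<ominus> b \<in> J"
  shows "J +> a = J +> b"
  using quotient_eq_iff_same_a_r_cos[OF assms(1-3)] assms(4) by simp

lemma tensor_relationsI:
  fixes B :: "('b, 'l) ring_scheme" and V :: "('b, 'v) bimodule"
  defines "F \<equiv> free_ring (tensor_letters B V)"
  shows "letter (Inl \<one>\<^bsub>B\<^esub>) \<ominus>\<^bsub>F\<^esub> \<one>\<^bsub>F\<^esub> \<in> tensor_relations B V"
    and "\<lbrakk>r \<in> carrier B; s \<in> carrier B\<rbrakk> \<Longrightarrow>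
      letter (Inl (r \<oplus>\<^bsub>B\<^esub> s)) \<ominus>\<^bsub>F\<^esub> (letter (Inl r) \<oplus>\<^bsub>F\<^esub> letter (Inl s)) \<in> tensor_relations B V"
    and "\<lbrakk>r \<in> carrier B; s \<in> carrier B\<rbrakk> \<Longrightarrow>
      letter (Inl (r \<otimes>\<^bsub>B\<^esub> s)) \<ominus>\<^bsub>F\<^esub> (letter (Inl r) \<otimes>\<^bsub>F\<^esub> letter (Inl s)) \<in> tensor_relations B V"
    and "\<lbrakk>u \<in> carrier V; u' \<in> carrier V\<rbrakk> \<Longrightarrow>
      letter (Inr (u \<oplus>\<^bsub>V\<^esub> u')) \<ominus>\<^bsub>F\<^esub> (letter (Inr u) \<oplus>\<^bsub>F\<^esub> letter (Inr u')) \<in> tensor_relations B V"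
    and "\<lbrakk>r \<in> carrier B; u \<in> carrier V\<rbrakk> \<Longrightarrow>
      letter (Inr (r \<odot>\<^bsub>V\<^esub> u)) \<ominus>\<^bsub>F\<^esub> (letter (Inl r) \<otimes>\<^bsub>F\<^esub> letter (Inr u)) \<in> tensor_relations B V"
    and "\<lbrakk>r \<in> carrier B; u \<in> carrier V\<rbrakk> \<Longrightarrow>
      letter (Inr (rsmult V u r)) \<ominus>\<^bsub>F\<^esub> (letter (Inr u) \<otimes>\<^bsub>F\<^esub> letter (Inl r)) \<in> tensor_relations B V"
  unfolding tensor_relations_def Let_def F_def by blast+

section \<open>Weights of words and homogeneous elements\<close>

definition wt :: "('x + 'y) list \<Rightarrow> nat" where
  "wt w = length (filter (\<lambda>a. \<not> isl a) w)"

lemma wt_simps [simp]: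
  "wt [] = 0" "wt (Inl r # w) = wt w" "wt (Inr v # w) = Suc (wt w)" "wt (u @ w) = wt u + wt w"
  by (simp_all add: wt_def)

definition homogeneous :: "nat \<Rightarrow> (('x + 'y) list \<Rightarrow> int) \<Rightarrow> bool" where
  "homogeneous k f \<longleftrightarrow> (\<forall>w. f w \<noteq> 0 \<longrightarrow> wt w = k)"

definition weight_part :: "(('x + 'y) list \<Rightarrow> int) \<Rightarrow> nat \<Rightarrow> ('x + 'y) list \<Rightarrow> int" where
  "weight_part f k = (\<lambda>w. if wt w = k then f w else 0)"

lemma homogeneous_weight_part: "homogeneous k (weight_part f k)"
  by (simp add: homogeneous_def weight_part_def)

lemma weight_part_closed: "f \<in> carrier (free_ring L) \<Longrightarrow> weight_part f k \<in> carrier (free_ring L)"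
proof -
  assume f: "f \<in> carrier (free_ring L)"
  have "{w. weight_part f k w \<noteq> 0} \<subseteq> {w. f w \<noteq> 0}" by (auto simp: weight_part_def)
  then have "finite {w. weight_part f k w \<noteq> 0}"
    by (rule finite_subset) (use f in \<open>simp add: free_ring_carrier\<close>)
  then show ?thesis using f by (auto simp: free_ring_carrier weight_part_def)
qed

lemma sum_weight_part:
  assumes f: "f \<in> carrier (free_ring L)"
  shows "finsum (free_ring L) (weight_part f) (wt ` {w. f w \<noteq> 0}) = f"
proof
  fix w
  have fin: "finite (wt ` {w. f w \<noteq> 0})" using f by (simp add: free_ring_carrier)
  have "finsum (free_ring L) (weight_part f) (wt ` {w. f w \<noteq> 0}) w =
      (\<Sum>k\<in>wt ` {w. f w \<noteq> 0}. weight_part f k w)"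
    by (rule free_ring_finsum) (rule weight_part_closed[OF f])
  also have "\<dots> = f w"
    using fin by (auto simp: weight_part_def sum.delta')
  finally show "finsum (free_ring L) (weight_part f) (wt ` {w. f w \<noteq> 0}) w = f w" .
qed

context quantum_affine
begin

subsection \<open>Presentation by generators and relations\<close>

abbreviation RR :: "('a, 'b) ring_scheme" where "RR \<equiv> A\<lparr>carrier := R\<rparr>"

text \<open>Taking the degree one part itself turns the map from the bimodule to \<open>A\<close>
  into an inclusion, with both actions given by multiplication in \<open>A\<close>.\<close>

definition V :: "('a, 'a) bimodule" where
  "V = \<lparr>carrier = D 1, monoid.mult = (\<otimes>), one = \<one>, ring.zero = \<zero>, add = (\<oplus>),
        smult = (\<otimes>), rsmult = (\<lambda>v r. v \<otimes> r)\<rparr>"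

lemma V_simps [simp]:
  "carrier V = D 1" "\<zero>\<^bsub>V\<^esub> = \<zero>" "add V = (\<oplus>)" "smult V = (\<otimes>)" "rsmult V = (\<lambda>v r. v \<otimes> r)"
  by (simp_all add: V_def)

lemma D_smult_right: "\<lbrakk>a \<in> D k; r \<in> R\<rbrakk> \<Longrightarrow> a \<otimes> r \<in> D k"
  using D_smult R_central D_closed by metis

lemma V_bimodule: "is_bimodule RR V"
proof -
  have "abelian_group V"
  proof (rule abelian_groupI)
    fix v assume "v \<in> carrier V"
    then show "\<exists>w\<in>carrier V. w \<oplus>\<^bsub>V\<^esub> v = \<zero>\<^bsub>V\<^esub>"
      by (auto intro!: bexI[of _ "\<ominus> v"] simp: D_neg l_neg D_closed)
  qed (auto simp: D_zero D_add D_closed a_ac)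
  moreover have "ring RR" using R_cring by (simp add: cring_def)
  ultimately show ?thesis unfolding is_bimodule_def
    by (simp add: D_smult D_smult_right D_closed R_sub l_distr r_distr m_assoc)
qed

lemma unit_exp_exponents: "i \<in> {1..n} \<Longrightarrow> unit_exp i \<in> exponents n"
  unfolding unit_exp_def by (rule exponents_incr[OF exponents_zero])

lemma inj_unit_exp: "inj unit_exp"
  by (rule injI) (metis fun_upd_apply nat.simps(3) unit_exp_def)

lemma mon_unit_exp: "i \<in> {1..n} \<Longrightarrow> mon (unit_exp i) = x i"
  unfolding unit_exp_def by (rule mon_single)

lemma deg_one:
  assumes \<alpha>: "\<alpha> \<in> exponents n" and deg: "deg \<alpha> = 1"
  shows "\<alpha> \<in> unit_exp ` {1..n}"
proof -
  obtain i where i: "i \<in> {1..n}" "\<alpha> i \<noteq> 0"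
    using deg sum.neutral[of "{1..n}" \<alpha>] unfolding deg_def by fastforce
  then have eq: "\<alpha> = incr (decr \<alpha> i) i" by auto
  then have "Suc (deg (decr \<alpha> i)) = 1" using deg_incr[OF i(1), of "decr \<alpha> i"] deg by simp
  then have "decr \<alpha> i = (\<lambda>_. 0)" using deg_zeroD[OF exponents_decr[OF \<alpha>]] by simp
  then have "\<alpha> = unit_exp i" using eq unfolding unit_exp_def by metis
  then show ?thesis using i by blast
qed

lemma D1_expand:
  assumes u: "u \<in> D 1"
  shows "u = (\<Oplus>i\<in>{1..n}. cf u (unit_exp i) \<otimes> x i)"
proof -
  have u': "u \<in> carrier A" using u by (rule D_closed)
  have "{\<alpha>. cf u \<alpha> \<noteq> \<zero>} \<subseteq> unit_exp ` {1..n}"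
    using u deg_one cf_outside[OF u'] unfolding D_def by blast
  then have "u = (\<Oplus>\<alpha>\<in>unit_exp ` {1..n}. cf u \<alpha> \<otimes> mon \<alpha>)"
    by (intro cf_expand u') auto
  also have "\<dots> = (\<Oplus>i\<in>{1..n}. cf u (unit_exp i) \<otimes> mon (unit_exp i))"
    by (rule finsum_reindex) (auto simp: cf_closed u' mon_closed intro: inj_on_subset[OF inj_unit_exp])
  also have "\<dots> = (\<Oplus>i\<in>{1..n}. cf u (unit_exp i) \<otimes> x i)"
    by (rule finsum_cong') (auto simp: mon_unit_exp cf_closed u' x_closed)
  finally show ?thesis .
qed

lemma V_finsum: "(\<And>i. i \<in> I \<Longrightarrow> f i \<in> D 1) \<Longrightarrow> finsum V f I = finsum A f I"
proof (induction I rule: infinite_finite_induct)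
  interpret V: abelian_group V using V_bimodule by (simp add: is_bimodule_def)
  {
    case (infinite I) then show ?case by simp
  next
    case empty then show ?case using V.finsum_empty by simp
  next
    case (insert i I)
    have "f \<in> I \<rightarrow> carrier A" "f i \<in> carrier A" using insert.prems D_closed by auto
    with insert show ?case by (subst V.finsum_insert) (auto simp: Pi_def)
  }
qed

text \<open>Coefficients have to be a function of the generator x_i and not of its index, so x must
  be injective on {1..n}. This can fail in the zero ring, where the claim is trivial and treated
  separately.\<close>

lemma V_fin_gen: "fin_gen_bimodule RR V"
proof -
  have "\<exists>c\<in>x ` {1..n} \<rightarrow> carrier RR. v = (\<Oplus>\<^bsub>V\<^esub>s\<in>x ` {1..n}. c s \<odot>\<^bsub>V\<^esub> s)" if v: "v \<in> carrier V" for v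
  proof (cases "\<one> = \<zero>")
    case True
    then have z: "a = \<zero>" if "a \<in> carrier A" for a using that by (metis l_null l_one)
    have "(\<Oplus>\<^bsub>V\<^esub>s\<in>x ` {1..n}. \<zero> \<odot>\<^bsub>V\<^esub> s) = (\<Oplus>s\<in>x ` {1..n}. \<zero> \<otimes> s)"
      by (subst V_finsum) (auto simp: D_x x_closed D_zero)
    also have "\<dots> \<in> carrier A" by (rule finsum_closed) (auto simp: x_closed)
    finally have "v = (\<Oplus>\<^bsub>V\<^esub>s\<in>x ` {1..n}. \<zero> \<odot>\<^bsub>V\<^esub> s)" using z v D_closed by (metis V_simps(1))
    then show ?thesis using R_zero by (intro bexI[of _ "\<lambda>_. \<zero>"]) auto
  next
    case False
    have inj: "inj_on x {1..n}"
    proof (rule inj_onI)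
      fix i j assume ij: "i \<in> {1..n}" "j \<in> {1..n}" "x i = x j"
      then have "cf (mon (unit_exp i)) (unit_exp i) = cf (mon (unit_exp j)) (unit_exp i)"
        by (simp add: mon_unit_exp)
      then have "unit_exp i = unit_exp j"
        using False ij by (simp add: cf_mon unit_exp_exponents split: if_splits)
      then show "i = j" using inj_unit_exp by (simp add: inj_eq)
    qed
    define c where "c s = cf v (unit_exp (the_inv_into {1..n} x s))" for s
    have v': "v \<in> D 1" "v \<in> carrier A" using v D_closed by auto
    have cx: "c (x i) = cf v (unit_exp i)" if "i \<in> {1..n}" for i
      by (simp add: c_def the_inv_into_f_f[OF inj that])
    have cR: "c s \<in> R" for s by (simp add: c_def cf_R v')
    have "(\<Oplus>\<^bsub>V\<^esub>s\<in>x ` {1..n}. c s \<odot>\<^bsub>V\<^esub> s) = (\<Oplus>s\<in>x ` {1..n}. c s \<otimes> s)"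
      by (subst V_finsum) (use cR D_x in \<open>auto intro!: D_smult\<close>)
    also have "\<dots> = (\<Oplus>i\<in>{1..n}. c (x i) \<otimes> x i)"
      by (rule finsum_reindex[OF _ inj]) (auto simp: x_closed R_sub cR)
    also have "\<dots> = (\<Oplus>i\<in>{1..n}. cf v (unit_exp i) \<otimes> x i)"
      by (rule finsum_cong') (auto simp: cx x_closed cf_closed v')
    also have "\<dots> = v" by (rule D1_expand[symmetric, OF v'(1)])
    finally have "v = (\<Oplus>\<^bsub>V\<^esub>s\<in>x ` {1..n}. c s \<odot>\<^bsub>V\<^esub> s)" by simp
    then show ?thesis using cR by (intro bexI[of _ c]) auto
  qed
  moreover have "x ` {1..n} \<subseteq> carrier V" using D_x by auto
  ultimately show ?thesis unfolding fin_gen_bimodule_def using V_bimodule by blast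
qed

section \<open>The tensor algebra of the degree one part and its map to \<open>A\<close>\<close>

abbreviation L :: "('a + 'a) set" where "L \<equiv> tensor_letters RR V"
abbreviation FF where "FF \<equiv> free_ring L"
abbreviation TI where "TI \<equiv> tensor_ideal RR V"
abbreviation T where "T \<equiv> tensor_algebra RR V"

lemma L_iff [simp]: "Inl r \<in> L \<longleftrightarrow> r \<in> R" "Inr u \<in> L \<longleftrightarrow> u \<in> D 1"
  by (auto simp: tensor_letters_def)

abbreviation \<phi> :: "'a + 'a \<Rightarrow> 'a" where "\<phi> \<equiv> case_sum (\<lambda>r. r) (\<lambda>v. v)"

lemma \<phi>_closed: "l \<in> L \<Longrightarrow> \<phi> l \<in> carrier A"
  by (cases l) (auto simp: R_sub D_closed)

abbreviation \<psi> where "\<psi> \<equiv> free_eval A \<phi>"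

lemma FF_ring: "ring FF" by (rule free_ring_ring)

lemma \<psi>_hom: "ring_hom_ring FF A \<psi>"
  using free_eval_hom[OF \<phi>_closed] FF_ring ring_axioms by (intro ring_hom_ringI2) auto

lemma word_cons: "word (l # ls) = letter l \<otimes>\<^bsub>free_ring L'\<^esub> word ls"
  by (simp add: letter_eq_word word_mult)

lemma letter_closed: "l \<in> L' \<Longrightarrow> letter l \<in> carrier (free_ring L')"
  by (simp add: letter_eq_word word_closed)

lemma \<psi>_letter: "l \<in> L \<Longrightarrow> \<psi> (letter l) = \<phi> l"
  by (simp add: letter_eq_word free_eval_word[OF \<phi>_closed] word_eval_def \<phi>_closed)

lemma relations_closed: "tensor_relations RR V \<subseteq> carrier FF"
proof -
  interpret F: ring FF by (rule FF_ring)
  show ?thesis unfolding tensor_relations_def Let_def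
    by (auto intro!: F.minus_closed F.a_closed F.m_closed letter_closed
        simp: R_one R_add R_mult D_add D_smult D_smult_right)
qed

lemma relations_zero: "\<rho> \<in> tensor_relations RR V \<Longrightarrow> \<psi> \<rho> = \<zero>"
proof -
  assume \<rho>: "\<rho> \<in> tensor_relations RR V"
  interpret \<psi>: ring_hom_ring FF A \<psi> by (rule \<psi>_hom)
  have minus: "\<psi> (a \<ominus>\<^bsub>FF\<^esub> b) = \<psi> a \<ominus> \<psi> b" if "a \<in> carrier FF" "b \<in> carrier FF" for a b
    using that by (simp add: a_minus_def)
  show ?thesis using \<rho> unfolding tensor_relations_def Let_def
    by (auto simp: minus letter_closed \<psi>_letter R_one R_add R_mult R_sub D_add D_smult D_smult_right D_closed
        r_right_minus_eq)
qed

lemma TI_ideal: "ideal TI FF"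
proof -
  interpret F: ring FF by (rule FF_ring)
  show ?thesis unfolding tensor_ideal_def by (rule F.genideal_ideal[OF relations_closed])
qed

lemma TI_zero: "f \<in> TI \<Longrightarrow> \<psi> f = \<zero>"
proof -
  assume f: "f \<in> TI"
  interpret \<psi>: ring_hom_ring FF A \<psi> by (rule \<psi>_hom)
  have "tensor_relations RR V \<subseteq> a_kernel FF A \<psi>"
    using relations_closed relations_zero unfolding a_kernel_def' by blast
  then have "TI \<subseteq> a_kernel FF A \<psi>"
    unfolding tensor_ideal_def by (rule \<psi>.R.genideal_minimal[OF \<psi>.kernel_is_ideal])
  then show ?thesis using f unfolding a_kernel_def' by blast
qed

lemma T_ring: "ring T"
  unfolding tensor_algebra_def by (rule ideal.quotient_is_ring[OF TI_ideal])

definition cls where "cls f = TI +>\<^bsub>FF\<^esub> f"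

lemma cls_hom: "ring_hom_ring FF T cls"
  using ideal.rcos_ring_hom[OF TI_ideal] FF_ring T_ring
  by (intro ring_hom_ringI2) (auto simp: tensor_algebra_def cls_def[abs_def])

lemma T_carrier: "carrier T = cls ` carrier FF"
  by (auto simp: tensor_algebra_def FactRing_def A_RCOSETS_def' cls_def)

lemma tensor_base_eq: "tensor_base RR V r = cls (letter (Inl r))"
  by (simp add: tensor_base_def cls_def)

lemma tensor_power_eq: "tensor_power RR V k = {cls f | f. f \<in> carrier FF \<and> homogeneous k f}"
  by (auto simp: tensor_power_def cls_def homogeneous_def wt_def)

lemma cls_eqI: "\<lbrakk>a \<in> carrier FF; b \<in> carrier FF; a \<ominus>\<^bsub>FF\<^esub> b \<in> tensor_relations RR V\<rbrakk> \<Longrightarrow> cls a = cls b"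
proof -
  assume ab: "a \<in> carrier FF" "b \<in> carrier FF" "a \<ominus>\<^bsub>FF\<^esub> b \<in> tensor_relations RR V"
  interpret F: ring FF by (rule FF_ring)
  have "a \<ominus>\<^bsub>FF\<^esub> b \<in> TI"
    using F.genideal_self[OF relations_closed] ab(3) unfolding tensor_ideal_def by blast
  then show ?thesis unfolding cls_def by (rule F.coset_eqI[OF TI_ideal ab(1,2)])
qed

abbreviation t\<beta> where "t\<beta> r \<equiv> cls (letter (Inl r))"
abbreviation t\<nu> where "t\<nu> u \<equiv> cls (letter (Inr u))"

lemma cls_letter_closed: "r \<in> R \<Longrightarrow> t\<beta> r \<in> carrier T" "u \<in> D 1 \<Longrightarrow> t\<nu> u \<in> carrier T"
  by (auto simp: T_carrier letter_closed)

lemma t_relations: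
  shows "t\<beta> \<one> = \<one>\<^bsub>T\<^esub>"
    and "\<lbrakk>r \<in> R; s \<in> R\<rbrakk> \<Longrightarrow> t\<beta> (r \<oplus> s) = t\<beta> r \<oplus>\<^bsub>T\<^esub> t\<beta> s"
    and "\<lbrakk>r \<in> R; s \<in> R\<rbrakk> \<Longrightarrow> t\<beta> (r \<otimes> s) = t\<beta> r \<otimes>\<^bsub>T\<^esub> t\<beta> s"
    and "\<lbrakk>u \<in> D 1; u' \<in> D 1\<rbrakk> \<Longrightarrow> t\<nu> (u \<oplus> u') = t\<nu> u \<oplus>\<^bsub>T\<^esub> t\<nu> u'"
    and "\<lbrakk>r \<in> R; u \<in> D 1\<rbrakk> \<Longrightarrow> t\<nu> (r \<otimes> u) = t\<beta> r \<otimes>\<^bsub>T\<^esub> t\<nu> u"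
    and "\<lbrakk>r \<in> R; u \<in> D 1\<rbrakk> \<Longrightarrow> t\<nu> (u \<otimes> r) = t\<nu> u \<otimes>\<^bsub>T\<^esub> t\<beta> r"
proof -
  interpret F: ring FF by (rule FF_ring)
  interpret cls: ring_hom_ring FF T cls by (rule cls_hom)
  note lc = letter_closed[of "Inl _" L] letter_closed[of "Inr _" L]
  have add: "cls c = cls a \<oplus>\<^bsub>T\<^esub> cls b"
    if "a \<in> carrier FF" "b \<in> carrier FF" "c \<in> carrier FF" "c \<ominus>\<^bsub>FF\<^esub> (a \<oplus>\<^bsub>FF\<^esub> b) \<in> tensor_relations RR V" for a b c
    using cls_eqI[of c "a \<oplus>\<^bsub>FF\<^esub> b"] that by simp
  have mult: "cls c = cls a \<otimes>\<^bsub>T\<^esub> cls b"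
    if "a \<in> carrier FF" "b \<in> carrier FF" "c \<in> carrier FF" "c \<ominus>\<^bsub>FF\<^esub> (a \<otimes>\<^bsub>FF\<^esub> b) \<in> tensor_relations RR V" for a b c
    using cls_eqI[of c "a \<otimes>\<^bsub>FF\<^esub> b"] that by simp
  show "t\<beta> \<one> = \<one>\<^bsub>T\<^esub>"
    unfolding cls.hom_one[symmetric]
    using tensor_relationsI(1)[of RR V] by (intro cls_eqI) (auto simp: lc R_one)
  show "\<lbrakk>r \<in> R; s \<in> R\<rbrakk> \<Longrightarrow> t\<beta> (r \<oplus> s) = t\<beta> r \<oplus>\<^bsub>T\<^esub> t\<beta> s"
    using tensor_relationsI(2)[where B = RR and V = V] by (intro add) (auto simp: lc R_add)
  show "\<lbrakk>r \<in> R; s \<in> R\<rbrakk> \<Longrightarrow> t\<beta> (r \<otimes> s) = t\<beta> r \<otimes>\<^bsub>T\<^esub> t\<beta> s"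
    using tensor_relationsI(3)[where B = RR and V = V] by (intro mult) (auto simp: lc R_mult)
  show "\<lbrakk>u \<in> D 1; u' \<in> D 1\<rbrakk> \<Longrightarrow> t\<nu> (u \<oplus> u') = t\<nu> u \<oplus>\<^bsub>T\<^esub> t\<nu> u'"
    using tensor_relationsI(4)[where B = RR and V = V] by (intro add) (auto simp: lc D_add)
  show "\<lbrakk>r \<in> R; u \<in> D 1\<rbrakk> \<Longrightarrow> t\<nu> (r \<otimes> u) = t\<beta> r \<otimes>\<^bsub>T\<^esub> t\<nu> u"
    using tensor_relationsI(5)[where B = RR and V = V] by (intro mult) (auto simp: lc D_smult)
  show "\<lbrakk>r \<in> R; u \<in> D 1\<rbrakk> \<Longrightarrow> t\<nu> (u \<otimes> r) = t\<nu> u \<otimes>\<^bsub>T\<^esub> t\<beta> r"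
    using tensor_relationsI(6)[where B = RR and V = V] by (intro mult) (auto simp: lc D_smult_right)
qed

lemma t\<nu>_zero: "t\<nu> \<zero> = \<zero>\<^bsub>T\<^esub>" and t\<beta>_zero: "t\<beta> \<zero> = \<zero>\<^bsub>T\<^esub>"
proof -
  interpret T: ring T by (rule T_ring)
  have double: "a = \<zero>\<^bsub>T\<^esub>" if "a \<in> carrier T" "a = a \<oplus>\<^bsub>T\<^esub> a" for a
    using that by (metis T.add.r_cancel_one')
  show "t\<nu> \<zero> = \<zero>\<^bsub>T\<^esub>"
    by (rule double) (use t_relations(4)[OF D_zero D_zero] in \<open>auto simp: cls_letter_closed D_zero\<close>)
  show "t\<beta> \<zero> = \<zero>\<^bsub>T\<^esub>"
    by (rule double) (use t_relations(2)[OF R_zero R_zero] in \<open>auto simp: cls_letter_closed R_zero\<close>)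
qed

lemma t\<nu>_finsum: "(\<And>i. i \<in> I \<Longrightarrow> f i \<in> D 1) \<Longrightarrow> t\<nu> (finsum A f I) = (\<Oplus>\<^bsub>T\<^esub>i\<in>I. t\<nu> (f i))"
proof (induction I rule: infinite_finite_induct)
  interpret T: ring T by (rule T_ring)
  {
    case (infinite I) then show ?case by (simp add: t\<nu>_zero)
  next
    case empty then show ?case by (simp add: t\<nu>_zero)
  next
    case (insert i I)
    have "finsum A f I \<in> D 1" by (rule D_finsum) (use insert in auto)
    moreover have "finsum A f (insert i I) = f i \<oplus> finsum A f I"
      using insert by (intro finsum_insert) (auto intro: D_closed)
    ultimately show ?case using insert
      by (subst T.finsum_insert) (auto simp: t_relations(4) cls_letter_closed)
  }
qed


definition \<Phi> :: "(('a + 'a) list \<Rightarrow> int) set \<Rightarrow> 'a" where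
  "\<Phi> = (SOME k. k \<in> ring_hom T A \<and> (\<forall>f\<in>carrier FF. k (cls f) = \<psi> f))"

lemma \<Phi>_hom: "\<Phi> \<in> ring_hom T A" and \<Phi>_cls: "f \<in> carrier FF \<Longrightarrow> \<Phi> (cls f) = \<psi> f"
proof -
  interpret \<psi>: ring_hom_ring FF A \<psi> by (rule \<psi>_hom)
  have "\<exists>k. k \<in> ring_hom T A \<and> (\<forall>f\<in>carrier FF. k (cls f) = \<psi> f)"
    using \<psi>.induced_hom[OF TI_ideal TI_zero] unfolding tensor_algebra_def cls_def .
  from someI_ex[OF this] show "\<Phi> \<in> ring_hom T A" "f \<in> carrier FF \<Longrightarrow> \<Phi> (cls f) = \<psi> f"
    unfolding \<Phi>_def by blast+
qed

lemma \<Phi>_ring_hom: "ring_hom_ring T A \<Phi>"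
  using T_ring ring_axioms \<Phi>_hom by (rule ring_hom_ringI2)

section \<open>The quadratic relations and the quotient by them\<close>

definition rel :: "nat \<Rightarrow> nat \<Rightarrow> (('a + 'a) list \<Rightarrow> int) set" where
  "rel i j = t\<nu> (x j) \<otimes>\<^bsub>T\<^esub> t\<nu> (x i) \<ominus>\<^bsub>T\<^esub> t\<beta> (Q j i) \<otimes>\<^bsub>T\<^esub> (t\<nu> (x i) \<otimes>\<^bsub>T\<^esub> t\<nu> (x j))"

definition rels :: "(('a + 'a) list \<Rightarrow> int) set set" where
  "rels = (\<lambda>(i, j). rel i j) ` {(i, j). i \<in> {1..n} \<and> j \<in> {1..n} \<and> i < j}"

definition J where "J = Idl\<^bsub>T\<^esub> rels"

abbreviation I where "I \<equiv> a_kernel T A \<Phi>"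

lemma I_iff: "t \<in> I \<longleftrightarrow> t \<in> carrier T \<and> \<Phi> t = \<zero>"
  by (simp add: a_kernel_def')

lemma I_ideal: "ideal I T"
  by (rule ring_hom_ring.kernel_is_ideal[OF \<Phi>_ring_hom])

lemma finite_rels: "finite rels"
  unfolding rels_def
  by (rule finite_imageI, rule finite_subset[of _ "{1..n} \<times> {1..n}"]) auto

lemma \<Phi>_letter: "r \<in> R \<Longrightarrow> \<Phi> (t\<beta> r) = r" "u \<in> D 1 \<Longrightarrow> \<Phi> (t\<nu> u) = u"
  by (simp_all add: \<Phi>_cls letter_closed \<psi>_letter)

lemma rels_I: "rels \<subseteq> I"
proof
  fix t assume "t \<in> rels"
  then obtain i j where ij: "i \<in> {1..n}" "j \<in> {1..n}" "i < j" "t = rel i j" by (auto simp: rels_def)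
  interpret \<Phi>: ring_hom_ring T A \<Phi> by (rule \<Phi>_ring_hom)
  have q: "Q j i \<in> R" by (rule Q_R[OF ij(1-3)])
  have cl: "t\<nu> (x i) \<in> carrier T" "t\<nu> (x j) \<in> carrier T" "t\<beta> (Q j i) \<in> carrier T"
    using cls_letter_closed D_x ij q by auto
  have "\<Phi> t = x j \<otimes> x i \<ominus> Q j i \<otimes> (x i \<otimes> x j)"
    unfolding ij(4) rel_def using cl D_x ij q by (simp add: a_minus_def \<Phi>_letter)
  also have "\<dots> = \<zero>" using x_swap[OF ij(1-3)] x_closed ij R_sub[OF q] by (simp add: r_right_minus_eq)
  finally show "t \<in> I" unfolding I_iff ij(4) rel_def using cl by simp
qed

lemma rels_closed: "rels \<subseteq> carrier T"
  using rels_I I_iff by blast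

lemma J_ideal: "ideal J T"
  unfolding J_def by (rule ring.genideal_ideal[OF T_ring rels_closed])

lemma J_I: "J \<subseteq> I"
  unfolding J_def by (rule ring.genideal_minimal[OF T_ring I_ideal rels_I])

abbreviation B where "B \<equiv> T Quot J"

definition \<gamma> where "\<gamma> t = J +>\<^bsub>T\<^esub> t"

lemma B_ring: "ring B" by (rule ideal.quotient_is_ring[OF J_ideal])

lemma \<gamma>_hom: "ring_hom_ring T B \<gamma>"
  using ideal.rcos_ring_hom[OF J_ideal] T_ring B_ring
  by (intro ring_hom_ringI2) (auto simp: \<gamma>_def[abs_def])

definition b\<beta> where "b\<beta> r = \<gamma> (t\<beta> r)"
definition bx where "bx i = \<gamma> (t\<nu> (x i))"

lemma b\<beta>_hom: "ring_hom_ring RR B b\<beta>"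
proof (rule ring_hom_ringI2)
  interpret \<gamma>: ring_hom_ring T B \<gamma> by (rule \<gamma>_hom)
  show "ring RR" using R_cring by (simp add: cring_def)
  show "b\<beta> \<in> ring_hom RR B"
    by (rule ring_hom_memI) (auto simp: b\<beta>_def t_relations cls_letter_closed)
qed (rule B_ring)

text \<open>Centrality of the scalars holds in the tensor algebra already, by the two bimodule
  relations and centrality in \<open>A\<close>; the swap rule is what dividing by \<open>J\<close>
  adds. Independence of the monomials is not part of the claim, so straightening is available before
  the quotient is identified with \<open>A\<close>.\<close>

lemma B_vars: "quantum_vars RR B b\<beta> n Q bx"
proof -
  interpret \<gamma>: ring_hom_ring T B \<gamma> by (rule \<gamma>_hom)
  have central: "b\<beta> r \<otimes>\<^bsub>B\<^esub> bx i = bx i \<otimes>\<^bsub>B\<^esub> b\<beta> r" if "i \<in> {1..n}" "r \<in> R" for i r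
  proof -
    have "t\<beta> r \<otimes>\<^bsub>T\<^esub> t\<nu> (x i) = t\<nu> (x i) \<otimes>\<^bsub>T\<^esub> t\<beta> r"
      using t_relations(5,6)[OF that(2) D_x[OF that(1)]] x_central[OF that] by simp
    then show ?thesis using that D_x cls_letter_closed
      by (simp add: b\<beta>_def bx_def flip: \<gamma>.hom_mult)
  qed
  have swap: "bx j \<otimes>\<^bsub>B\<^esub> bx i = b\<beta> (Q j i) \<otimes>\<^bsub>B\<^esub> (bx i \<otimes>\<^bsub>B\<^esub> bx j)"
    if ij: "i \<in> {1..n}" "j \<in> {1..n}" "i < j" for i j
  proof -
    have cl: "t\<nu> (x i) \<in> carrier T" "t\<nu> (x j) \<in> carrier T" "t\<beta> (Q j i) \<in> carrier T"
      using cls_letter_closed D_x ij Q_R by auto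
    have "rel i j \<in> rels" using ij unfolding rels_def by (intro image_eqI[of _ _ "(i, j)"]) auto
    then have "rel i j \<in> J" unfolding J_def using ring.genideal_self[OF T_ring rels_closed] by blast
    then have "\<gamma> (t\<nu> (x j) \<otimes>\<^bsub>T\<^esub> t\<nu> (x i)) = \<gamma> (t\<beta> (Q j i) \<otimes>\<^bsub>T\<^esub> (t\<nu> (x i) \<otimes>\<^bsub>T\<^esub> t\<nu> (x j)))"
      unfolding \<gamma>_def rel_def using cl by (intro ring.coset_eqI[OF T_ring J_ideal]) auto
    then show ?thesis using cl by (simp add: b\<beta>_def bx_def)
  qed
  show ?thesis unfolding quantum_vars_def quantum_vars_axioms_def
    using b\<beta>_hom R_cring Q_R central swap D_x cls_letter_closed by (auto simp: bx_def)
qed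

abbreviation bmon where "bmon \<equiv> std_monomial B n bx"

lemma bmon_closed: "bmon \<alpha> \<in> carrier B"
  by (rule quantum_vars.std_monomial_closed[OF B_vars])

lemma b\<beta>_closed: "r \<in> R \<Longrightarrow> b\<beta> r \<in> carrier B"
  using ring_hom_closed[OF ring_hom_ring.homh[OF b\<beta>_hom]] by simp

lemma b\<beta>_zero: "b\<beta> \<zero> = \<zero>\<^bsub>B\<^esub>"
proof -
  interpret h: ring_hom_ring RR B b\<beta> by (rule b\<beta>_hom)
  show ?thesis using h.hom_zero by simp
qed

text \<open>
  The section of \<open>T / J \<rightarrow> A\<close> given by the standard monomials. It agrees with the projection on every word,
  because words can be straightened in \<open>T / J\<close>; so the kernel of \<open>T \<rightarrow> A\<close> is \<open>J\<close>.
\<close>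

definition \<sigma> where "\<sigma> a = (\<Oplus>\<^bsub>B\<^esub>\<alpha>\<in>{\<alpha>. cf a \<alpha> \<noteq> \<zero>}. b\<beta> (cf a \<alpha>) \<otimes>\<^bsub>B\<^esub> bmon \<alpha>)"

lemma \<sigma>_superset:
  assumes a: "a \<in> carrier A" and F: "finite F" "{\<alpha>. cf a \<alpha> \<noteq> \<zero>} \<subseteq> F"
  shows "\<sigma> a = (\<Oplus>\<^bsub>B\<^esub>\<alpha>\<in>F. b\<beta> (cf a \<alpha>) \<otimes>\<^bsub>B\<^esub> bmon \<alpha>)"
proof -
  interpret B: ring B by (rule B_ring)
  show ?thesis unfolding \<sigma>_def
    by (rule B.add.finprod_mono_neutral_cong_left)
      (use F in \<open>auto simp: b\<beta>_zero bmon_closed b\<beta>_closed cf_R[OF a]\<close>)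
qed

lemma \<sigma>_closed: "a \<in> carrier A \<Longrightarrow> \<sigma> a \<in> carrier B"
proof -
  assume a: "a \<in> carrier A"
  interpret B: ring B by (rule B_ring)
  show ?thesis unfolding \<sigma>_def by (rule B.finsum_closed) (auto simp: bmon_closed b\<beta>_closed cf_R[OF a])
qed

lemma \<sigma>_add:
  assumes a: "a \<in> carrier A" and b: "b \<in> carrier A"
  shows "\<sigma> (a \<oplus> b) = \<sigma> a \<oplus>\<^bsub>B\<^esub> \<sigma> b"
proof -
  interpret B: ring B by (rule B_ring)
  interpret h: ring_hom_ring RR B b\<beta> by (rule b\<beta>_hom)
  define F where "F = {\<alpha>. cf a \<alpha> \<noteq> \<zero>} \<union> {\<alpha>. cf b \<alpha> \<noteq> \<zero>}"
  have F: "finite F" using cf_finite a b by (auto simp: F_def)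
  have "\<sigma> (a \<oplus> b) = (\<Oplus>\<^bsub>B\<^esub>\<alpha>\<in>F. b\<beta> (cf (a \<oplus> b) \<alpha>) \<otimes>\<^bsub>B\<^esub> bmon \<alpha>)"
    by (rule \<sigma>_superset) (use F a b in \<open>auto simp: F_def cf_add\<close>)
  also have "\<dots> = (\<Oplus>\<^bsub>B\<^esub>\<alpha>\<in>F. b\<beta> (cf a \<alpha>) \<otimes>\<^bsub>B\<^esub> bmon \<alpha> \<oplus>\<^bsub>B\<^esub> b\<beta> (cf b \<alpha>) \<otimes>\<^bsub>B\<^esub> bmon \<alpha>)"
  proof (rule B.finsum_cong')
    fix \<alpha>
    show "b\<beta> (cf (a \<oplus> b) \<alpha>) \<otimes>\<^bsub>B\<^esub> bmon \<alpha> = b\<beta> (cf a \<alpha>) \<otimes>\<^bsub>B\<^esub> bmon \<alpha> \<oplus>\<^bsub>B\<^esub> b\<beta> (cf b \<alpha>) \<otimes>\<^bsub>B\<^esub> bmon \<alpha>"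
      using h.hom_add[of "cf a \<alpha>" "cf b \<alpha>"] cf_R[OF a] cf_R[OF b]
      by (simp add: cf_add a b B.l_distr bmon_closed b\<beta>_closed)
  qed (auto simp: bmon_closed b\<beta>_closed cf_R a b)
  also have "\<dots> = (\<Oplus>\<^bsub>B\<^esub>\<alpha>\<in>F. b\<beta> (cf a \<alpha>) \<otimes>\<^bsub>B\<^esub> bmon \<alpha>) \<oplus>\<^bsub>B\<^esub> (\<Oplus>\<^bsub>B\<^esub>\<alpha>\<in>F. b\<beta> (cf b \<alpha>) \<otimes>\<^bsub>B\<^esub> bmon \<alpha>)"
    by (rule B.finsum_addf) (auto simp: bmon_closed b\<beta>_closed cf_R a b)
  also have "(\<Oplus>\<^bsub>B\<^esub>\<alpha>\<in>F. b\<beta> (cf a \<alpha>) \<otimes>\<^bsub>B\<^esub> bmon \<alpha>) = \<sigma> a"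
    by (rule \<sigma>_superset[symmetric]) (use F a in \<open>auto simp: F_def\<close>)
  also have "(\<Oplus>\<^bsub>B\<^esub>\<alpha>\<in>F. b\<beta> (cf b \<alpha>) \<otimes>\<^bsub>B\<^esub> bmon \<alpha>) = \<sigma> b"
    by (rule \<sigma>_superset[symmetric]) (use F b in \<open>auto simp: F_def\<close>)
  finally show ?thesis .
qed

lemma \<sigma>_zero: "\<sigma> \<zero> = \<zero>\<^bsub>B\<^esub>"
proof -
  interpret B: ring B by (rule B_ring)
  show ?thesis by (simp add: \<sigma>_def cf_zero)
qed

lemma \<sigma>_finsum: "(\<And>i. i \<in> F \<Longrightarrow> f i \<in> carrier A) \<Longrightarrow> \<sigma> (finsum A f F) = (\<Oplus>\<^bsub>B\<^esub>i\<in>F. \<sigma> (f i))"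
proof (induction F rule: infinite_finite_induct)
  interpret B: ring B by (rule B_ring)
  {
    case (infinite F) then show ?case by (simp add: \<sigma>_zero)
  next
    case empty then show ?case by (simp add: \<sigma>_zero)
  next
    case (insert i F)
    then have "f \<in> F \<rightarrow> carrier A" "f i \<in> carrier A" by auto
    with insert show ?case by (subst B.finsum_insert) (auto simp: \<sigma>_add \<sigma>_closed)
  }
qed

lemma \<sigma>_R: "r \<in> R \<Longrightarrow> \<sigma> r = b\<beta> r"
proof -
  assume r: "r \<in> R"
  interpret B: ring B by (rule B_ring)
  have "\<sigma> r = (\<Oplus>\<^bsub>B\<^esub>\<alpha>\<in>{\<lambda>_. 0}. b\<beta> (cf r \<alpha>) \<otimes>\<^bsub>B\<^esub> bmon \<alpha>)"
    by (rule \<sigma>_superset) (auto simp: R_sub[OF r] cf_const[OF r])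
  then show ?thesis using r by (simp add: cf_const b\<beta>_closed B.monomial_zero)
qed

lemma \<sigma>_smult:
  assumes a: "a \<in> carrier A" and r: "r \<in> R"
  shows "\<sigma> (r \<otimes> a) = b\<beta> r \<otimes>\<^bsub>B\<^esub> \<sigma> a"
proof -
  interpret B: ring B by (rule B_ring)
  interpret h: ring_hom_ring RR B b\<beta> by (rule b\<beta>_hom)
  have "\<sigma> (r \<otimes> a) = (\<Oplus>\<^bsub>B\<^esub>\<alpha>\<in>{\<alpha>. cf a \<alpha> \<noteq> \<zero>}. b\<beta> (cf (r \<otimes> a) \<alpha>) \<otimes>\<^bsub>B\<^esub> bmon \<alpha>)"
    by (rule \<sigma>_superset) (use a R_sub[OF r] in \<open>auto simp: cf_smult r cf_finite\<close>)
  also have "\<dots> = (\<Oplus>\<^bsub>B\<^esub>\<alpha>\<in>{\<alpha>. cf a \<alpha> \<noteq> \<zero>}. b\<beta> r \<otimes>\<^bsub>B\<^esub> (b\<beta> (cf a \<alpha>) \<otimes>\<^bsub>B\<^esub> bmon \<alpha>))"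
  proof (rule B.finsum_cong')
    fix \<alpha>
    show "b\<beta> (cf (r \<otimes> a) \<alpha>) \<otimes>\<^bsub>B\<^esub> bmon \<alpha> = b\<beta> r \<otimes>\<^bsub>B\<^esub> (b\<beta> (cf a \<alpha>) \<otimes>\<^bsub>B\<^esub> bmon \<alpha>)"
      using h.hom_mult[of r "cf a \<alpha>"] cf_R[OF a] r
      by (simp add: cf_smult a B.m_assoc bmon_closed b\<beta>_closed)
  qed (auto simp: bmon_closed b\<beta>_closed cf_R a r)
  also have "\<dots> = b\<beta> r \<otimes>\<^bsub>B\<^esub> \<sigma> a"
    unfolding \<sigma>_def by (rule B.finsum_rdistr[symmetric]) (auto simp: cf_finite bmon_closed b\<beta>_closed cf_R a r)
  finally show ?thesis .
qed

text \<open>Centrality is stated on the image of \<open>\<sigma>\<close>; straightening multiplies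
  only elements of this form by scalars.\<close>

lemma b\<beta>_central:
  assumes a: "a \<in> carrier A" and r: "r \<in> R"
  shows "\<sigma> a \<otimes>\<^bsub>B\<^esub> b\<beta> r = b\<beta> r \<otimes>\<^bsub>B\<^esub> \<sigma> a"
proof -
  interpret B: ring B by (rule B_ring)
  interpret h: ring_hom_ring RR B b\<beta> by (rule b\<beta>_hom)
  have "\<sigma> a \<otimes>\<^bsub>B\<^esub> b\<beta> r = (\<Oplus>\<^bsub>B\<^esub>\<alpha>\<in>{\<alpha>. cf a \<alpha> \<noteq> \<zero>}. b\<beta> (cf a \<alpha>) \<otimes>\<^bsub>B\<^esub> bmon \<alpha> \<otimes>\<^bsub>B\<^esub> b\<beta> r)"
    unfolding \<sigma>_def by (rule B.finsum_ldistr) (auto simp: cf_finite bmon_closed b\<beta>_closed cf_R a r)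
  also have "\<dots> = (\<Oplus>\<^bsub>B\<^esub>\<alpha>\<in>{\<alpha>. cf a \<alpha> \<noteq> \<zero>}. b\<beta> r \<otimes>\<^bsub>B\<^esub> (b\<beta> (cf a \<alpha>) \<otimes>\<^bsub>B\<^esub> bmon \<alpha>))"
  proof (rule B.finsum_cong')
    fix \<alpha>
    have c: "cf a \<alpha> \<in> R" by (rule cf_R[OF a])
    note cl = b\<beta>_closed[OF c] b\<beta>_closed[OF r] bmon_closed[of \<alpha>]
    have "b\<beta> (cf a \<alpha>) \<otimes>\<^bsub>B\<^esub> bmon \<alpha> \<otimes>\<^bsub>B\<^esub> b\<beta> r = b\<beta> (cf a \<alpha>) \<otimes>\<^bsub>B\<^esub> (b\<beta> r \<otimes>\<^bsub>B\<^esub> bmon \<alpha>)"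
      using quantum_vars.std_monomial_central[OF B_vars, of r \<alpha>] r cl by (simp add: B.m_assoc)
    also have "\<dots> = (b\<beta> (cf a \<alpha>) \<otimes>\<^bsub>B\<^esub> b\<beta> r) \<otimes>\<^bsub>B\<^esub> bmon \<alpha>" using cl by (simp add: B.m_assoc)
    also have "b\<beta> (cf a \<alpha>) \<otimes>\<^bsub>B\<^esub> b\<beta> r = b\<beta> r \<otimes>\<^bsub>B\<^esub> b\<beta> (cf a \<alpha>)"
      using h.hom_mult[of r "cf a \<alpha>"] h.hom_mult[of "cf a \<alpha>" r] r c R_comm[OF r c] by simp
    finally show "b\<beta> (cf a \<alpha>) \<otimes>\<^bsub>B\<^esub> bmon \<alpha> \<otimes>\<^bsub>B\<^esub> b\<beta> r = b\<beta> r \<otimes>\<^bsub>B\<^esub> (b\<beta> (cf a \<alpha>) \<otimes>\<^bsub>B\<^esub> bmon \<alpha>)"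
      using cl by (simp add: B.m_assoc)
  qed (auto simp: bmon_closed b\<beta>_closed cf_R a r)
  also have "\<dots> = b\<beta> r \<otimes>\<^bsub>B\<^esub> \<sigma> a"
    unfolding \<sigma>_def by (rule B.finsum_rdistr[symmetric]) (auto simp: cf_finite bmon_closed b\<beta>_closed cf_R a r)
  finally show ?thesis .
qed

lemma bx_closed: "i \<in> {1..n} \<Longrightarrow> bx i \<in> carrier B"
  using ring_hom_closed[OF ring_hom_ring.homh[OF \<gamma>_hom]] cls_letter_closed(2)[OF D_x] by (simp add: bx_def)

text \<open>The straightening step. The same twist arises in \<open>A\<close>, through
  \<open>cf_mult_x\<close>, and in \<open>T Quot J\<close>, through
  \<open>std_monomial_mult_var\<close>, because both rings satisfy \<open>quantum_vars\<close> with
  the same \<open>Q\<close>.\<close>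

lemma \<sigma>_mult_x:
  assumes a: "a \<in> carrier A" and i: "i \<in> {1..n}"
  shows "\<sigma> (a \<otimes> x i) = \<sigma> a \<otimes>\<^bsub>B\<^esub> bx i"
proof -
  interpret B: ring B by (rule B_ring)
  interpret h: ring_hom_ring RR B b\<beta> by (rule b\<beta>_hom)
  define F where "F = {\<alpha>. cf a \<alpha> \<noteq> \<zero>}"
  have F: "finite F" using cf_finite a by (auto simp: F_def)
  have ax: "a \<otimes> x i \<in> carrier A" using a x_closed[OF i] by simp
  have sub: "{\<alpha>. cf (a \<otimes> x i) \<alpha> \<noteq> \<zero>} \<subseteq> (\<lambda>\<alpha>. incr \<alpha> i) ` F"
  proof
    fix \<alpha> assume "\<alpha> \<in> {\<alpha>. cf (a \<otimes> x i) \<alpha> \<noteq> \<zero>}"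
    then have "\<alpha> i \<noteq> 0" "cf a (decr \<alpha> i) \<noteq> \<zero>"
      using R_sub[OF tw_R[OF i]] by (auto simp: cf_mult_x[OF a i] split: if_splits)
    then have "\<alpha> = incr (decr \<alpha> i) i" "decr \<alpha> i \<in> F" by (auto simp: F_def)
    then show "\<alpha> \<in> (\<lambda>\<alpha>. incr \<alpha> i) ` F" by (rule image_eqI)
  qed
  have "\<sigma> (a \<otimes> x i) = (\<Oplus>\<^bsub>B\<^esub>\<alpha>\<in>(\<lambda>\<alpha>. incr \<alpha> i) ` F. b\<beta> (cf (a \<otimes> x i) \<alpha>) \<otimes>\<^bsub>B\<^esub> bmon \<alpha>)"
    by (rule \<sigma>_superset[OF ax _ sub]) (use F in simp)
  also have "\<dots> = (\<Oplus>\<^bsub>B\<^esub>\<alpha>\<in>F. b\<beta> (cf (a \<otimes> x i) (incr \<alpha> i)) \<otimes>\<^bsub>B\<^esub> bmon (incr \<alpha> i))"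
    by (rule B.finsum_reindex)
      (auto simp: bmon_closed b\<beta>_closed cf_R[OF ax] intro: inj_on_subset[OF inj_incr])
  also have "\<dots> = (\<Oplus>\<^bsub>B\<^esub>\<alpha>\<in>F. b\<beta> (cf a \<alpha>) \<otimes>\<^bsub>B\<^esub> bmon \<alpha> \<otimes>\<^bsub>B\<^esub> bx i)"
  proof (rule B.finsum_cong')
    fix \<alpha>
    have c: "cf a \<alpha> \<in> R" "tw \<alpha> i \<in> R" using cf_R[OF a] tw_R[OF i] by auto
    have "cf (a \<otimes> x i) (incr \<alpha> i) = tw \<alpha> i \<otimes> cf a \<alpha>" by (simp add: cf_mult_x[OF a i])
    then have "cf (a \<otimes> x i) (incr \<alpha> i) = cf a \<alpha> \<otimes> tw \<alpha> i" using R_comm[OF c] by simp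
    then show "b\<beta> (cf (a \<otimes> x i) (incr \<alpha> i)) \<otimes>\<^bsub>B\<^esub> bmon (incr \<alpha> i) = b\<beta> (cf a \<alpha>) \<otimes>\<^bsub>B\<^esub> bmon \<alpha> \<otimes>\<^bsub>B\<^esub> bx i"
      using h.hom_mult[of "cf a \<alpha>" "tw \<alpha> i"] c b\<beta>_closed bmon_closed bx_closed[OF i]
        quantum_vars.std_monomial_mult_var[OF B_vars i, of \<alpha>]
      by (simp add: B.m_assoc del: fun_upd_apply)
  qed (auto simp: bmon_closed b\<beta>_closed cf_R a bx_closed[OF i])
  also have "\<dots> = \<sigma> a \<otimes>\<^bsub>B\<^esub> bx i"
    unfolding \<sigma>_def F_def
    by (rule B.finsum_ldistr[symmetric]) (auto simp: cf_finite bmon_closed b\<beta>_closed cf_R a bx_closed[OF i])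
  finally show ?thesis .
qed

text \<open>A letter from the bimodule may be any element of \<open>D 1\<close>; additivity and the
  left action in the tensor relations reduce it to the n variables.\<close>

lemma \<gamma>_t\<nu>:
  assumes u: "u \<in> D 1"
  shows "\<gamma> (t\<nu> u) = (\<Oplus>\<^bsub>B\<^esub>i\<in>{1..n}. b\<beta> (cf u (unit_exp i)) \<otimes>\<^bsub>B\<^esub> bx i)"
proof -
  interpret \<gamma>: ring_hom_ring T B \<gamma> by (rule \<gamma>_hom)
  have c: "cf u \<alpha> \<in> R" for \<alpha> using u D_closed cf_R by auto
  have cl: "t\<beta> (cf u (unit_exp i)) \<in> carrier T" "t\<nu> (x i) \<in> carrier T" if "i \<in> {1..n}" for i
    using cls_letter_closed c D_x that by auto
  have "t\<nu> u = t\<nu> (\<Oplus>i\<in>{1..n}. cf u (unit_exp i) \<otimes> x i)"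
    by (subst D1_expand[OF u]) (rule refl)
  also have "\<dots> = (\<Oplus>\<^bsub>T\<^esub>i\<in>{1..n}. t\<nu> (cf u (unit_exp i) \<otimes> x i))"
    by (rule t\<nu>_finsum) (use c D_x D_smult in auto)
  also have "\<dots> = (\<Oplus>\<^bsub>T\<^esub>i\<in>{1..n}. t\<beta> (cf u (unit_exp i)) \<otimes>\<^bsub>T\<^esub> t\<nu> (x i))"
    by (rule \<gamma>.R.finsum_cong') (use cl c D_x in \<open>auto simp: t_relations(5)\<close>)
  finally have "\<gamma> (t\<nu> u) = (\<Oplus>\<^bsub>B\<^esub>i\<in>{1..n}. \<gamma> (t\<beta> (cf u (unit_exp i)) \<otimes>\<^bsub>T\<^esub> t\<nu> (x i)))"
    using cl by (simp add: \<gamma>.hom_finsum comp_def)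
  also have "\<dots> = (\<Oplus>\<^bsub>B\<^esub>i\<in>{1..n}. b\<beta> (cf u (unit_exp i)) \<otimes>\<^bsub>B\<^esub> bx i)"
    by (rule \<gamma>.S.finsum_cong') (use cl in \<open>auto simp: b\<beta>_def bx_def\<close>)
  finally show ?thesis .
qed

lemma \<sigma>_mult_D1:
  assumes a: "a \<in> carrier A" and u: "u \<in> D 1"
  shows "\<sigma> (a \<otimes> u) = \<sigma> a \<otimes>\<^bsub>B\<^esub> \<gamma> (t\<nu> u)"
proof -
  interpret B: ring B by (rule B_ring)
  have c: "cf u \<alpha> \<in> R" for \<alpha> using u D_closed cf_R by auto
  note cl = R_sub[OF c] x_closed a b\<beta>_closed[OF c] bx_closed \<sigma>_closed[OF a]
  have "a \<otimes> u = a \<otimes> (\<Oplus>i\<in>{1..n}. cf u (unit_exp i) \<otimes> x i)"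
    by (subst D1_expand[OF u]) (rule refl)
  also have "\<dots> = (\<Oplus>i\<in>{1..n}. a \<otimes> (cf u (unit_exp i) \<otimes> x i))"
    by (rule finsum_rdistr) (use cl in auto)
  finally have "\<sigma> (a \<otimes> u) = \<sigma> (\<Oplus>i\<in>{1..n}. a \<otimes> (cf u (unit_exp i) \<otimes> x i))" by (rule arg_cong)
  also have "\<dots> = (\<Oplus>\<^bsub>B\<^esub>i\<in>{1..n}. \<sigma> (a \<otimes> (cf u (unit_exp i) \<otimes> x i)))"
    by (rule \<sigma>_finsum) (use cl in auto)
  also have "\<dots> = (\<Oplus>\<^bsub>B\<^esub>i\<in>{1..n}. \<sigma> a \<otimes>\<^bsub>B\<^esub> (b\<beta> (cf u (unit_exp i)) \<otimes>\<^bsub>B\<^esub> bx i))"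
  proof (rule B.finsum_cong')
    fix i assume i: "i \<in> {1..n}"
    have "a \<otimes> (cf u (unit_exp i) \<otimes> x i) = cf u (unit_exp i) \<otimes> (a \<otimes> x i)"
      using R_central[OF c a, of "unit_exp i"] cl i by (simp add: m_assoc[symmetric])
    then have "\<sigma> (a \<otimes> (cf u (unit_exp i) \<otimes> x i)) = b\<beta> (cf u (unit_exp i)) \<otimes>\<^bsub>B\<^esub> (\<sigma> a \<otimes>\<^bsub>B\<^esub> bx i)"
      using cl i by (simp add: \<sigma>_smult[OF _ c] \<sigma>_mult_x)
    then show "\<sigma> (a \<otimes> (cf u (unit_exp i) \<otimes> x i)) = \<sigma> a \<otimes>\<^bsub>B\<^esub> (b\<beta> (cf u (unit_exp i)) \<otimes>\<^bsub>B\<^esub> bx i)"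
      using b\<beta>_central[OF a c, of "unit_exp i"] cl i by (simp add: B.m_assoc[symmetric])
  qed (use cl in auto)
  also have "\<dots> = \<sigma> a \<otimes>\<^bsub>B\<^esub> \<gamma> (t\<nu> u)"
    unfolding \<gamma>_t\<nu>[OF u] by (rule B.finsum_rdistr[symmetric]) (use cl in auto)
  finally show ?thesis .
qed

text \<open>Letters are appended at the right end, since the section is known to respect
  multiplication by generators on that side.\<close>

lemma \<gamma>_cls_word: "set ls \<subseteq> L \<Longrightarrow> \<gamma> (cls (word ls)) = \<sigma> (word_eval A \<phi> ls)"
proof (induction ls rule: rev_induct)
  case Nil
  interpret \<gamma>: ring_hom_ring T B \<gamma> by (rule \<gamma>_hom)
  interpret cls: ring_hom_ring FF T cls by (rule cls_hom)
  show ?case using cls.hom_one \<sigma>_R[OF R_one]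
    by (simp add: free_ring_one word_eval_def b\<beta>_def t_relations(1))
next
  case (snoc l ls)
  interpret \<gamma>: ring_hom_ring T B \<gamma> by (rule \<gamma>_hom)
  interpret cls: ring_hom_ring FF T cls by (rule cls_hom)
  have l: "l \<in> L" and ls: "set ls \<subseteq> L" using snoc.prems by auto
  have ev: "word_eval A \<phi> ls \<in> carrier A" by (rule eval_closed[OF \<phi>_closed ls])
  have evs: "word_eval A \<phi> (ls @ [l]) = word_eval A \<phi> ls \<otimes> \<phi> l"
    using word_eval_append[of ls "[l]" \<phi>] \<phi>_closed ls l by (auto simp: word_eval_def)
  have "cls (word (ls @ [l])) = cls (word ls) \<otimes>\<^bsub>T\<^esub> cls (letter l)"
    unfolding letter_eq_word word_mult[where u = ls and v = "[l]" and L = L, symmetric]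
    using ls l by (intro cls.hom_mult) (auto intro: word_closed)
  then have g: "\<gamma> (cls (word (ls @ [l]))) = \<sigma> (word_eval A \<phi> ls) \<otimes>\<^bsub>B\<^esub> \<gamma> (cls (letter l))"
    using snoc.IH[OF ls] ls l by (simp add: word_closed letter_closed)
  show ?case
  proof (cases l)
    case (Inl r)
    then have r: "r \<in> R" using l by simp
    have "\<sigma> (word_eval A \<phi> ls \<otimes> r) = \<sigma> (word_eval A \<phi> ls) \<otimes>\<^bsub>B\<^esub> b\<beta> r"
      using R_central[OF r ev] \<sigma>_smult[OF ev r] b\<beta>_central[OF ev r] by simp
    then show ?thesis using g evs Inl by (simp add: b\<beta>_def)
  next
    case (Inr u)
    then have "u \<in> D 1" using l by simp
    then show ?thesis using g evs Inr \<sigma>_mult_D1[OF ev] by simp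
  qed
qed

lemma \<gamma>_cls:
  assumes f: "f \<in> carrier FF"
  shows "\<gamma> (cls f) = \<sigma> (\<psi> f)"
proof -
  interpret \<gamma>: ring_hom_ring T B \<gamma> by (rule \<gamma>_hom)
  interpret cls: ring_hom_ring FF T cls by (rule cls_hom)
  interpret \<psi>: ring_hom_ring FF A \<psi> by (rule \<psi>_hom)
  note add = cls.hom_add \<psi>.hom_add
  show ?thesis
  proof (rule free_ring_additive_eq[OF \<gamma>.S.is_abelian_group f])
    fix ls :: "('a + 'a) list" assume "set ls \<subseteq> L"
    then show "\<gamma> (cls (word ls)) = \<sigma> (\<psi> (word ls))"
      using \<gamma>_cls_word by (simp add: free_eval_word[OF \<phi>_closed])
  qed (simp_all add: \<sigma>_closed \<sigma>_add add[unfolded free_ring_add])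
qed

text \<open>An element t of the kernel satisfies \<gamma> t = \<sigma> (\<Phi> t) = \<sigma> 0 = 0,
  so it already lies in \<open>J\<close>. The finite generation of the kernel comes from
  here.\<close>

lemma I_eq_J: "I = J"
proof
  show "I \<subseteq> J"
  proof
    fix t assume "t \<in> I"
    then obtain f where f: "f \<in> carrier FF" "t = cls f" "\<Phi> t = \<zero>" "t \<in> carrier T" by (auto simp: I_iff T_carrier)
    then have "\<gamma> t = \<zero>\<^bsub>B\<^esub>" using \<gamma>_cls \<Phi>_cls \<sigma>_zero by simp
    then have "J +>\<^bsub>T\<^esub> t = J" by (simp add: \<gamma>_def FactRing_def)
    then show "t \<in> J" using ideal.rcos_const_imp_mem[OF J_ideal f(4)] by simp
  qed
qed (rule J_I)

end

section \<open>Homogeneity of the kernel and the compatible grading\<close>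

lemma homogeneous_zero: "homogeneous k (\<lambda>_. 0)"
  and homogeneous_add: "\<lbrakk>homogeneous k f; homogeneous k g\<rbrakk> \<Longrightarrow> homogeneous k (\<lambda>w. f w + g w)"
  and homogeneous_word: "homogeneous (wt w) (word w)"
  by (auto simp: homogeneous_def word_def) (metis add_0)

context quantum_affine
begin

lemma word_eval_Cons: "word_eval A \<phi> (l # ls) = \<phi> l \<otimes> word_eval A \<phi> ls"
  by (simp add: word_eval_def)

lemma word_eval_D: "set ls \<subseteq> L \<Longrightarrow> word_eval A \<phi> ls \<in> D (wt ls)"
proof (induction ls)
  case Nil then show ?case using D_R[OF R_one] by (simp add: word_eval_def)
next
  case (Cons l ls)
  then show ?case using D_mult[OF D_R, of _ "word_eval A \<phi> ls" "wt ls"] D_mult[of _ 1 "word_eval A \<phi> ls" "wt ls"]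
    by (cases l) (auto simp: word_eval_Cons plus_1_eq_Suc)
qed

lemma \<psi>_homogeneous:
  assumes f: "f \<in> carrier FF" and hom: "homogeneous k f"
  shows "\<psi> f \<in> D k"
proof -
  interpret \<psi>: ring_hom_ring FF A \<psi> by (rule \<psi>_hom)
  have "f \<in> {f \<in> carrier FF. \<psi> f \<in> D k}"
  proof (rule free_ring_span)
    show "finite {ls. f ls \<noteq> 0}" using f by (simp add: free_ring_carrier)
    fix ls assume "f ls \<noteq> 0"
    then have "set ls \<subseteq> L" "wt ls = k" using f hom by (auto simp: free_ring_carrier homogeneous_def)
    then show "word ls \<in> {f \<in> carrier FF. \<psi> f \<in> D k}"
      using word_eval_D by (auto simp: word_closed free_eval_word[OF \<phi>_closed])
  next
    show "(\<lambda>_. 0) \<in> {f \<in> carrier FF. \<psi> f \<in> D k}"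
      using \<psi>.hom_zero \<psi>.R.zero_closed by (simp add: free_ring_zero D_zero)
  next
    fix g g' assume "g \<in> {f \<in> carrier FF. \<psi> f \<in> D k}" "g' \<in> {f \<in> carrier FF. \<psi> f \<in> D k}"
    then show "(\<lambda>ls. g ls + g' ls) \<in> {f \<in> carrier FF. \<psi> f \<in> D k}"
      using \<psi>.hom_add[of g g'] \<psi>.R.a_closed[of g g'] by (simp add: free_ring_add D_add)
  next
    fix g assume "g \<in> {f \<in> carrier FF. \<psi> f \<in> D k}"
    then show "(\<lambda>ls. - g ls) \<in> {f \<in> carrier FF. \<psi> f \<in> D k}"
      using \<psi>.hom_a_inv[of g] \<psi>.R.a_inv_closed[of g] by (simp add: free_ring_neg D_neg)
  qed
  then show ?thesis by simp
qed

lemma mon_word: "\<alpha> \<in> exponents n \<Longrightarrow> \<exists>ls. set ls \<subseteq> L \<and> wt ls = deg \<alpha> \<and> word_eval A \<phi> ls = mon \<alpha>"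
proof (induction rule: exponents_induct)
  case zero
  show ?case by (rule exI[of _ "[]"]) (simp add: word_eval_def monomial_zero deg_zero)
next
  case (incr \<alpha> m)
  then obtain ls where ls: "set ls \<subseteq> L" "wt ls = deg \<alpha>" "word_eval A \<phi> ls = mon \<alpha>" by blast
  have xm: "Inr (x m) \<in> L" using D_x[OF incr.hyps(2)] by simp
  have "word_eval A \<phi> (ls @ [Inr (x m)]) = mon \<alpha> \<otimes> x m"
  proof -
    have "\<phi> l \<in> carrier A" if "l \<in> set ls \<union> set [Inr (x m)]" for l
      using \<phi>_closed ls xm x_closed[OF incr.hyps(2)] that by auto
    from word_eval_append[of ls "[Inr (x m)]" \<phi>, OF this] show ?thesis
      using ls x_closed[OF incr.hyps(2)] by (simp add: word_eval_def)
  qed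
  also have "\<dots> = mon (incr \<alpha> m)"
    by (rule mon_incr_last[symmetric]) (use incr.hyps in auto)
  finally have "set (ls @ [Inr (x m)]) \<subseteq> L \<and> wt (ls @ [Inr (x m)]) = deg (incr \<alpha> m) \<and>
      word_eval A \<phi> (ls @ [Inr (x m)]) = mon (incr \<alpha> m)"
    using ls xm incr.hyps(2) by (simp add: deg_incr del: fun_upd_apply)
  then show ?case by blast
qed

lemma D_\<psi>:
  assumes a: "a \<in> D k"
  shows "\<exists>f\<in>carrier FF. homogeneous k f \<and> \<psi> f = a"
proof -
  interpret \<psi>: ring_hom_ring FF A \<psi> by (rule \<psi>_hom)
  have a': "a \<in> carrier A" using a by (rule D_closed)
  have "\<exists>f\<in>carrier FF. homogeneous k f \<and> \<psi> f = (\<Oplus>\<alpha>\<in>S. cf a \<alpha> \<otimes> mon \<alpha>)"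
    if "finite S" "S \<subseteq> {\<alpha>. cf a \<alpha> \<noteq> \<zero>}" for S
    using that
  proof (induction S rule: finite_induct)
    case empty
    show ?case using \<psi>.hom_zero \<psi>.R.zero_closed homogeneous_zero
      by (intro bexI[of _ "\<zero>\<^bsub>FF\<^esub>"]) (auto simp: free_ring_zero)
  next
    case (insert \<alpha> S)
    then obtain f where f: "f \<in> carrier FF" "homogeneous k f" "\<psi> f = (\<Oplus>\<alpha>\<in>S. cf a \<alpha> \<otimes> mon \<alpha>)" by auto
    have \<alpha>: "\<alpha> \<in> exponents n" "deg \<alpha> = k" using insert.prems a cf_outside[OF a'] by (auto simp: D_def)
    obtain ls where ls: "set ls \<subseteq> L" "wt ls = k" "word_eval A \<phi> ls = mon \<alpha>" using mon_word[OF \<alpha>(1)] \<alpha>(2) by auto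
    \<comment> \<open>The coefficient becomes an additional first letter from \<open>R\<close>,
      which leaves the weight unchanged.\<close>
    define g :: "('a + 'a) list \<Rightarrow> int" where "g = word (Inl (cf a \<alpha>) # ls)"
    have set: "set (Inl (cf a \<alpha>) # ls) \<subseteq> L" using ls cf_R[OF a'] by simp
    have g: "g \<in> carrier FF" "homogeneous k g" "\<psi> g = cf a \<alpha> \<otimes> mon \<alpha>"
      using word_closed[OF set] homogeneous_word[of "Inl (cf a \<alpha>) # ls"] ls
        free_eval_word[OF \<phi>_closed set] by (simp_all add: g_def word_eval_Cons)
    have "\<psi> (g \<oplus>\<^bsub>FF\<^esub> f) = (\<Oplus>\<alpha>\<in>insert \<alpha> S. cf a \<alpha> \<otimes> mon \<alpha>)"
      using f g insert.hyps by (subst finsum_insert) (auto simp: cf_closed a' mon_closed)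
    moreover have "homogeneous k (g \<oplus>\<^bsub>FF\<^esub> f)" using f g homogeneous_add by (simp add: free_ring_add)
    ultimately show ?case using f g by blast
  qed
  from this[OF cf_finite[OF a'] subset_refl] show ?thesis
    using cf_expand[OF a' cf_finite[OF a'] subset_refl] by simp
qed

lemma cls_Cons:
  "\<lbrakk>l \<in> L; set ls \<subseteq> L\<rbrakk> \<Longrightarrow> cls (word (l # ls)) = cls (letter l) \<otimes>\<^bsub>T\<^esub> cls (word ls)"
proof -
  interpret cls: ring_hom_ring FF T cls by (rule cls_hom)
  assume "l \<in> L" "set ls \<subseteq> L"
  then show ?thesis unfolding word_cons[of l ls L] by (intro cls.hom_mult letter_closed word_closed)
qed

lemma cls_word_0: "\<lbrakk>set ls \<subseteq> L; wt ls = 0\<rbrakk> \<Longrightarrow> word_eval A \<phi> ls \<in> R \<and> cls (word ls) = t\<beta> (word_eval A \<phi> ls)"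
proof (induction ls)
  case Nil
  interpret cls: ring_hom_ring FF T cls by (rule cls_hom)
  show ?case using cls.hom_one by (simp add: free_ring_one word_eval_def t_relations R_one)
next
  case (Cons l ls)
  then obtain r where "l = Inl r" "r \<in> R" by (cases l) auto
  then show ?case using Cons by (simp add: cls_Cons word_eval_Cons t_relations R_mult)
qed

text \<open>The scalars before and after the single letter from the bimodule are absorbed by the
  left and the right bimodule relation.\<close>

lemma cls_word_1: "\<lbrakk>set ls \<subseteq> L; wt ls = 1\<rbrakk> \<Longrightarrow> word_eval A \<phi> ls \<in> D 1 \<and> cls (word ls) = t\<nu> (word_eval A \<phi> ls)"
proof (induction ls)
  case Nil then show ?case by simp
next
  case (Cons l ls)
  show ?case
  proof (cases l)
    case (Inl r)
    then have "r \<in> R" using Cons.prems by simp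
    then show ?thesis using Cons Inl by (simp add: cls_Cons word_eval_Cons t_relations D_smult)
  next
    case (Inr u)
    then have "u \<in> D 1" "set ls \<subseteq> L" "wt ls = 0" using Cons.prems by (auto simp: One_nat_def)
    then show ?thesis using cls_word_0[of ls] Inr by (simp add: cls_Cons word_eval_Cons t_relations D_smult_right)
  qed
qed

text \<open>
  Words with at most one letter from \<open>V\<close> collapse to a single letter in the tensor algebra, so the
  map to \<open>A\<close> is injective in degrees \<open>0\<close> and \<open>1\<close>.
\<close>

lemma cls_low_degree:
  assumes f: "f \<in> carrier FF" and k: "k < 2" and hom: "homogeneous k f" and z: "\<psi> f = \<zero>"
  shows "cls f = \<zero>\<^bsub>T\<^esub>"
proof -
  interpret cls: ring_hom_ring FF T cls by (rule cls_hom)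
  interpret \<psi>: ring_hom_ring FF A \<psi> by (rule \<psi>_hom)
  \<comment> \<open>The canonical map from \<open>R\<close> or \<open>V\<close> into the tensor
    algebra, which inverts evaluation in degree k.\<close>
  define t where "t = (if k = 0 then t\<beta> else t\<nu>)"
  have t: "t \<zero> = \<zero>\<^bsub>T\<^esub>" "\<And>a b. \<lbrakk>a \<in> D k; b \<in> D k\<rbrakk> \<Longrightarrow> t (a \<oplus> b) = t a \<oplus>\<^bsub>T\<^esub> t b"
    "\<And>a. a \<in> D k \<Longrightarrow> t a \<in> carrier T"
    using k D_0 less_2_cases[OF k] by (auto simp: t_def t\<beta>_zero t\<nu>_zero t_relations cls_letter_closed One_nat_def)
  have neg: "t (\<ominus> a) = \<ominus>\<^bsub>T\<^esub> t a" if a: "a \<in> D k" for a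
  proof -
    have "t (\<ominus> a) \<oplus>\<^bsub>T\<^esub> t a = \<zero>\<^bsub>T\<^esub>"
      using t(2)[OF D_neg[OF a] a] t(1) a by (simp add: l_neg D_closed)
    then show ?thesis using t(3)[OF a] t(3)[OF D_neg[OF a]] by (simp add: cls.S.minus_equality)
  qed
  \<comment> \<open>Membership of the value in \<open>D k\<close> is carried along because t is
    additive only there.\<close>
  let ?H = "{f \<in> carrier FF. \<psi> f \<in> D k \<and> cls f = t (\<psi> f)}"
  have "f \<in> ?H"
  proof (rule free_ring_span)
    show "finite {ls. f ls \<noteq> 0}" using f by (simp add: free_ring_carrier)
    fix ls assume "f ls \<noteq> 0"
    then have ls: "set ls \<subseteq> L" "wt ls = k" using f hom by (auto simp: free_ring_carrier homogeneous_def)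
    have "word_eval A \<phi> ls \<in> D k \<and> cls (word ls) = t (word_eval A \<phi> ls)"
    proof (cases "k = 0")
      case True
      then show ?thesis using cls_word_0[of ls] ls D_0 by (simp add: t_def)
    next
      case False
      then have "k = 1" using k by simp
      then show ?thesis using cls_word_1[of ls] ls by (simp add: t_def)
    qed
    then show "word ls \<in> ?H" using ls(1) by (simp add: word_closed free_eval_word[OF \<phi>_closed])
  next
    show "(\<lambda>_. 0) \<in> ?H"
      using \<psi>.hom_zero cls.hom_zero cls.R.zero_closed t(1) by (simp add: free_ring_zero D_zero)
  next
    fix g g' assume "g \<in> ?H" "g' \<in> ?H"
    then show "(\<lambda>ls. g ls + g' ls) \<in> ?H"
      using \<psi>.hom_add[of g g'] cls.hom_add[of g g'] cls.R.a_closed[of g g'] t(2)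
      by (simp add: free_ring_add D_add)
  next
    fix g assume "g \<in> ?H"
    then show "(\<lambda>ls. - g ls) \<in> ?H"
      using \<psi>.hom_a_inv[of g] cls.hom_a_inv[of g] cls.R.a_inv_closed[of g] neg
      by (simp add: free_ring_neg D_neg)
  qed
  then show ?thesis using z t(1) by simp
qed

text \<open>The weight parts of f land in different degrees of \<open>A\<close>, so if their sum
  vanishes then each of them does. Hence the kernel is homogeneous.\<close>

lemma weight_parts:
  assumes f: "f \<in> carrier FF"
  shows "cls f = (\<Oplus>\<^bsub>T\<^esub>k\<in>wt ` {ls. f ls \<noteq> 0}. cls (weight_part f k))"
    and "\<psi> f = \<zero> \<Longrightarrow> k \<in> wt ` {ls. f ls \<noteq> 0} \<Longrightarrow> \<psi> (weight_part f k) = \<zero>"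
proof -
  interpret cls: ring_hom_ring FF T cls by (rule cls_hom)
  interpret \<psi>: ring_hom_ring FF A \<psi> by (rule \<psi>_hom)
  let ?K = "wt ` {ls. f ls \<noteq> 0}"
  have K: "finite ?K" using f by (simp add: free_ring_carrier)
  note cl = weight_part_closed[OF f]
  show "cls f = (\<Oplus>\<^bsub>T\<^esub>k\<in>?K. cls (weight_part f k))"
    using cls.hom_finsum[of "weight_part f" ?K] sum_weight_part[OF f] cl by (simp add: comp_def)
  have sum: "\<psi> f = (\<Oplus>k\<in>?K. \<psi> (weight_part f k))"
    using \<psi>.hom_finsum[of "weight_part f" ?K] sum_weight_part[OF f] cl by (simp add: comp_def)
  have D: "\<psi> (weight_part f k) \<in> D k" for k
    by (rule \<psi>_homogeneous[OF cl homogeneous_weight_part])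
  assume z: "\<psi> f = \<zero>" and k: "k \<in> ?K"
  show "\<psi> (weight_part f k) = \<zero>"
  proof (rule cf_eqD)
    fix \<alpha>
    show "cf (\<psi> (weight_part f k)) \<alpha> = cf \<zero> \<alpha>"
    proof (cases "deg \<alpha> = k")
      case True
      have "cf \<zero> \<alpha> = cf (\<Oplus>k\<in>?K. \<psi> (weight_part f k)) \<alpha>" using sum z by simp
      also have "\<dots> = cf (\<psi> (weight_part f k)) \<alpha>"
        using cf_graded_sum[OF K, of "\<lambda>k. \<psi> (weight_part f k)" \<alpha>] D k True by simp
      finally show ?thesis by simp
    next
      case False
      then show ?thesis using D[of k] by (auto simp: D_def cf_zero)
    qed
  qed (use D D_closed in auto)
qed

lemma compatible: "compatible_grading RR A (\<lambda>r. r) Ap D"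
proof -
  interpret \<Phi>: ring_hom_ring T A \<Phi> by (rule \<Phi>_ring_hom)
  interpret I: ideal I T by (rule I_ideal)
  define H where "H = (\<lambda>X. the_elem (\<Phi> ` X))"
  have H: "H (I +>\<^bsub>T\<^esub> t) = \<Phi> t" if "t \<in> carrier T" for t
    using \<Phi>.the_elem_simp[OF that] by (simp add: H_def)
  have power_cl: "tensor_power RR V k \<subseteq> carrier T" for k
    by (auto simp: tensor_power_eq T_carrier)
  have DH: "D k = (\<lambda>t. H (I +>\<^bsub>T\<^esub> t)) ` tensor_power RR V k" for k
  proof (intro equalityI subsetI)
    fix a assume "a \<in> D k"
    then obtain f where f: "f \<in> carrier FF" "homogeneous k f" "\<psi> f = a" using D_\<psi> by blast
    then have "H (I +>\<^bsub>T\<^esub> cls f) = a" using H[of "cls f"] \<Phi>_cls by (simp add: T_carrier)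
    moreover have "cls f \<in> tensor_power RR V k" using f by (auto simp: tensor_power_eq)
    ultimately show "a \<in> (\<lambda>t. H (I +>\<^bsub>T\<^esub> t)) ` tensor_power RR V k" by (intro image_eqI) auto
  next
    fix a assume "a \<in> (\<lambda>t. H (I +>\<^bsub>T\<^esub> t)) ` tensor_power RR V k"
    then obtain f where f: "f \<in> carrier FF" "homogeneous k f" "a = H (I +>\<^bsub>T\<^esub> cls f)"
      by (auto simp: tensor_power_eq)
    then have "a = \<psi> f" using H[of "cls f"] \<Phi>_cls by (simp add: T_carrier)
    then show "a \<in> D k" using \<psi>_homogeneous f by simp
  qed
  have surj: "\<Phi> ` carrier T = carrier A"
  proof
    show "carrier A \<subseteq> \<Phi> ` carrier T"
    proof
      fix a assume a: "a \<in> carrier A"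
      let ?K = "deg ` {\<alpha>. cf a \<alpha> \<noteq> \<zero>}"
      have "\<exists>t\<in>carrier T. \<Phi> t = homog_part a k" for k
      proof -
        obtain f where "f \<in> carrier FF" "\<psi> f = homog_part a k" using D_\<psi>[OF homog_part_D[OF a]] by blast
        then show ?thesis using \<Phi>_cls by (intro bexI[of _ "cls f"]) (auto simp: T_carrier)
      qed
      then obtain t where t: "\<And>k. t k \<in> carrier T" "\<And>k. \<Phi> (t k) = homog_part a k" by metis
      have "\<Phi> (\<Oplus>\<^bsub>T\<^esub>k\<in>?K. t k) = (\<Oplus>k\<in>?K. homog_part a k)"
        using \<Phi>.hom_finsum[of t ?K] t by (simp add: comp_def)
      also have "\<dots> = a" by (rule sum_homog_part) (auto simp: a cf_finite)
      finally have "\<Phi> (\<Oplus>\<^bsub>T\<^esub>k\<in>?K. t k) = a" .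
      then show "a \<in> \<Phi> ` carrier T" using t(1) by (intro image_eqI[of _ _ "\<Oplus>\<^bsub>T\<^esub>k\<in>?K. t k"]) auto
    qed
  qed auto
  have iso: "H \<in> ring_iso (T Quot I) A"
    unfolding H_def by (rule \<Phi>.FactRing_iso_set[OF surj])
  have base: "H (I +>\<^bsub>T\<^esub> tensor_base RR V r) = r" if "r \<in> R" for r
    using H[OF cls_letter_closed(1)[OF that]] \<Phi>_letter(1)[OF that] by (simp add: tensor_base_eq)
  \<comment> \<open>One decomposition gives both requirements on the ideal: it is the sum of its
    homogeneous parts, and it starts in degree 2, because parts of weight 0 and 1 vanish in the
    tensor algebra.\<close>
  have decomposition: "t \<in> component_sum T (\<lambda>k. I \<inter> tensor_power RR V k) {2..}" if t: "t \<in> I" for t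
  proof -
    obtain f where f: "f \<in> carrier FF" "t = cls f" "\<psi> f = \<zero>"
      using t \<Phi>_cls by (auto simp: I_iff T_carrier)
    let ?K = "wt ` {ls. f ls \<noteq> 0}"
    have K: "finite ?K" using f by (simp add: free_ring_carrier)
    note cl = weight_part_closed[OF f(1)]
    have I: "cls (weight_part f k) \<in> I \<inter> tensor_power RR V k" if "k \<in> ?K" for k
      using weight_parts(2)[OF f(1,3) that] cl homogeneous_weight_part[of k f] \<Phi>_cls
      by (auto simp: I_iff T_carrier tensor_power_eq)
    have low: "cls (weight_part f k) = \<zero>\<^bsub>T\<^esub>" if "k \<in> ?K" "k \<notin> {2..}" for k
      using weight_parts(2)[OF f(1,3) that(1)] that(2)
      by (intro cls_low_degree[of _ k]) (auto simp: cl homogeneous_weight_part)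
    have "t = (\<Oplus>\<^bsub>T\<^esub>k\<in>?K. cls (weight_part f k))" using weight_parts(1)[OF f(1)] f(2) by simp
    also have "\<dots> = (\<Oplus>\<^bsub>T\<^esub>k\<in>?K \<inter> {2..}. cls (weight_part f k))"
      by (rule \<Phi>.R.add.finprod_mono_neutral_cong_right) (use K low I I_iff in auto)
    finally show ?thesis unfolding component_sum_def using K I
      by (intro CollectI exI[of _ "?K \<inter> {2..}"] exI[of _ "\<lambda>k. cls (weight_part f k)"]) auto
  qed
  have sum_I: "component_sum T (\<lambda>k. I \<inter> tensor_power RR V k) UNIV \<subseteq> I"
  proof
    fix t assume "t \<in> component_sum T (\<lambda>k. I \<inter> tensor_power RR V k) UNIV"
    then obtain F :: "nat set" and y where F: "t = (\<Oplus>\<^bsub>T\<^esub>i\<in>F. y i)" "finite F" "\<forall>i\<in>F. y i \<in> I"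
      unfolding component_sum_def by auto
    have "(\<Oplus>\<^bsub>T\<^esub>i\<in>F. y i) \<in> I" using F(2,3)
    proof (induction F rule: finite_induct)
      case empty then show ?case using I.zero_closed by simp
    next
      case (insert i F)
      then have "y \<in> F \<rightarrow> carrier T" "y i \<in> carrier T" using I_iff by auto
      with insert show ?case by simp
    qed
    then show "t \<in> I" using F(1) by simp
  qed
  have mono: "component_sum T D1 N1 \<subseteq> component_sum T D2 N2"
    if "N1 \<subseteq> N2" "\<And>k. D1 k \<subseteq> D2 k" for D1 D2 N1 N2
    unfolding component_sum_def using that by blast
  let ?ID = "\<lambda>k. I \<inter> tensor_power RR V k"
  have sub: "I \<subseteq> component_sum T ?ID {2..}" using decomposition by (rule subsetI)
  have c1: "I = component_sum T ?ID UNIV"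
    by (rule equalityI[OF subset_trans[OF sub mono] sum_I]) auto
  have c2: "I \<subseteq> component_sum T (tensor_power RR V) {2..}"
    by (rule subset_trans[OF sub mono]) auto
  have fg: "\<exists>S. finite S \<and> S \<subseteq> carrier T \<and> I = Idl\<^bsub>T\<^esub> S"
    using finite_rels rels_closed I_eq_J J_def by blast
  have "\<exists>(V :: ('a, 'a) bimodule) I h.
        let T = tensor_algebra RR V in
        fin_gen_bimodule RR V \<and>
        ideal I T \<and> (\<exists>S. finite S \<and> S \<subseteq> carrier T \<and> I = Idl\<^bsub>T\<^esub> S) \<and>
        I = component_sum T (\<lambda>n. I \<inter> tensor_power RR V n) UNIV \<and>
        I \<subseteq> component_sum T (tensor_power RR V) {2..} \<and>
        h \<in> ring_iso (T Quot I) A \<and>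
        (\<forall>r\<in>carrier RR. h (I +>\<^bsub>T\<^esub> tensor_base RR V r) = r) \<and>
        (\<forall>n. D n = (\<lambda>t. h (I +>\<^bsub>T\<^esub> t)) ` tensor_power RR V n)"
    unfolding Let_def
    by (intro exI[of _ V] exI[of _ I] exI[of _ H] conjI V_fin_gen I_ideal fg c1 c2 iso allI DH)
      (simp add: base)
  then show ?thesis unfolding compatible_grading_def
    using grading Ap_component_sum by blast
qed

lemma augmented_koszul: "augmented_koszul RR A (\<lambda>r. r)"
  unfolding augmented_koszul_def using central augmentation compatible koszul by blast

end

text \<open>The hypotheses provide scalars only as existing elements or through definite
  descriptions. They are identified by reading off coefficients, at x_i for the action on
  \<open>R\<close> and at x_i x_j for the invertibility of the swap scalars.\<close>

lemma (in pbw_basis) quantum_affineI: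
  assumes cring: "cring (A\<lparr>carrier := R\<rparr>)"
    and quasi: "pbw_quasi_commutative A R n x" and const: "pbw_constant A R n x"
  shows "\<exists>Q. quantum_affine A R n x Q"
proof -
  let ?e = "\<lambda>i. incr (\<lambda>_. 0 :: nat) i"
  have e: "?e i \<in> exponents n" if "i \<in> {1..n}" for i
    by (rule exponents_incr[OF exponents_zero that])
  have cfx: "cf (x i) (?e i) = \<one>" if "i \<in> {1..n}" for i
    using cf_mon[OF e[OF that], of "?e i"] mon_single[OF that] by simp
  have comm: "x i \<otimes> r = r \<otimes> x i" if i: "i \<in> {1..n}" and r: "r \<in> R" for i r
  \<comment> \<open>Quasi-commutativity provides a scalar for nonzero r only.\<close>
  proof (cases "r = \<zero>")
    case True
    then show ?thesis using x_closed[OF i] by simp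
  next
    case False
    then obtain c where c: "c \<in> R" "x i \<otimes> r = c \<otimes> x i"
      using quasi i r unfolding pbw_quasi_commutative_def by blast
    \<comment> \<open>The definite description is pinned down by the coefficient of x_i, to which
      the constant d does not contribute. Constancy of the extension then turns c into r.\<close>
    have "pbw_sigma A R x i r = c"
      unfolding pbw_sigma_def
    proof (rule the_equality)
      show "c \<in> R \<and> (\<exists>d\<in>R. x i \<otimes> r = c \<otimes> x i \<oplus> d)"
        using c R_zero R_sub[OF c(1)] x_closed[OF i] by (auto intro!: bexI[of _ "\<zero>"])
      fix s assume "s \<in> R \<and> (\<exists>d\<in>R. x i \<otimes> r = s \<otimes> x i \<oplus> d)"
      then obtain d where s: "s \<in> R" "d \<in> R" "c \<otimes> x i = s \<otimes> x i \<oplus> d" using c by auto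
      have cc: "cf (c \<otimes> x i) (?e i) = c"
        using cf_smult[OF x_closed[OF i] c(1), of "?e i"] cfx[OF i] R_sub[OF c(1)] by simp
      have "?e i \<noteq> (\<lambda>_. 0)" by (auto simp: fun_eq_iff)
      then have cs: "cf (s \<otimes> x i \<oplus> d) (?e i) = s"
        using cf_add[of "s \<otimes> x i" d "?e i"] cf_smult[OF x_closed[OF i] s(1), of "?e i"] cfx[OF i]
          R_sub[OF s(1)] R_sub[OF s(2)] x_closed[OF i] cf_const[OF s(2), of "?e i"]
        by (simp del: fun_upd_apply)
      show "s = c" using cc unfolding s(3) cs .
    qed
    then show ?thesis using const i r c unfolding pbw_constant_def by simp
  qed
  have "\<forall>i j. \<exists>c. i \<in> {1..n} \<longrightarrow> j \<in> {1..n} \<longrightarrow> c \<in> R \<and> x j \<otimes> x i = c \<otimes> (x i \<otimes> x j)"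
    using quasi unfolding pbw_quasi_commutative_def by blast
  then obtain q where q: "\<And>i j. \<lbrakk>i \<in> {1..n}; j \<in> {1..n}\<rbrakk> \<Longrightarrow>
      q i j \<in> R \<and> x j \<otimes> x i = q i j \<otimes> (x i \<otimes> x j)" by metis
  have unit: "q j i \<otimes> q i j = \<one>" if ij: "i \<in> {1..n}" "j \<in> {1..n}" "i < j" for i j
  proof -
    let ?ij = "incr (?e i) j"
    have mem: "?ij \<in> exponents n" by (rule exponents_incr[OF e[OF ij(1)] ij(2)])
    have pair: "mon ?ij = x i \<otimes> x j" by (rule mon_pair) (use ij in auto)
    have R: "q j i \<in> R" "q i j \<in> R" using q ij by auto
    have "x i \<otimes> x j = q j i \<otimes> (q i j \<otimes> (x i \<otimes> x j))"
      using q[OF ij(1,2)] q[OF ij(2,1)] by metis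
    then have "mon ?ij = (q j i \<otimes> q i j) \<otimes> mon ?ij"
      unfolding pair using R R_sub x_closed ij by (simp add: m_assoc)
    then have "cf (mon ?ij) ?ij = cf ((q j i \<otimes> q i j) \<otimes> mon ?ij) ?ij" by (rule arg_cong)
    then show ?thesis using cf_mon[OF mem, of ?ij] cf_term[OF mem R_mult[OF R], of ?ij] by simp
  qed
  have "\<exists>s\<in>R. s \<otimes> q i j = \<one>" if "i \<in> {1..n}" "j \<in> {1..n}" "i < j" for i j
    using unit[OF that] q that by blast
  \<comment> \<open>The scalar in x_j x_i is \<open>q i j\<close> but has to be presented as
    \<open>Q j i\<close>, hence the exchanged arguments.\<close>
  then have "quantum_affine A R n x (\<lambda>j i. q i j)"
    unfolding quantum_affine_def quantum_affine_axioms_def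
    using pbw_basis_axioms cring comm q by blast
  then show ?thesis by blast
qed

theorem theorem4p11:
  fixes K :: "('k, 'l) ring_scheme"
    and A :: "('a, 'm) ring_scheme"
    and R :: "'a set"
    and \<eta> :: "'k \<Rightarrow> 'a"
    and n :: nat
    and x :: "nat \<Rightarrow> 'a"
  assumes "field K"
    and "cring (A\<lparr>carrier := R\<rparr>)"
    and "augmented_koszul K (A\<lparr>carrier := R\<rparr>) \<eta>"
    and "pbw_semi_commutative A R n x"
  shows "augmented_koszul (A\<lparr>carrier := R\<rparr>) A (\<lambda>r. r)"
proof -
  have quasi: "pbw_quasi_commutative A R n x" and const: "pbw_constant A R n x"
    using assms(4) by (auto simp: pbw_semi_commutative_def)
  then have "pbw_basis A R n x"
    unfolding pbw_quasi_commutative_def skew_pbw_extension_def pbw_basis_def pbw_basis_axioms_def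
    by blast
  then obtain Q where "quantum_affine A R n x Q"
    using pbw_basis.quantum_affineI assms(2) quasi const by blast
  then show ?thesis by (rule quantum_affine.augmented_koszul)
qed

end
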